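(* There is a universal numerical constant $C>0$ (independent of all problem parameters) such that for every $d\ge1$, all Borel probability measures $\mu,\nu$ on $\mathbb{R}^d$, every cost $c$ satisfying the cost assumption with Lipschitz constant $L>0$, every $\varepsilon>0$, every $n\ge 1$, and every $R>0$ such that the diameter of $\mathrm{supp}(\nu)$ is at most $R$, $$\mathbb{E}\big[\|\hat T_\varepsilon-T_\varepsilon\|_{L^2(\hat\mu)}^2\big]\le C R^2\Big(1+\frac1\varepsilon\Big)\sqrt{\frac{\mathcal{N}(\mu,\frac{\varepsilon}{L})\wedge\mathcal{N}(\nu,\frac{\varepsilon}{L})}{n}}.$$
   Context: Cost assumption: $c$ is Borel measurable with $\|c\|_{L^\infty(\mu\otimes\nu)}\le 1$; $|c(x,y)-c(x',y)|\le L\|x-x'\|$ for all $x,x'\in\mathrm{supp}(\mu)$, $y\in\mathrm{supp}(\nu)$; and $|c(x,y)-c(x,y')|\le L\|y-y'\|$ for all $x\in\mathrm{supp}(\mu)$, $y,y'\in\mathrm{supp}(\nu)$. Here $\|\cdot\|$ is the Euclidean norm. For probability measures $P,Q$, the entropic OT problem is $S_\varepsilon(P,Q):=\inf_{\pi\in\Pi(P,Q)}\{\int c\,d\pi+\varepsilon\,\mathrm{KL}(\pi\|P\otimes Q)\}$, where $\Pi(P,Q)$ is the set of couplings of $P$ and $Q$. Samples: $x_1,\dots,x_n\sim\mu$ iid, $y_1,\dots,y_n\sim\nu$ iid, mutually independent; $\hat\mu=\frac1n\sum_i\delta_{x_i}$, $\hat\nu=\frac1n\sum_j\delta_{y_j}$;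 $\mathbb{E}$ is expectation over both samples. $\pi_\varepsilon$ denotes the unique minimizer for $(\mu,\nu)$ and $\hat\pi_\varepsilon$ the unique minimizer for $(\hat\mu,\hat\nu)$. Entropic maps: $T_\varepsilon(x):=\mathbb{E}_{\pi_\varepsilon}[y\mid x]$ and $\hat T_\varepsilon(x):=\mathbb{E}_{\hat\pi_\varepsilon}[y\mid x]=\frac1n\sum_{j}y_j\hat p_\varepsilon(x,y_j)$ for $x\in\{x_1,\dots,x_n\}$, where $\hat p_\varepsilon=\frac{d\hat\pi_\varepsilon}{d(\hat\mu\otimes\hat\nu)}$. For vector-valued $\alpha$, $\|\alpha\|^2_{L^2(P)}=\int\|\alpha\|^2dP$. (The version of $T_\varepsilon$ used is $T_\varepsilon(x)=\int y\,p_\varepsilon(x,y)\,d\nu(y)$ with $p_\varepsilon=\frac{d\pi_\varepsilon}{d(\mu\otimes\nu)}$.) Covering numbers: $\mathcal{N}(\mu,\delta)$ is the minimal number of closed Euclidean balls of radius $\delta$ (centers in $\mathbb{R}^d$) covering $\mathrm{supp}(\mu)$; similarly $\mathcal{N}(\nu,\delta)$. $a\wedge b=\min(a,b)$. *)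

theory Defs
  imports "HOL-Probability.Probability" "HOL-Library.Extended_Nat"
begin

text \<open>
  The constant in the theorem must not depend on the dimension, so the dimension has to be
  quantified inside the formula and cannot be a type. Points of Euclidean d-space are therefore
  extensional functions on \<open>{..<d}\<close>, and the measurable space is the finite product of copies of
  the Borel line, whose sigma-algebra is the Borel sigma-algebra of d-space. The underlying
  measure of \<open>Rd d\<close> is never used; only its \<open>space\<close> and \<open>sets\<close> matter.
\<close>

type_synonym point = "nat \<Rightarrow> real"

definition Rd :: "nat \<Rightarrow> point measure" where
  "Rd d = (\<Pi>\<^sub>M i\<in>{..<d}. borel)"

definition enorm :: "nat \<Rightarrow> point \<Rightarrow> real" where
  "enorm d x = L2_set x {..<d}"

definition edist :: "nat \<Rightarrow> point \<Rightarrow> point \<Rightarrow> real" where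
  "edist d x y = enorm d (\<lambda>i. x i - y i)"

definition borel_prob :: "nat \<Rightarrow> point measure \<Rightarrow> bool" where
  "borel_prob d P \<longleftrightarrow> prob_space P \<and> sets P = sets (Rd d)"

definition supp :: "nat \<Rightarrow> point measure \<Rightarrow> point set" where
  "supp d P = {x \<in> space (Rd d). \<forall>r>0. emeasure P {y \<in> space (Rd d). edist d x y < r} > 0}"

text \<open>The infimum of the empty set of type \<^typ>\<open>enat\<close> is \<open>\<infinity>\<close>: no finite cover exists.\<close>

definition covering_number :: "nat \<Rightarrow> point measure \<Rightarrow> real \<Rightarrow> enat" where
  "covering_number d P \<delta> =
     (INF F \<in> {F. finite F \<and> F \<subseteq> space (Rd d) \<and>
                  supp d P \<subseteq> (\<Union>a\<in>F. {y \<in> space (Rd d). edist d a y \<le> \<delta>})}. enat (card F))"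

definition L2_norm_sq :: "nat \<Rightarrow> point measure \<Rightarrow> (point \<Rightarrow> point) \<Rightarrow> ennreal" where
  "L2_norm_sq d P \<alpha> = (\<integral>\<^sup>+ x. ennreal ((enorm d (\<alpha> x))\<^sup>2) \<partial>P)"

text \<open>
  The library's \<^const>\<open>KL_divergence\<close> takes the reference measure first, and returns junk when the
  log-density does not exist or is not integrable. For probability measures the negative part of
  the log-density is always integrable, so the value is \<open>\<infinity>\<close> in all these cases.
\<close>

definition KL :: "'a measure \<Rightarrow> 'a measure \<Rightarrow> ereal" where
  "KL N M =
     (if absolutely_continuous M N \<and> integrable N (entropy_density (exp 1) M N)
      then ereal (KL_divergence (exp 1) M N) else \<infinity>)"

definition couplings :: "'a measure \<Rightarrow> 'b measure \<Rightarrow> ('a \<times> 'b) measure set" where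
  "couplings P Q =
     {\<pi>. sets \<pi> = sets (P \<Otimes>\<^sub>M Q) \<and> distr \<pi> P fst = P \<and> distr \<pi> Q snd = Q}"

text \<open>
  The cost integral may be junk only for plans that are not absolutely continuous, where the
  \<open>KL\<close> term is \<open>\<infinity>\<close> anyway.
\<close>

definition eot_objective ::
  "('a \<Rightarrow> 'b \<Rightarrow> real) \<Rightarrow> real \<Rightarrow> 'a measure \<Rightarrow> 'b measure \<Rightarrow> ('a \<times> 'b) measure \<Rightarrow> ereal" where
  "eot_objective c \<epsilon> P Q \<pi> = ereal (\<integral>z. c (fst z) (snd z) \<partial>\<pi>) + ereal \<epsilon> * KL \<pi> (P \<Otimes>\<^sub>M Q)"

definition eot_value ::
  "('a \<Rightarrow> 'b \<Rightarrow> real) \<Rightarrow> real \<Rightarrow> 'a measure \<Rightarrow> 'b measure \<Rightarrow> ereal" where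
  "eot_value c \<epsilon> P Q = (INF \<pi>\<in>couplings P Q. eot_objective c \<epsilon> P Q \<pi>)"

definition eot_plan ::
  "('a \<Rightarrow> 'b \<Rightarrow> real) \<Rightarrow> real \<Rightarrow> 'a measure \<Rightarrow> 'b measure \<Rightarrow> ('a \<times> 'b) measure" where
  "eot_plan c \<epsilon> P Q =
     (THE \<pi>. \<pi> \<in> couplings P Q \<and> eot_objective c \<epsilon> P Q \<pi> = eot_value c \<epsilon> P Q)"

definition eot_density ::
  "('a \<Rightarrow> 'b \<Rightarrow> real) \<Rightarrow> real \<Rightarrow> 'a measure \<Rightarrow> 'b measure \<Rightarrow> 'a \<Rightarrow> 'b \<Rightarrow> real" where
  "eot_density c \<epsilon> P Q x y = enn2real (RN_deriv (P \<Otimes>\<^sub>M Q) (eot_plan c \<epsilon> P Q) (x, y))"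

text \<open>
  The density is determined only up to null sets of \<open>P \<Otimes> Q\<close>, hence the map up to null sets of \<open>P\<close>.
  When \<open>P\<close> and \<open>Q\<close> are empirical measures, the density is determined at all pairs of sample points
  and the integral is the average over the \<open>Q\<close>-sample.
\<close>

definition entropic_map ::
  "nat \<Rightarrow> (point \<Rightarrow> point \<Rightarrow> real) \<Rightarrow> real \<Rightarrow> point measure \<Rightarrow> point measure \<Rightarrow> point \<Rightarrow> point" where
  "entropic_map d c \<epsilon> P Q x = (\<lambda>k\<in>{..<d}. \<integral>y. y k * eot_density c \<epsilon> P Q x y \<partial>Q)"

definition cost_assumption ::
  "nat \<Rightarrow> point measure \<Rightarrow> point measure \<Rightarrow> real \<Rightarrow> (point \<Rightarrow> point \<Rightarrow> real) \<Rightarrow> bool" where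
  "cost_assumption d \<mu> \<nu> L c \<longleftrightarrow>
     (\<lambda>(x, y). c x y) \<in> borel_measurable (Rd d \<Otimes>\<^sub>M Rd d) \<and>
     (AE z in \<mu> \<Otimes>\<^sub>M \<nu>. \<bar>c (fst z) (snd z)\<bar> \<le> 1) \<and>
     (\<forall>x\<in>supp d \<mu>. \<forall>x'\<in>supp d \<mu>. \<forall>y\<in>supp d \<nu>. \<bar>c x y - c x' y\<bar> \<le> L * edist d x x') \<and>
     (\<forall>x\<in>supp d \<mu>. \<forall>y\<in>supp d \<nu>. \<forall>y'\<in>supp d \<nu>. \<bar>c x y - c x y'\<bar> \<le> L * edist d y y')"

text \<open>
  The empirical measure is the image of the uniform distribution on indices, so that repeated
  sample points are counted with multiplicity.
\<close>

definition empirical :: "nat \<Rightarrow> nat \<Rightarrow> (nat \<Rightarrow> point) \<Rightarrow> point measure" where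
  "empirical d n x = distr (uniform_count_measure {..<n}) (Rd d) x"

definition sample_law ::
  "nat \<Rightarrow> point measure \<Rightarrow> point measure \<Rightarrow> ((nat \<Rightarrow> point) \<times> (nat \<Rightarrow> point)) measure" where
  "sample_law n \<mu> \<nu> = (\<Pi>\<^sub>M i\<in>{..<n}. \<mu>) \<Otimes>\<^sub>M (\<Pi>\<^sub>M j\<in>{..<n}. \<nu>)"

text \<open>
  The covering numbers are combined in \<^typ>\<open>enat\<close>. The conversion to a real is meaningful whenever
  one of the two supports is bounded and \<open>\<delta> > 0\<close>, since then the minimum is finite.
\<close>

definition min_covering :: "nat \<Rightarrow> point measure \<Rightarrow> point measure \<Rightarrow> real \<Rightarrow> real" where
  "min_covering d \<mu> \<nu> \<delta> = real (the_enat (min (covering_number d \<mu> \<delta>) (covering_number d \<nu> \<delta>)))"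

end

theory Submission
  imports Defs
begin

text \<open>
  Let \<open>p = u v exp (- c / \<epsilon>)\<close> and \<open>q\<close> be the optimal densities for \<open>(\<mu>, \<nu>)\<close> and for the empirical
  measures; the potentials come from Sinkhorn's iteration, which contracts by Birkhoff's theorem, and
  their logarithms are bounded by \<open>2 / \<epsilon>\<close>. On the sample \<open>ln q - ln p\<close> is a sum of a function of
  \<open>x\<close> and a function of \<open>y\<close>, while \<open>q\<close> has exact marginals. So the symmetrised divergence of \<open>q\<close> and
  \<open>p\<close> is at most \<open>4 / \<epsilon>\<close> times the mean absolute defects of the row and column averages of \<open>p\<close>.
  This divergence bounds the squared \<open>L\<^sup>1\<close> distance of the rows of \<open>q\<close> and \<open>p\<close>, hence the distance of
  the empirical map to the plug-in average of \<open>y\<close> against \<open>p\<close>. All remaining terms are fluctuations of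
  averages of independent variables, of order \<open>(\<integral> p\<^sup>2) / n\<close>. Finally \<open>\<integral> p\<^sup>2 \<le> e\<^sup>4 N\<close>: on a ball of radius
  \<open>\<epsilon> / L\<close> the density changes by at most a factor \<open>e\<^sup>4\<close> in one variable, and its integral over
  the ball is at most one.
\<close>

section \<open>Existence of Schroedinger potentials\<close>

text \<open>The obstacle is exponential dependence on \<open>1 / \<epsilon>\<close>: pointwise the
  density \<open>p\<close> is only bounded by \<open>exp (5 / \<epsilon>)\<close>. Therefore the
  potentials enter the estimate through their logarithms, which costs the linear factor
  \<open>1 / \<epsilon>\<close>, and \<open>p\<close> enters through its second moment. The
  empirical density \<open>q\<close> depends on the whole sample, so averages against it are not
  sums of independent terms. The divergence identity eliminates it: what remains are defects of the
  fixed density \<open>p\<close>, multiplied by bounded coefficients. The identity is linear in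
  these defects, whose size is the square root of the second moment of \<open>p\<close> over
  \<open>n\<close>; this is why a square root of \<open>N / n\<close> bounds a squared error. The
  remaining fluctuation terms are quadratic, of order \<open>N / n\<close>, and are absorbed into
  the root when \<open>exp 4 * N \<le> n\<close>; otherwise the trivial bound \<open>4 * R^2\<close>
  is enough. No dimension enters, because coordinates are always summed before the radius
  \<open>R\<close> is used.\<close>

definition pos_bounded :: "'a measure \<Rightarrow> ('a \<Rightarrow> real) \<Rightarrow> bool" where
  "pos_bounded M w \<longleftrightarrow> w \<in> borel_measurable M \<and> (\<exists>\<alpha> \<beta>. 0 < \<alpha> \<and> (\<forall>x\<in>space M. \<alpha> \<le> w x \<and> w x \<le> \<beta>))"

lemma pos_bounded_measurable: "pos_bounded M w \<Longrightarrow> w \<in> borel_measurable M"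
  by (simp add: pos_bounded_def)

lemma pos_bounded_pos: "pos_bounded M w \<Longrightarrow> x \<in> space M \<Longrightarrow> 0 < w x"
  unfolding pos_bounded_def by (meson less_le_trans)

lemma pos_boundedI_limit:
  assumes "\<And>y. y \<in> space M \<Longrightarrow> (\<lambda>n. w n y) \<longlonglongrightarrow> v y" "\<And>n. w n \<in> borel_measurable M"
    "\<And>n y. y \<in> space M \<Longrightarrow> \<alpha> \<le> w n y \<and> w n y \<le> \<beta>" "0 < \<alpha>"
  shows "pos_bounded M v"
proof -
  have "v \<in> borel_measurable M" by (rule borel_measurable_LIMSEQ_real[OF assms(1,2)])
  moreover have "\<alpha> \<le> v y \<and> v y \<le> \<beta>" if y: "y \<in> space M" for y
    using LIMSEQ_le_const[OF assms(1)[OF y]] LIMSEQ_le_const2[OF assms(1)[OF y]] assms(3)[OF y] by blast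
  ultimately show ?thesis using assms(4) unfolding pos_bounded_def by blast
qed

lemma (in prob_space) integrable_bounded:
  fixes f :: "'a \<Rightarrow> real"
  assumes "f \<in> borel_measurable M" "\<And>x. x \<in> space M \<Longrightarrow> \<bar>f x\<bar> \<le> B"
  shows "integrable M f"
  by (rule integrable_const_bound[of _ B]) (use assms in auto)

lemma (in prob_space) integral_bounds:
  fixes f :: "'a \<Rightarrow> real"
  assumes "f \<in> borel_measurable M" "\<And>x. x \<in> space M \<Longrightarrow> a \<le> f x" "\<And>x. x \<in> space M \<Longrightarrow> f x \<le> b"
  shows "a \<le> (\<integral>x. f x \<partial>M)" "(\<integral>x. f x \<partial>M) \<le> b"
proof -
  have i: "integrable M f"
  proof (rule integrable_bounded[OF assms(1)])
    fix x assume "x \<in> space M"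
    with assms(2)[of x] assms(3)[of x] show "\<bar>f x\<bar> \<le> \<bar>a\<bar> + \<bar>b\<bar>" by linarith
  qed
  show "a \<le> (\<integral>x. f x \<partial>M)"
    by (rule integral_ge_const[OF i]) (use assms in auto)
  show "(\<integral>x. f x \<partial>M) \<le> b"
    by (rule integral_le_const[OF i]) (use assms in auto)
qed

lemma (in prob_space) integrable_pos_bounded_mult:
  assumes "pos_bounded M w" "K \<in> borel_measurable M"
    and "\<And>y. y \<in> space M \<Longrightarrow> 0 \<le> K y \<and> K y \<le> b"
  shows "integrable M (\<lambda>y. w y * K y)"
proof -
  obtain \<alpha> \<beta> where w: "0 < \<alpha>" "\<And>x. x\<in>space M \<Longrightarrow> \<alpha> \<le> w x \<and> w x \<le> \<beta>" "w \<in> borel_measurable M"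
    using assms(1) by (auto simp: pos_bounded_def)
  show ?thesis
  proof (rule integrable_bounded[of _ "\<beta> * b"])
    show "(\<lambda>y. w y * K y) \<in> borel_measurable M" using w(3) assms(2) by measurable
    fix y assume y: "y \<in> space M"
    with w(1) w(2)[OF y] have "0 \<le> w y" "w y \<le> \<beta>" "0 \<le> \<beta>" by auto
    with assms(3)[OF y] have "w y * K y \<le> \<beta> * b" "0 \<le> w y * K y"
      by (auto intro!: mult_mono)
    then show "\<bar>w y * K y\<bar> \<le> \<beta> * b" by simp
  qed
qed

text \<open>Birkhoff's contraction, with the distance of two functions measured by \<open>M / m - 1\<close>.\<close>

lemma kernel_average_contraction:
  fixes K :: "'a \<Rightarrow> 'b \<Rightarrow> real"
  assumes Q: "prob_space Q" and ab: "0 < a" "a \<le> b"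
    and K: "\<And>x. x \<in> X \<Longrightarrow> K x \<in> borel_measurable Q"
    and Kab: "\<And>x y. x \<in> X \<Longrightarrow> y \<in> space Q \<Longrightarrow> a \<le> K x y \<and> K x y \<le> b"
    and w: "pos_bounded Q w" "pos_bounded Q w'"
    and mM: "0 < m" "\<And>y. y \<in> space Q \<Longrightarrow> m * w y \<le> w' y \<and> w' y \<le> M * w y"
    and X: "x0 \<in> X"
  shows "\<exists>m' M'. 0 < m' \<and> m' \<le> M' \<and> M' / m' - 1 \<le> (1 - (a / b)\<^sup>2) * (M / m - 1) \<and>
    (\<forall>x\<in>X. m' * (\<integral>y. w y * K x y \<partial>Q) \<le> (\<integral>y. w' y * K x y \<partial>Q)
        \<and> (\<integral>y. w' y * K x y \<partial>Q) \<le> M' * (\<integral>y. w y * K x y \<partial>Q))"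
proof -
  interpret prob_space Q by fact
  define I where "I x = (\<integral>y. w y * K x y \<partial>Q)" for x
  define I' where "I' x = (\<integral>y. w' y * K x y \<partial>Q)" for x
  \<comment> \<open>One factor \<open>a / b\<close> compares numerators at two points of
    \<open>X\<close>, the other one compares denominators.\<close>
  define \<delta> where "\<delta> = (a / b)\<^sup>2"
  have b: "0 < b" using ab by simp
  have \<delta>: "0 < \<delta>" "\<delta> \<le> 1" using ab b by (auto simp: \<delta>_def power_le_one)
  have K0: "0 \<le> K x y \<and> K x y \<le> b" if "x \<in> X" "y \<in> space Q" for x y
    using ab Kab[OF that] by linarith
  have int: "integrable Q (\<lambda>y. w y * K x y)" "integrable Q (\<lambda>y. w' y * K x y)" if "x \<in> X" for x
    using integrable_pos_bounded_mult[OF w(1) K[OF that] K0[OF that]]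
      integrable_pos_bounded_mult[OF w(2) K[OF that] K0[OF that]] by auto
  have Kratio: "(a / b) * K z y \<le> K x y" if "x \<in> X" "z \<in> X" "y \<in> space Q" for x z y
  proof -
    have "(a / b) * K z y \<le> (a / b) * b"
      using ab b Kab[OF that(2,3)] by (intro mult_left_mono) auto
    also have "\<dots> = a" using b by simp
    finally show ?thesis using Kab[OF that(1,3)] by simp
  qed
  have Ipos: "0 < I x" if x: "x \<in> X" for x
  proof -
    obtain \<alpha> \<beta> where al: "0 < \<alpha>" "\<And>x. x\<in>space Q \<Longrightarrow> \<alpha> \<le> w x \<and> w x \<le> \<beta>"
      using w(1) by (auto simp: pos_bounded_def)
    have "\<alpha> * a \<le> I x" unfolding I_def
    proof (rule integral_ge_const[OF int(1)[OF x]], rule AE_I2)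
      fix y assume "y \<in> space Q"
      then show "\<alpha> * a \<le> w y * K x y" using al(1) al(2)[of y] Kab[OF x, of y] ab by (intro mult_mono) auto
    qed
    moreover have "0 < \<alpha> * a" using al(1) ab(1) by simp
    ultimately show ?thesis by linarith
  qed
  \<comment> \<open>For nonnegative \<open>h\<close> the quotient of the averages of
    \<open>h\<close> and \<open>w\<close> at \<open>x\<close> is at least \<delta> times its value
    at \<open>x0\<close>. Used for \<open>h = w' - m * w\<close> and for
    \<open>h = M * w - w'\<close>, this moves both ends of the range of \<open>G\<close>
    inwards.\<close>
  have comp: "\<delta> * (\<integral>y. h y * K x0 y \<partial>Q) / I x0 \<le> (\<integral>y. h y * K x y \<partial>Q) / I x"
    if x: "x \<in> X" and h: "\<And>y. y \<in> space Q \<Longrightarrow> 0 \<le> h y" "\<And>x. x \<in> X \<Longrightarrow> integrable Q (\<lambda>y. h y * K x y)" for x h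
  proof -
    have 1: "(a / b) * (\<integral>y. h y * K x0 y \<partial>Q) \<le> (\<integral>y. h y * K x y \<partial>Q)"
    proof -
      have "(a / b) * (\<integral>y. h y * K x0 y \<partial>Q) = (\<integral>y. (a / b) * (h y * K x0 y) \<partial>Q)" by simp
      also have "\<dots> \<le> (\<integral>y. h y * K x y \<partial>Q)"
      proof (rule integral_mono)
        fix y assume y: "y \<in> space Q"
        have "h y * ((a / b) * K x0 y) \<le> h y * K x y"
          using Kratio[OF x X y] h(1)[OF y] by (rule mult_left_mono)
        then show "a / b * (h y * K x0 y) \<le> h y * K x y" by (simp add: mult_ac)
      qed (use h(2) x X in auto)
      finally show ?thesis .
    qed
    have 2: "(a / b) * I x \<le> I x0"
    proof -
      have "(a / b) * I x = (\<integral>y. (a / b) * (w y * K x y) \<partial>Q)" by (simp add: I_def)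
      also have "\<dots> \<le> I x0" unfolding I_def
      proof (rule integral_mono)
        fix y assume y: "y \<in> space Q"
        have "w y * ((a / b) * K x y) \<le> w y * K x0 y"
          using Kratio[OF X x y] pos_bounded_pos[OF w(1) y] by (intro mult_left_mono) auto
        then show "a / b * (w y * K x y) \<le> w y * K x0 y" by (simp add: mult_ac)
      qed (use int x X in auto)
      finally show ?thesis .
    qed
    define H where "H = (\<integral>y. h y * K x0 y \<partial>Q)"
    have H: "0 \<le> H" unfolding H_def
      using h(1) K0[OF X] by (intro integral_nonneg_AE AE_I2 mult_nonneg_nonneg) auto
    have "\<delta> * H / I x0 = (a / b) * H * ((a / b) / I x0)" by (simp add: \<delta>_def power2_eq_square mult_ac)
    also have "(a / b) / I x0 \<le> 1 / I x"
      using 2 Ipos[OF x] Ipos[OF X] b by (simp add: pos_divide_le_eq pos_le_divide_eq mult_ac)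
    then have "(a / b) * H * ((a / b) / I x0) \<le> (a / b) * H * (1 / I x)"
      using H ab b by (intro mult_left_mono) auto
    also have "\<dots> \<le> (\<integral>y. h y * K x y \<partial>Q) * (1 / I x)"
      using 1 Ipos[OF x] by (intro mult_right_mono) (auto simp: H_def)
    finally show ?thesis by (simp add: H_def)
  qed
  define G where "G x = I' x / I x" for x
  have Gint1: "(\<integral>y. (w' y - m * w y) * K x y \<partial>Q) = I' x - m * I x" if "x \<in> X" for x
  proof -
    have "(\<integral>y. (w' y - m * w y) * K x y \<partial>Q) = (\<integral>y. w' y * K x y - m * (w y * K x y) \<partial>Q)"
      by (simp add: algebra_simps)
    also have "\<dots> = I' x - m * I x" using int[OF that] by (simp add: I_def I'_def)
    finally show ?thesis .
  qed
  have Gint2: "(\<integral>y. (M * w y - w' y) * K x y \<partial>Q) = M * I x - I' x" if "x \<in> X" for x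
  proof -
    have "(\<integral>y. (M * w y - w' y) * K x y \<partial>Q) = (\<integral>y. M * (w y * K x y) - w' y * K x y \<partial>Q)"
      by (simp add: algebra_simps)
    also have "\<dots> = M * I x - I' x" using int[OF that] by (simp add: I_def I'_def)
    finally show ?thesis .
  qed
  have int1: "integrable Q (\<lambda>y. (w' y - m * w y) * K x y)" "integrable Q (\<lambda>y. (M * w y - w' y) * K x y)"
    if "x \<in> X" for x
  proof -
    have "integrable Q (\<lambda>y. w' y * K x y - m * (w y * K x y))" "integrable Q (\<lambda>y. M * (w y * K x y) - w' y * K x y)"
      using int[OF that] by auto
    then show "integrable Q (\<lambda>y. (w' y - m * w y) * K x y)" "integrable Q (\<lambda>y. (M * w y - w' y) * K x y)"
      by (simp_all add: algebra_simps)
  qed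
  have lo: "m + \<delta> * (G x0 - m) \<le> G x" if x: "x \<in> X" for x
  proof -
    have "\<delta> * (I' x0 - m * I x0) / I x0 \<le> (I' x - m * I x) / I x"
      using comp[OF x, of "\<lambda>y. w' y - m * w y"] mM(2) int1(1) by (simp add: Gint1 x X)
    then show ?thesis using Ipos[OF x] Ipos[OF X] by (simp add: G_def field_simps)
  qed
  have hi: "G x \<le> M - \<delta> * (M - G x0)" if x: "x \<in> X" for x
  proof -
    have "\<delta> * (M * I x0 - I' x0) / I x0 \<le> (M * I x - I' x) / I x"
      using comp[OF x, of "\<lambda>y. M * w y - w' y"] mM(2) int1(2) by (simp add: Gint2 x X)
    then show ?thesis using Ipos[OF x] Ipos[OF X] by (simp add: G_def field_simps)
  qed
  \<comment> \<open>The two shifts add up to \<open>\<delta> * (M - m)\<close>, so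
    \<open>M' - m'\<close> is \<open>(1 - \<delta>) * (M - m)\<close>. Dividing by
    \<open>m' \<ge> m\<close> gives the contraction of \<open>M / m - 1\<close> by plain algebra,
    without the logarithm of Hilbert's metric.\<close>
  define m' where "m' = m + \<delta> * (G x0 - m)"
  define M' where "M' = M - \<delta> * (M - G x0)"
  have "m * I x0 \<le> I' x0"
  proof -
    have "0 \<le> (\<integral>y. (w' y - m * w y) * K x0 y \<partial>Q)"
      using mM(2) K0[OF X] by (intro integral_nonneg_AE AE_I2 mult_nonneg_nonneg) auto
    then show ?thesis using Gint1[OF X] by simp
  qed
  then have G0: "m \<le> G x0" using Ipos[OF X] by (simp add: G_def field_simps)
  have mm': "m \<le> m'" using G0 \<delta> by (simp add: m'_def)
  have m': "0 < m'" using mm' mM(1) by simp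
  have le: "m' \<le> M'" using lo[OF X] hi[OF X] by (simp add: m'_def M'_def)
  have "M' - m' = (1 - \<delta>) * (M - m)" by (simp add: m'_def M'_def algebra_simps)
  then have "M' / m' - 1 = (1 - \<delta>) * (M - m) / m'" using m' by (simp add: field_simps)
  also have "\<dots> \<le> (1 - \<delta>) * (M - m) / m"
  proof (rule divide_left_mono[OF mm'])
    show "0 \<le> (1 - \<delta>) * (M - m)" using le \<open>M' - m' = _\<close> by simp
  qed (use m' mM in simp)
  also have "\<dots> = (1 - \<delta>) * (M / m - 1)" using mM(1) by (simp add: field_simps)
  finally have ratio: "M' / m' - 1 \<le> (1 - (a / b)\<^sup>2) * (M / m - 1)" by (simp add: \<delta>_def)
  show ?thesis
  proof (rule exI[of _ m'], rule exI[of _ M'], intro conjI m' le ratio ballI)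
    fix x assume x: "x \<in> X"
    have "m' \<le> G x" "G x \<le> M'" using lo[OF x] hi[OF x] by (auto simp: m'_def M'_def)
    then show "m' * (\<integral>y. w y * K x y \<partial>Q) \<le> (\<integral>y. w' y * K x y \<partial>Q)"
        "(\<integral>y. w' y * K x y \<partial>Q) \<le> M' * (\<integral>y. w y * K x y \<partial>Q)"
      using Ipos[OF x] by (simp_all add: G_def I_def I'_def pos_divide_le_eq pos_le_divide_eq)
  qed
qed

text \<open>Reciprocals turn the interval from \<open>m'\<close> to \<open>M'\<close> into the one
  from \<open>1 / M'\<close> to \<open>1 / m'\<close>. The quotient of the endpoints is unchanged,
  so the averaging step passes its contraction factor on to half a Sinkhorn step.\<close>

lemma reciprocal_average_contraction:
  fixes K :: "'a \<Rightarrow> 'b \<Rightarrow> real"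
  assumes Q: "prob_space Q" and ab: "0 < a" "a \<le> b"
    and K: "\<And>x. x \<in> X \<Longrightarrow> K x \<in> borel_measurable Q"
    and Kab: "\<And>x y. x \<in> X \<Longrightarrow> y \<in> space Q \<Longrightarrow> a \<le> K x y \<and> K x y \<le> b"
    and w: "pos_bounded Q w" "pos_bounded Q w'"
    and mM: "0 < m" "\<And>y. y \<in> space Q \<Longrightarrow> m * w y \<le> w' y \<and> w' y \<le> M * w y"
    and X: "x0 \<in> X"
    and pos: "\<And>x. x \<in> X \<Longrightarrow> 0 < (\<integral>y. w y * K x y \<partial>Q)" "\<And>x. x \<in> X \<Longrightarrow> 0 < (\<integral>y. w' y * K x y \<partial>Q)"
  shows "\<exists>m' M'. 0 < m' \<and> m' \<le> M' \<and> M' / m' - 1 \<le> (1 - (a / b)\<^sup>2) * (M / m - 1) \<and>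
    (\<forall>x\<in>X. m' * (1 / (\<integral>y. w y * K x y \<partial>Q)) \<le> 1 / (\<integral>y. w' y * K x y \<partial>Q)
        \<and> 1 / (\<integral>y. w' y * K x y \<partial>Q) \<le> M' * (1 / (\<integral>y. w y * K x y \<partial>Q)))"
proof -
  obtain m' M' where *: "0 < m'" "m' \<le> M'" "M' / m' - 1 \<le> (1 - (a / b)\<^sup>2) * (M / m - 1)"
    "\<And>x. x \<in> X \<Longrightarrow> m' * (\<integral>y. w y * K x y \<partial>Q) \<le> (\<integral>y. w' y * K x y \<partial>Q)
        \<and> (\<integral>y. w' y * K x y \<partial>Q) \<le> M' * (\<integral>y. w y * K x y \<partial>Q)"
    using kernel_average_contraction[where K = K and X = X, OF Q ab K Kab w mM X] by blast
  show ?thesis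
  proof (rule exI[of _ "1 / M'"], rule exI[of _ "1 / m'"], intro conjI ballI)
    fix x assume x: "x \<in> X"
    show "1 / M' * (1 / (\<integral>y. w y * K x y \<partial>Q)) \<le> 1 / (\<integral>y. w' y * K x y \<partial>Q)"
        "1 / (\<integral>y. w' y * K x y \<partial>Q) \<le> 1 / m' * (1 / (\<integral>y. w y * K x y \<partial>Q))"
      using *(1,2) *(4)[OF x] pos[OF x]
      by (auto simp: pos_divide_le_eq pos_le_divide_eq divide_divide_eq_right mult_ac intro!: divide_left_mono)
  qed (use * in \<open>auto intro!: divide_left_mono\<close>)
qed


section \<open>Sinkhorn's iteration for a kernel between two positive constants\<close>

definition recip_average :: "'b measure \<Rightarrow> ('a \<Rightarrow> 'b \<Rightarrow> real) \<Rightarrow> ('b \<Rightarrow> real) \<Rightarrow> 'a \<Rightarrow> real" where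
  "recip_average Q k v x = 1 / (\<integral>y. v y * k x y \<partial>Q)"

text \<open>The bounds hold at every point and not just almost everywhere: the iterates are compared
  pointwise, and the marginal equations of their limit are later evaluated at individual sample
  points.\<close>

locale pos_kernel = P: prob_space P + Q: prob_space Q
  for P :: "'a measure" and Q :: "'b measure" +
  fixes k :: "'a \<Rightarrow> 'b \<Rightarrow> real" and a b :: real
  assumes k_meas [measurable]: "(\<lambda>(x, y). k x y) \<in> borel_measurable (P \<Otimes>\<^sub>M Q)"
    and a_pos: "0 < a"
    and k_bounds: "\<And>x y. x \<in> space P \<Longrightarrow> y \<in> space Q \<Longrightarrow> a \<le> k x y \<and> k x y \<le> b"
begin

sublocale PQ: pair_prob_space P Q ..

lemma transpose: "pos_kernel Q P (\<lambda>y x. k x y) a b"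
proof (unfold_locales)
  show "(\<lambda>(y, x). k x y) \<in> borel_measurable (Q \<Otimes>\<^sub>M P)"
    using measurable_compose[OF measurable_pair_swap' k_meas] by (simp add: split_beta')
qed (use a_pos k_bounds in auto)

lemma k_meas_section: "x \<in> space P \<Longrightarrow> k x \<in> borel_measurable Q"
  using measurable_compose[OF measurable_Pair1' k_meas] by simp

lemma ab: "a \<le> b"
proof -
  obtain x y where "x \<in> space P" "y \<in> space Q" using P.not_empty Q.not_empty by auto
  then show ?thesis using k_bounds[of x y] by linarith
qed

lemma k_nonneg: "x \<in> space P \<Longrightarrow> y \<in> space Q \<Longrightarrow> 0 \<le> k x y \<and> k x y \<le> b"
  using k_bounds[of x y] a_pos by linarith

lemma integrable_section:
  assumes "pos_bounded Q v" "x \<in> space P"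
  shows "integrable Q (\<lambda>y. v y * k x y)"
  using Q.integrable_pos_bounded_mult[OF assms(1) k_meas_section[OF assms(2)]] k_nonneg[OF assms(2)] by blast

lemma integral_section_bounds:
  assumes v: "pos_bounded Q v" and \<alpha>: "0 < \<alpha>" "\<And>y. y \<in> space Q \<Longrightarrow> \<alpha> \<le> v y \<and> v y \<le> \<beta>" and x: "x \<in> space P"
  shows "\<alpha> * a \<le> (\<integral>y. v y * k x y \<partial>Q)" "(\<integral>y. v y * k x y \<partial>Q) \<le> \<beta> * b"
proof -
  have "\<alpha> * a \<le> v y * k x y \<and> v y * k x y \<le> \<beta> * b" if y: "y \<in> space Q" for y
    using \<alpha>(1) \<alpha>(2)[OF y] k_bounds[OF x y] a_pos by (auto intro!: mult_mono)
  then show "\<alpha> * a \<le> (\<integral>y. v y * k x y \<partial>Q)" "(\<integral>y. v y * k x y \<partial>Q) \<le> \<beta> * b"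
    using integrable_section[OF v x]
    by (auto intro!: Q.integral_ge_const Q.integral_le_const)
qed

lemma integral_section_pos:
  assumes "pos_bounded Q v" "x \<in> space P"
  shows "0 < (\<integral>y. v y * k x y \<partial>Q)"
proof -
  obtain \<alpha> \<beta> where *: "0 < \<alpha>" "\<And>y. y\<in>space Q \<Longrightarrow> \<alpha> \<le> v y \<and> v y \<le> \<beta>"
    using assms(1) unfolding pos_bounded_def by blast
  have "0 < \<alpha> * a" using *(1) a_pos by simp
  with integral_section_bounds(1)[OF assms(1) * assms(2)] show ?thesis by linarith
qed

lemma pos_bounded_recip_average:
  assumes v: "pos_bounded Q v"
  shows "pos_bounded P (recip_average Q k v)"
proof -
  have [measurable]: "v \<in> borel_measurable Q" by (rule pos_bounded_measurable[OF v])
  have 1: "recip_average Q k v \<in> borel_measurable P"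
    unfolding recip_average_def by measurable
  obtain \<alpha> \<beta> where *: "0 < \<alpha>" "\<And>y. y\<in>space Q \<Longrightarrow> \<alpha> \<le> v y \<and> v y \<le> \<beta>"
    using v unfolding pos_bounded_def by blast
  obtain y where "y \<in> space Q" using Q.not_empty by auto
  with * have \<beta>: "0 < \<beta>" by force
  have b: "0 < b" using ab a_pos by simp
  have "1 / (\<beta> * b) \<le> recip_average Q k v x \<and> recip_average Q k v x \<le> 1 / (\<alpha> * a)" if x: "x \<in> space P" for x
    unfolding recip_average_def
    using integral_section_bounds[OF v * x] integral_section_pos[OF v x] * \<beta> b a_pos
    by (auto intro!: divide_left_mono)
  with 1 \<beta> b show ?thesis unfolding pos_bounded_def by (metis mult_pos_pos zero_less_divide_1_iff)
qed

lemma recip_average_contraction: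
  assumes w: "pos_bounded Q w" "pos_bounded Q w'"
    and mM: "0 < m" "\<And>y. y \<in> space Q \<Longrightarrow> m * w y \<le> w' y \<and> w' y \<le> M * w y"
  shows "\<exists>m' M'. 0 < m' \<and> m' \<le> M' \<and> M' / m' - 1 \<le> (1 - (a / b)\<^sup>2) * (M / m - 1) \<and>
    (\<forall>x\<in>space P. m' * recip_average Q k w x \<le> recip_average Q k w' x
        \<and> recip_average Q k w' x \<le> M' * recip_average Q k w x)"
proof -
  obtain x0 where "x0 \<in> space P" using P.not_empty by auto
  then show ?thesis
    unfolding recip_average_def
    by (intro reciprocal_average_contraction[OF Q.prob_space_axioms a_pos ab _ _ w mM, where X = "space P"])
      (auto simp: k_meas_section k_bounds integral_section_pos w)
qed

lemma integrable_kernel: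
  assumes "pos_bounded P u" "pos_bounded Q v"
  shows "integrable (P \<Otimes>\<^sub>M Q) (\<lambda>(x, y). u x * v y * k x y)"
proof -
  obtain \<alpha> \<beta> where u: "0 < \<alpha>" "\<And>y. y\<in>space P \<Longrightarrow> \<alpha> \<le> u y \<and> u y \<le> \<beta>" 
    and [measurable]: "u \<in> borel_measurable P"
    using assms(1) unfolding pos_bounded_def by blast
  obtain \<alpha>' \<beta>' where v: "0 < \<alpha>'" "\<And>y. y\<in>space Q \<Longrightarrow> \<alpha>' \<le> v y \<and> v y \<le> \<beta>'" 
    and [measurable]: "v \<in> borel_measurable Q"
    using assms(2) unfolding pos_bounded_def by blast
  show ?thesis
  proof (rule PQ.P.integrable_bounded)
    show "(\<lambda>(x, y). u x * v y * k x y) \<in> borel_measurable (P \<Otimes>\<^sub>M Q)" by measurable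
    fix z assume "z \<in> space (P \<Otimes>\<^sub>M Q)"
    then have z: "fst z \<in> space P" "snd z \<in> space Q" by (auto simp: space_pair_measure)
    have "0 \<le> u (fst z)" "u (fst z) \<le> \<beta>" "0 \<le> v (snd z)" "v (snd z) \<le> \<beta>'"
      using u(1) v(1) u(2)[OF z(1)] v(2)[OF z(2)] by linarith+
    moreover have "0 \<le> k (fst z) (snd z)" "k (fst z) (snd z) \<le> b" using k_nonneg z by auto
    ultimately have "0 \<le> u (fst z) * v (snd z) * k (fst z) (snd z)"
      "u (fst z) * v (snd z) * k (fst z) (snd z) \<le> \<beta> * \<beta>' * b"
      by (auto intro!: mult_mono mult_nonneg_nonneg)
    then show "\<bar>case z of (x, y) \<Rightarrow> u x * v y * k x y\<bar> \<le> \<beta> * \<beta>' * b" by (simp add: split_beta')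
  qed
qed

definition half_step :: "('b \<Rightarrow> real) \<Rightarrow> 'a \<Rightarrow> real" where
  "half_step v = recip_average Q k v"

text \<open>One full round of the iteration. A fixed point \<open>v\<close>, together with
  \<open>half_step v\<close>, solves both marginal equations.\<close>

definition full_step :: "('b \<Rightarrow> real) \<Rightarrow> 'b \<Rightarrow> real" where
  "full_step v = recip_average P (\<lambda>y x. k x y) (half_step v)"

lemma pos_bounded_half_step: "pos_bounded Q v \<Longrightarrow> pos_bounded P (half_step v)"
  unfolding half_step_def by (rule pos_bounded_recip_average)

lemma pos_bounded_full_step: "pos_bounded Q v \<Longrightarrow> pos_bounded Q (full_step v)"
  unfolding full_step_def by (intro pos_kernel.pos_bounded_recip_average[OF transpose] pos_bounded_half_step)

text \<open>Both sides are the total mass of \<open>u v k\<close>, with the two marginal constraints integrated out in turn.\<close>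

lemma integral_full_step_ratio:
  assumes v: "pos_bounded Q v"
  shows "(\<integral>y. v y / full_step v y \<partial>Q) = 1"
proof -
  define u where "u = half_step v"
  have u: "pos_bounded P u" unfolding u_def by (rule pos_bounded_half_step[OF v])
  have "(\<integral>y. v y / full_step v y \<partial>Q) = (\<integral>y. (\<integral>x. u x * v y * k x y \<partial>P) \<partial>Q)"
  proof (rule Bochner_Integration.integral_cong[OF refl])
    fix y assume "y \<in> space Q"
    have "v y / full_step v y = v y * (\<integral>x. u x * k x y \<partial>P)"
      by (simp add: full_step_def u_def recip_average_def)
    also have "\<dots> = (\<integral>x. v y * (u x * k x y) \<partial>P)" by simp
    also have "\<dots> = (\<integral>x. u x * v y * k x y \<partial>P)" by (simp add: mult_ac)
    finally show "v y / full_step v y = (\<integral>x. u x * v y * k x y \<partial>P)" .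
  qed
  also have "\<dots> = (\<integral>x. (\<integral>y. u x * v y * k x y \<partial>Q) \<partial>P)"
    using integrable_kernel[OF u v] by (rule PQ.Fubini_integral)
  also have "\<dots> = (\<integral>x. 1 \<partial>P)"
  proof (rule Bochner_Integration.integral_cong[OF refl])
    fix x assume x: "x \<in> space P"
    have "(\<integral>y. u x * v y * k x y \<partial>Q) = (\<integral>y. u x * (v y * k x y) \<partial>Q)" by (simp add: mult_ac)
    also have "\<dots> = u x * (\<integral>y. v y * k x y \<partial>Q)" by simp
    also have "\<dots> = 1" using integral_section_pos[OF v x] by (simp add: u_def half_step_def recip_average_def)
    finally show "(\<integral>y. u x * v y * k x y \<partial>Q) = 1" .
  qed
  also have "\<dots> = 1" by (simp add: P.prob_space)
  finally show ?thesis .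
qed

text \<open>The quotient \<open>v / full_step v\<close> has mean one and lies between
  \<open>1 / M\<close> and \<open>1 / m\<close>. This fixes the scale: the contraction controls only
  \<open>M / m\<close>, hence functions up to a scalar factor, and would not by itself stop the
  iterates from drifting.\<close>

lemma full_step_ratio_bounds:
  assumes v: "pos_bounded Q v" and m: "0 < m"
    "\<And>y. y \<in> space Q \<Longrightarrow> m * v y \<le> full_step v y \<and> full_step v y \<le> M * v y"
  shows "m \<le> 1" "1 \<le> M"
proof -
  note fs = pos_bounded_full_step[OF v]
  have [measurable]: "v \<in> borel_measurable Q" "full_step v \<in> borel_measurable Q"
    using v fs by (auto simp: pos_bounded_def)
  obtain y0 where y0: "y0 \<in> space Q" using Q.not_empty by auto
  have M: "0 < M"
    using m(2)[OF y0] pos_bounded_pos[OF v y0] pos_bounded_pos[OF fs y0]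
    by (meson less_le_trans zero_less_mult_pos2)
  have r: "1 / M \<le> v y / full_step v y \<and> v y / full_step v y \<le> 1 / m" if y: "y \<in> space Q" for y
    using m(1) m(2)[OF y] pos_bounded_pos[OF v y] pos_bounded_pos[OF fs y] M
    by (auto simp: pos_divide_le_eq pos_le_divide_eq mult_ac)
  have "1 / M \<le> (\<integral>y. v y / full_step v y \<partial>Q)" "(\<integral>y. v y / full_step v y \<partial>Q) \<le> 1 / m"
    using r by (auto intro!: Q.integral_bounds)
  then show "m \<le> 1" "1 \<le> M"
    unfolding integral_full_step_ratio[OF v] using m(1) M by (auto simp: pos_divide_le_eq pos_le_divide_eq)
qed

fun sinkhorn :: "nat \<Rightarrow> 'b \<Rightarrow> real" where
  "sinkhorn 0 = (\<lambda>_. 1)"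
| "sinkhorn (Suc n) = full_step (sinkhorn n)"

lemma pos_bounded_sinkhorn: "pos_bounded Q (sinkhorn n)"
proof (induction n)
  case 0
  show ?case unfolding pos_bounded_def by (auto intro!: exI[of _ 1])
next
  case (Suc n)
  then show ?case by (simp add: pos_bounded_full_step)
qed

lemma sinkhorn_step_ratio:
  obtains D where "0 \<le> D" "\<And>n. \<exists>m M. 0 < m \<and> m \<le> M \<and> M / m - 1 \<le> (1 - (a / b)\<^sup>2) ^ n * D \<and>
    (\<forall>y\<in>space Q. m * sinkhorn n y \<le> sinkhorn (Suc n) y \<and> sinkhorn (Suc n) y \<le> M * sinkhorn n y)"
proof -
  define \<rho> where "\<rho> = 1 - (a / b)\<^sup>2"
  have \<rho>: "0 \<le> \<rho>" "\<rho> \<le> 1" using ab a_pos by (auto simp: \<rho>_def power_le_one)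
  obtain \<alpha> \<beta> where *: "0 < \<alpha>" "\<And>y. y\<in>space Q \<Longrightarrow> \<alpha> \<le> sinkhorn (Suc 0) y \<and> sinkhorn (Suc 0) y \<le> \<beta>"
    using pos_bounded_sinkhorn[of "Suc 0"] unfolding pos_bounded_def by blast
  obtain y0 where y0: "y0 \<in> space Q" using Q.not_empty by auto
  have \<alpha>\<beta>: "\<alpha> \<le> \<beta>" using *(2)[OF y0] by linarith
  have "\<exists>m M. 0 < m \<and> m \<le> M \<and> M / m - 1 \<le> \<rho> ^ n * (\<beta> / \<alpha> - 1) \<and>
    (\<forall>y\<in>space Q. m * sinkhorn n y \<le> sinkhorn (Suc n) y \<and> sinkhorn (Suc n) y \<le> M * sinkhorn n y)" for n
  proof (induction n)
    case 0
    \<comment> \<open>The iteration starts at the constant one, so bounds of the first iterate serve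
      as \<open>m\<close> and \<open>M\<close>.\<close>
    show ?case using * \<alpha>\<beta> by (intro exI[of _ \<alpha>] exI[of _ \<beta>]) auto
  next
    case (Suc n)
    then obtain m M where mM: "0 < m" "m \<le> M" "M / m - 1 \<le> \<rho> ^ n * (\<beta> / \<alpha> - 1)"
      "\<And>y. y \<in> space Q \<Longrightarrow> m * sinkhorn n y \<le> sinkhorn (Suc n) y \<and> sinkhorn (Suc n) y \<le> M * sinkhorn n y"
      by blast
    note v = pos_bounded_sinkhorn
    obtain m1 M1 where m1: "0 < m1" "m1 \<le> M1" "M1 / m1 - 1 \<le> \<rho> * (M / m - 1)"
      "\<And>x. x \<in> space P \<Longrightarrow> m1 * half_step (sinkhorn n) x \<le> half_step (sinkhorn (Suc n)) x
        \<and> half_step (sinkhorn (Suc n)) x \<le> M1 * half_step (sinkhorn n) x"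
      using recip_average_contraction[OF v[of n] v[of "Suc n"] mM(1,4)] unfolding half_step_def \<rho>_def by blast
    obtain m2 M2 where m2: "0 < m2" "m2 \<le> M2" "M2 / m2 - 1 \<le> \<rho> * (M1 / m1 - 1)"
      "\<And>y. y \<in> space Q \<Longrightarrow> m2 * full_step (sinkhorn n) y \<le> full_step (sinkhorn (Suc n)) y
        \<and> full_step (sinkhorn (Suc n)) y \<le> M2 * full_step (sinkhorn n) y"
      using pos_kernel.recip_average_contraction[OF transpose pos_bounded_half_step[OF v[of n]]
          pos_bounded_half_step[OF v[of "Suc n"]] m1(1,4)] unfolding full_step_def \<rho>_def by blast
    \<comment> \<open>A full step contains two contractions. The second one is used with the factor
      one, which leaves the rate \<open>\<rho> ^ n\<close>; any geometric rate will do.\<close>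
    have "M2 / m2 - 1 \<le> 1 * (M1 / m1 - 1)"
      using m2(3) m1(1,2) \<rho> by (elim order_trans) (intro mult_right_mono, auto)
    also have "\<dots> \<le> \<rho> * (\<rho> ^ n * (\<beta> / \<alpha> - 1))"
      using order_trans[OF m1(3) mult_left_mono[OF mM(3) \<rho>(1)]] by simp
    finally have "M2 / m2 - 1 \<le> \<rho> ^ Suc n * (\<beta> / \<alpha> - 1)" by (simp add: mult_ac)
    with m2 show ?case by (intro exI[of _ m2] exI[of _ M2]) simp
  qed
  moreover have "0 \<le> \<beta> / \<alpha> - 1" using * \<alpha>\<beta> by simp
  ultimately show ?thesis using that unfolding \<rho>_def by blast
qed

text \<open>The increment of the logarithm lies between \<open>ln m\<close> and \<open>ln M\<close>.
  By \<open>full_step_ratio_bounds\<close> this interval contains zero, and its length is at most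
  \<open>M / m - 1\<close>, so the length bounds the increment.\<close>

lemma sinkhorn_log_step:
  obtains D where "0 \<le> D"
    "\<And>n y. y \<in> space Q \<Longrightarrow> \<bar>ln (sinkhorn (Suc n) y) - ln (sinkhorn n y)\<bar> \<le> (1 - (a / b)\<^sup>2) ^ n * D"
proof -
  obtain D where D: "0 \<le> D" "\<And>n. \<exists>m M. 0 < m \<and> m \<le> M \<and> M / m - 1 \<le> (1 - (a / b)\<^sup>2) ^ n * D \<and>
    (\<forall>y\<in>space Q. m * sinkhorn n y \<le> sinkhorn (Suc n) y \<and> sinkhorn (Suc n) y \<le> M * sinkhorn n y)"
    using sinkhorn_step_ratio by blast
  show ?thesis
  proof (rule that[OF D(1)])
    fix n y assume y: "y \<in> space Q"
    obtain m M where mM: "0 < m" "m \<le> M" "M / m - 1 \<le> (1 - (a / b)\<^sup>2) ^ n * D"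
      "\<And>y. y\<in>space Q \<Longrightarrow> m * sinkhorn n y \<le> sinkhorn (Suc n) y \<and> sinkhorn (Suc n) y \<le> M * sinkhorn n y"
      using D(2)[of n] by blast
    have m1: "m \<le> 1" "1 \<le> M"
      using full_step_ratio_bounds[where m = m and M = M, OF pos_bounded_sinkhorn[of n] mM(1)] mM(4) by simp_all
    have M: "0 < M" using m1 by simp
    have p: "0 < sinkhorn n y" "0 < sinkhorn (Suc n) y"
      using pos_bounded_pos[OF pos_bounded_sinkhorn[of n] y] pos_bounded_pos[OF pos_bounded_sinkhorn[of "Suc n"] y] by auto
    have "ln m + ln (sinkhorn n y) \<le> ln (sinkhorn (Suc n) y)"
      using mM(1) mM(4)[OF y] p by (subst ln_mult_pos[symmetric]) auto
    moreover have "ln (sinkhorn (Suc n) y) \<le> ln M + ln (sinkhorn n y)"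
      using M mM(4)[OF y] p by (subst ln_mult_pos[symmetric]) auto
    moreover have "ln M - ln m \<le> M / m - 1"
      using ln_le_minus_one[of "M / m"] M mM(1) by (simp add: ln_div)
    moreover have "ln m \<le> 0" "0 \<le> ln M" using m1 mM(1) by auto
    ultimately show "\<bar>ln (sinkhorn (Suc n) y) - ln (sinkhorn n y)\<bar> \<le> (1 - (a / b)\<^sup>2) ^ n * D"
      using mM(3) by linarith
  qed
qed

text \<open>The logarithms telescope into a series dominated by a geometric one. The bounds
  \<open>exp (- S)\<close> and \<open>exp S\<close>, uniform in \<open>n\<close> and
  \<open>y\<close>, provide the domination for passing to the limit under the integral.\<close>

lemma sinkhorn_converges:
  obtains S v where "\<And>n y. y \<in> space Q \<Longrightarrow> exp (- S) \<le> sinkhorn n y \<and> sinkhorn n y \<le> exp S"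
    "\<And>y. y \<in> space Q \<Longrightarrow> (\<lambda>n. sinkhorn n y) \<longlonglongrightarrow> v y"
proof -
  obtain D where D: "0 \<le> D"
    "\<And>n y. y \<in> space Q \<Longrightarrow> \<bar>ln (sinkhorn (Suc n) y) - ln (sinkhorn n y)\<bar> \<le> (1 - (a / b)\<^sup>2) ^ n * D"
    using sinkhorn_log_step by blast
  define \<rho> where "\<rho> = 1 - (a / b)\<^sup>2"
  have b: "0 < b" using ab a_pos by simp
  have \<rho>: "0 \<le> \<rho>" "\<rho> < 1" using ab a_pos b by (auto simp: \<rho>_def power_le_one)
  define d where "d y n = ln (sinkhorn (Suc n) y) - ln (sinkhorn n y)" for y n
  have d: "\<bar>d y n\<bar> \<le> \<rho> ^ n * D" if "y \<in> space Q" for y n using D(2)[OF that] by (simp add: d_def \<rho>_def)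
  have ln_eq: "ln (sinkhorn n y) = (\<Sum>i<n. d y i)" for n y
    by (induction n) (auto simp: d_def)
  have geo: "summable (\<lambda>n. \<rho> ^ n * D)" using \<rho> by (intro summable_mult2 summable_geometric) simp
  define S where "S = (\<Sum>n. \<rho> ^ n * D)"
  have pe: "sinkhorn n y = exp (\<Sum>i<n. d y i)" if "y \<in> space Q" for n y
    using pos_bounded_pos[OF pos_bounded_sinkhorn[of n] that] ln_eq[of n y] by (metis exp_ln)
  show ?thesis
  proof (rule that[of S "\<lambda>y. exp (\<Sum>i. d y i)"])
    fix n y assume y: "y \<in> space Q"
    have "\<bar>\<Sum>i<n. d y i\<bar> \<le> (\<Sum>i<n. \<rho> ^ i * D)"
      using d[OF y] by (intro order_trans[OF sum_abs] sum_mono)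
    also have "\<dots> \<le> S" unfolding S_def using geo \<rho> D(1) by (intro sum_le_suminf) auto
    finally show "exp (- S) \<le> sinkhorn n y \<and> sinkhorn n y \<le> exp S" by (auto simp: pe[OF y])
  next
    fix y assume y: "y \<in> space Q"
    have "summable (d y)" by (rule summable_comparison_test'[OF geo, of 0]) (use d[OF y] in auto)
    then have "(\<lambda>n. \<Sum>i<n. d y i) \<longlonglongrightarrow> (\<Sum>i. d y i)" by (rule summable_LIMSEQ)
    then show "(\<lambda>n. sinkhorn n y) \<longlonglongrightarrow> exp (\<Sum>i. d y i)" unfolding pe[OF y] by (rule tendsto_exp)
  qed
qed

lemma recip_average_tendsto:
  assumes x: "x \<in> space P"
    and lim: "\<And>y. y \<in> space Q \<Longrightarrow> (\<lambda>n. w n y) \<longlonglongrightarrow> v y"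
    and w: "\<And>n. w n \<in> borel_measurable Q" "\<And>n y. y \<in> space Q \<Longrightarrow> \<alpha> \<le> w n y \<and> w n y \<le> \<beta>"
    and v: "pos_bounded Q v" and \<alpha>: "0 < \<alpha>"
  shows "(\<lambda>n. recip_average Q k (w n) x) \<longlonglongrightarrow> recip_average Q k v x"
proof -
  have [measurable]: "k x \<in> borel_measurable Q" "v \<in> borel_measurable Q" "\<And>n. w n \<in> borel_measurable Q"
    using k_meas_section[OF x] pos_bounded_measurable[OF v] w by auto
  have "(\<lambda>n. \<integral>y. w n y * k x y \<partial>Q) \<longlonglongrightarrow> (\<integral>y. v y * k x y \<partial>Q)"
  proof (rule integral_dominated_convergence[where w = "\<lambda>_. \<beta> * b"])
    show "AE y in Q. (\<lambda>n. w n y * k x y) \<longlonglongrightarrow> v y * k x y"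
      by (intro AE_I2 tendsto_mult lim tendsto_const)
    show "AE y in Q. norm (w n y * k x y) \<le> \<beta> * b" for n
    proof (rule AE_I2)
      fix y assume y: "y \<in> space Q"
      have "0 \<le> w n y" "w n y \<le> \<beta>" "0 \<le> k x y" "k x y \<le> b" 
        using w(2)[OF y, of n] \<alpha> k_nonneg[OF x y] by linarith+
      then show "norm (w n y * k x y) \<le> \<beta> * b" by (auto simp: abs_mult intro!: mult_mono)
    qed
  qed auto
  then show ?thesis unfolding recip_average_def
    using integral_section_pos[OF v x] by (intro tendsto_divide tendsto_const) auto
qed

lemma schrodinger_potentials_exist:
  obtains u v where "pos_bounded P u" "pos_bounded Q v"
    "\<And>x. x \<in> space P \<Longrightarrow> u x * (\<integral>y. v y * k x y \<partial>Q) = 1"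
    "\<And>y. y \<in> space Q \<Longrightarrow> v y * (\<integral>x. u x * k x y \<partial>P) = 1"
proof -
  interpret T: pos_kernel Q P "\<lambda>y x. k x y" a b by (rule transpose)
  obtain S v where S: "\<And>n y. y \<in> space Q \<Longrightarrow> exp (- S) \<le> sinkhorn n y \<and> sinkhorn n y \<le> exp S"
    and lim: "\<And>y. y \<in> space Q \<Longrightarrow> (\<lambda>n. sinkhorn n y) \<longlonglongrightarrow> v y"
    using sinkhorn_converges by blast
  have v: "pos_bounded Q v"
    by (rule pos_boundedI_limit[OF lim _ S]) (auto intro: pos_bounded_measurable[OF pos_bounded_sinkhorn])
  have limu: "(\<lambda>n. half_step (sinkhorn n) x) \<longlonglongrightarrow> half_step v x" if "x \<in> space P" for x
    unfolding half_step_def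
    by (rule recip_average_tendsto[OF that lim _ S v]) (auto intro: pos_bounded_measurable[OF pos_bounded_sinkhorn])
  have b: "0 < b" using ab a_pos by simp
  have ub: "1 / (exp S * b) \<le> half_step (sinkhorn n) x \<and> half_step (sinkhorn n) x \<le> 1 / (exp (- S) * a)"
    if x: "x \<in> space P" for x n
    unfolding half_step_def recip_average_def
    using integral_section_bounds[OF pos_bounded_sinkhorn _ S x] integral_section_pos[OF pos_bounded_sinkhorn x]
      b a_pos by (auto intro!: divide_left_mono)
  have u: "pos_bounded P (half_step v)" by (rule pos_bounded_half_step[OF v])
  have limv: "(\<lambda>n. full_step (sinkhorn n) y) \<longlonglongrightarrow> full_step v y" if "y \<in> space Q" for y
    unfolding full_step_def
    by (rule T.recip_average_tendsto[OF that limu _ ub u])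
      (use b in \<open>auto intro: pos_bounded_measurable[OF pos_bounded_half_step[OF pos_bounded_sinkhorn]]\<close>)
  \<comment> \<open>Dominated convergence sends \<open>full_step (sinkhorn n) y\<close> to
    \<open>full_step v y\<close>, but it is also the shifted sequence, with limit
    \<open>v y\<close>.\<close>
  have fix_eq: "full_step v y = v y" if y: "y \<in> space Q" for y
  proof (rule LIMSEQ_unique[OF limv[OF y]])
    show "(\<lambda>n. full_step (sinkhorn n) y) \<longlonglongrightarrow> v y"
      using LIMSEQ_Suc[OF lim[OF y]] by simp
  qed
  show ?thesis
  proof (rule that[OF u v])
    fix x assume "x \<in> space P"
    then show "half_step v x * (\<integral>y. v y * k x y \<partial>Q) = 1"
      using integral_section_pos[OF v] by (force simp: half_step_def recip_average_def)
  next
    fix y assume y: "y \<in> space Q"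
    then show "v y * (\<integral>x. half_step v x * k x y \<partial>P) = 1"
      using T.integral_section_pos[OF u y] unfolding fix_eq[OF y, symmetric]
      by (simp add: full_step_def recip_average_def)
  qed
qed

end

text \<open>The bounds left by the iteration are not explicit. The pair may be rescaled to
  \<open>u * t\<close>, \<open>v / t\<close>; choosing \<open>t\<close> so that \<open>v\<close> has
  integral one makes \<open>1 / u\<close> a weighted mean of \<open>k\<close>, hence
  \<open>u\<close> lies between \<open>exp (- \<gamma>)\<close> and \<open>exp \<gamma>\<close>.
  Then \<open>1 / v\<close> is a mean of \<open>u * k\<close>, which gives
  \<open>2 * \<gamma>\<close> for \<open>v\<close>. The weaker bound is stated for both, which keeps
  the statement symmetric.\<close>

lemma normalized_potentials_exist:
  fixes P :: "'a measure" and Q :: "'b measure"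
  assumes "pos_kernel P Q k (exp (- \<gamma>)) (exp \<gamma>)"
  obtains u v where "u \<in> borel_measurable P" "v \<in> borel_measurable Q"
    "\<And>x. x \<in> space P \<Longrightarrow> exp (- (2 * \<gamma>)) \<le> u x \<and> u x \<le> exp (2 * \<gamma>)"
    "\<And>y. y \<in> space Q \<Longrightarrow> exp (- (2 * \<gamma>)) \<le> v y \<and> v y \<le> exp (2 * \<gamma>)"
    "\<And>x. x \<in> space P \<Longrightarrow> u x * (\<integral>y. v y * k x y \<partial>Q) = 1"
    "\<And>y. y \<in> space Q \<Longrightarrow> v y * (\<integral>x. u x * k x y \<partial>P) = 1"
proof -
  interpret pos_kernel P Q k "exp (- \<gamma>)" "exp \<gamma>" by fact
  have \<gamma>: "0 \<le> \<gamma>" using ab by simp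
  obtain u0 v0 where uv: "pos_bounded P u0" "pos_bounded Q v0"
    "\<And>x. x \<in> space P \<Longrightarrow> u0 x * (\<integral>y. v0 y * k x y \<partial>Q) = 1"
    "\<And>y. y \<in> space Q \<Longrightarrow> v0 y * (\<integral>x. u0 x * k x y \<partial>P) = 1"
    using schrodinger_potentials_exist by blast
  define t where "t = (\<integral>y. v0 y \<partial>Q)"
  obtain \<alpha> \<beta> where al: "0 < \<alpha>" "\<And>y. y\<in>space Q \<Longrightarrow> \<alpha> \<le> v0 y" "\<And>y. y\<in>space Q \<Longrightarrow> v0 y \<le> \<beta>"
    using uv(2) unfolding pos_bounded_def by blast
  have t: "0 < t" using Q.integral_bounds(1)[OF pos_bounded_measurable[OF uv(2)] al(2,3)] al(1)
    unfolding t_def by linarith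
  define u where "u x = u0 x * t" for x
  define v where "v y = v0 y / t" for y
  have um [measurable]: "u \<in> borel_measurable P" "v \<in> borel_measurable Q"
    using pos_bounded_measurable[OF uv(1)] pos_bounded_measurable[OF uv(2)] unfolding u_def v_def by measurable
  have upos: "0 < u x" if "x \<in> space P" for x
    using pos_bounded_pos[OF uv(1) that] t by (simp add: u_def)
  have vpos: "0 < v x" if "x \<in> space Q" for x
    using pos_bounded_pos[OF uv(2) that] t by (simp add: v_def)
  have m1: "u x * (\<integral>y. v y * k x y \<partial>Q) = 1" if "x \<in> space P" for x
    using uv(3)[OF that] t by (simp add: u_def v_def)
  have m2: "v y * (\<integral>x. u x * k x y \<partial>P) = 1" if "y \<in> space Q" for y
  proof -
    have "(\<integral>x. u x * k x y \<partial>P) = (\<integral>x. t * (u0 x * k x y) \<partial>P)" by (simp add: u_def mult_ac)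
    also have "\<dots> = t * (\<integral>x. u0 x * k x y \<partial>P)" by simp
    finally show ?thesis using uv(4)[OF that] t by (simp add: v_def)
  qed
  have v1: "(\<integral>y. v y \<partial>Q) = 1" using t by (simp add: v_def t_def)
  \<comment> \<open>A non-integrable function has integral 0 by default, so an integral equal to one
    already yields integrability. The same device is used below.\<close>
  have vint: "integrable Q v"
    using v1 not_integrable_integral_eq[of Q v] by fastforce
  have ub: "exp (- \<gamma>) \<le> u x \<and> u x \<le> exp \<gamma>" if x: "x \<in> space P" for x
  proof -
    have i: "integrable Q (\<lambda>y. v y * k x y)"
      using m1[OF x] not_integrable_integral_eq[of Q "\<lambda>y. v y * k x y"] by fastforce
    have "(\<integral>y. v y * exp (- \<gamma>) \<partial>Q) \<le> (\<integral>y. v y * k x y \<partial>Q)"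
      using i vint vpos k_bounds[OF x] by (intro integral_mono mult_left_mono) (auto simp: less_imp_le)
    moreover have "(\<integral>y. v y * k x y \<partial>Q) \<le> (\<integral>y. v y * exp \<gamma> \<partial>Q)"
      using i vint vpos k_bounds[OF x] by (intro integral_mono mult_left_mono) (auto simp: less_imp_le)
    ultimately have *: "exp (- \<gamma>) \<le> (\<integral>y. v y * k x y \<partial>Q)" "(\<integral>y. v y * k x y \<partial>Q) \<le> exp \<gamma>"
      using v1 by simp_all
    have "u x = 1 / (\<integral>y. v y * k x y \<partial>Q)"
      using m1[OF x] by (metis mult_zero_right nonzero_eq_divide_eq zero_neq_one)
    moreover have "1 / exp \<gamma> \<le> 1 / (\<integral>y. v y * k x y \<partial>Q)" "1 / (\<integral>y. v y * k x y \<partial>Q) \<le> 1 / exp (- \<gamma>)"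
      using * by (auto intro!: divide_left_mono mult_pos_pos less_le_trans[OF _ *(1)])
    ultimately show ?thesis by (simp add: exp_minus inverse_eq_divide)
  qed
  have vb: "exp (- (2 * \<gamma>)) \<le> v y \<and> v y \<le> exp (2 * \<gamma>)" if y: "y \<in> space Q" for y
  proof -
    have "exp (- \<gamma>) * exp (- \<gamma>) \<le> u x * k x y \<and> u x * k x y \<le> exp \<gamma> * exp \<gamma>" if "x \<in> space P" for x
      using ub[OF that] k_bounds[OF that y] k_nonneg[OF that y] upos[OF that] by (auto intro!: mult_mono)
    then have bb: "exp (- (2 * \<gamma>)) \<le> u x * k x y \<and> u x * k x y \<le> exp (2 * \<gamma>)" if "x \<in> space P" for x
      using that by (simp flip: exp_add)
    have i: "integrable P (\<lambda>x. u x * k x y)"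
      using m2[OF y] not_integrable_integral_eq[of P "\<lambda>x. u x * k x y"] by fastforce
    have *: "exp (- (2 * \<gamma>)) \<le> (\<integral>x. u x * k x y \<partial>P)" "(\<integral>x. u x * k x y \<partial>P) \<le> exp (2 * \<gamma>)"
      using i bb by (auto intro!: P.integral_ge_const P.integral_le_const)
    have "v y = 1 / (\<integral>x. u x * k x y \<partial>P)"
      using m2[OF y] by (metis mult_zero_right nonzero_eq_divide_eq zero_neq_one)
    moreover have "1 / exp (2 * \<gamma>) \<le> 1 / (\<integral>x. u x * k x y \<partial>P)" "1 / (\<integral>x. u x * k x y \<partial>P) \<le> 1 / exp (- (2 * \<gamma>))"
      using * by (auto intro!: divide_left_mono mult_pos_pos less_le_trans[OF _ *(1)])
    ultimately show ?thesis by (simp add: exp_minus inverse_eq_divide)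
  qed
  show ?thesis
  proof (rule that[OF um _ vb m1 m2])
    fix x assume x: "x \<in> space P"
    have "exp (- (2 * \<gamma>)) \<le> exp (- \<gamma>)" "exp \<gamma> \<le> exp (2 * \<gamma>)" using \<gamma> by auto
    with ub[OF x] show "exp (- (2 * \<gamma>)) \<le> u x \<and> u x \<le> exp (2 * \<gamma>)" by linarith
  qed
qed

section \<open>The entropic optimal plan\<close>

lemma couplingsD:
  assumes "\<pi> \<in> couplings P Q"
  shows "sets \<pi> = sets (P \<Otimes>\<^sub>M Q)" "distr \<pi> P fst = P" "distr \<pi> Q snd = Q"
  using assms unfolding couplings_def mem_Collect_eq by - (elim conjE, assumption)+

lemma log_exp1: "log (exp 1) x = ln x"
  by (simp add: log_def)

text \<open>The kernel is abstract and the measures are arbitrary, so that one development serves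
  the population pair and the empirical pair, as well as either pair with its two sides exchanged
  (\<open>swap\<close>).\<close>

locale schrodinger_system = P: prob_space P + Q: prob_space Q
  for P :: "'a measure" and Q :: "'b measure" +
  fixes k :: "'a \<Rightarrow> 'b \<Rightarrow> real" and u :: "'a \<Rightarrow> real" and v :: "'b \<Rightarrow> real" and \<gamma> :: real
  assumes k_measurable [measurable]: "(\<lambda>(x, y). k x y) \<in> borel_measurable (P \<Otimes>\<^sub>M Q)"
    and k_range: "\<And>x y. x \<in> space P \<Longrightarrow> y \<in> space Q \<Longrightarrow> exp (- \<gamma>) \<le> k x y \<and> k x y \<le> exp \<gamma>"
    and u_measurable [measurable]: "u \<in> borel_measurable P"
    and v_measurable [measurable]: "v \<in> borel_measurable Q"
    and u_range: "\<And>x. x \<in> space P \<Longrightarrow> exp (- (2 * \<gamma>)) \<le> u x \<and> u x \<le> exp (2 * \<gamma>)"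
    and v_range: "\<And>y. y \<in> space Q \<Longrightarrow> exp (- (2 * \<gamma>)) \<le> v y \<and> v y \<le> exp (2 * \<gamma>)"
    and marginal_left: "\<And>x. x \<in> space P \<Longrightarrow> u x * (\<integral>y. v y * k x y \<partial>Q) = 1"
    and marginal_right: "\<And>y. y \<in> space Q \<Longrightarrow> v y * (\<integral>x. u x * k x y \<partial>P) = 1"
begin

sublocale PQ: pair_prob_space P Q ..

sublocale pos_kernel P Q k "exp (- \<gamma>)" "exp \<gamma>"
  by unfold_locales (use k_range in auto)

lemma swap: "schrodinger_system Q P (\<lambda>y x. k x y) v u \<gamma>"
proof -
  interpret T: pos_kernel Q P "\<lambda>y x. k x y" "exp (- \<gamma>)" "exp \<gamma>" by (rule transpose)
  show ?thesis
    by unfold_locales (use k_range u_range v_range marginal_left marginal_right T.k_meas in auto)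
qed

definition p :: "'a \<Rightarrow> 'b \<Rightarrow> real" where
  "p x y = u x * v y * k x y"

definition plan :: "('a \<times> 'b) measure" where
  "plan = density (P \<Otimes>\<^sub>M Q) (\<lambda>z. ennreal (p (fst z) (snd z)))"

lemma u_pos: "x \<in> space P \<Longrightarrow> 0 < u x"
  using u_range[of x] exp_gt_zero[of "- (2 * \<gamma>)"] by linarith

lemma v_pos: "y \<in> space Q \<Longrightarrow> 0 < v y"
  using v_range[of y] exp_gt_zero[of "- (2 * \<gamma>)"] by linarith

lemma k_pos: "x \<in> space P \<Longrightarrow> y \<in> space Q \<Longrightarrow> 0 < k x y"
  using k_range[of x y] exp_gt_zero[of "- \<gamma>"] by linarith

lemma p_measurable [measurable]:
  "(\<lambda>z. p (fst z) (snd z)) \<in> borel_measurable (P \<Otimes>\<^sub>M Q)"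
  "(\<lambda>(x, y). p x y) \<in> borel_measurable (P \<Otimes>\<^sub>M Q)"
proof -
  have "(\<lambda>z. u (fst z) * v (snd z) * (case z of (x, y) \<Rightarrow> k x y)) \<in> borel_measurable (P \<Otimes>\<^sub>M Q)"
    by measurable
  then show "(\<lambda>z. p (fst z) (snd z)) \<in> borel_measurable (P \<Otimes>\<^sub>M Q)"
    by (simp add: p_def split_beta')
  then show "(\<lambda>(x, y). p x y) \<in> borel_measurable (P \<Otimes>\<^sub>M Q)" by (simp add: split_beta')
qed

lemma p_pos: "x \<in> space P \<Longrightarrow> y \<in> space Q \<Longrightarrow> 0 < p x y"
  unfolding p_def by (intro mult_pos_pos u_pos v_pos k_pos)

lemma p_le: assumes "x \<in> space P" "y \<in> space Q" shows "p x y \<le> exp (5 * \<gamma>)"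
proof -
  have "p x y \<le> exp (2 * \<gamma>) * exp (2 * \<gamma>) * exp \<gamma>"
    unfolding p_def using u_range[OF assms(1)] v_range[OF assms(2)] k_range[OF assms]
      u_pos[OF assms(1)] v_pos[OF assms(2)] k_pos[OF assms]
    by (intro mult_mono) auto
  then show ?thesis by (simp flip: exp_add)
qed

lemma p_section: "x \<in> space P \<Longrightarrow> p x \<in> borel_measurable Q"
  using measurable_compose[OF measurable_Pair1' p_measurable(2)] by simp

lemma integrable_p: "x \<in> space P \<Longrightarrow> integrable Q (p x)"
  using p_pos p_le by (intro Q.integrable_bounded[OF p_section, of _ "exp (5 * \<gamma>)"]) (auto simp: less_imp_le abs_of_pos)

lemma integral_p: "x \<in> space P \<Longrightarrow> (\<integral>y. p x y \<partial>Q) = 1"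
  using marginal_left[of x] by (simp add: p_def mult.assoc)

lemma nn_integral_p: "x \<in> space P \<Longrightarrow> (\<integral>\<^sup>+y. ennreal (p x y) \<partial>Q) = 1"
  using p_pos by (subst nn_integral_eq_integral[OF integrable_p]) (auto simp: integral_p less_imp_le)

lemma ln_p: "x \<in> space P \<Longrightarrow> y \<in> space Q \<Longrightarrow> ln (p x y) = ln (u x) + ln (v y) + ln (k x y)"
  using u_pos v_pos k_pos by (simp add: p_def ln_mult_pos)

lemma abs_ln_u: assumes "x \<in> space P" shows "\<bar>ln (u x)\<bar> \<le> 2 * \<gamma>"
  using u_range[OF assms] u_pos[OF assms] ln_ge_iff[of "u x" "- (2 * \<gamma>)"] ln_le_cancel_iff[of "u x" "exp (2 * \<gamma>)"] by auto

lemma abs_ln_v: assumes "y \<in> space Q" shows "\<bar>ln (v y)\<bar> \<le> 2 * \<gamma>"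
  using v_range[OF assms] v_pos[OF assms] ln_ge_iff[of "v y" "- (2 * \<gamma>)"] ln_le_cancel_iff[of "v y" "exp (2 * \<gamma>)"] by auto

lemma abs_ln_k: assumes "x \<in> space P" "y \<in> space Q" shows "\<bar>ln (k x y)\<bar> \<le> \<gamma>"
  using k_range[OF assms] k_pos[OF assms] ln_ge_iff[of "k x y" "- \<gamma>"] ln_le_cancel_iff[of "k x y" "exp \<gamma>"] by auto

lemma sets_plan [simp, measurable_cong]: "sets plan = sets (P \<Otimes>\<^sub>M Q)"
  by (simp add: plan_def)

lemma distr_fst_plan: "distr plan P fst = P"
proof (rule measure_eqI)
  fix A assume "A \<in> sets (distr plan P fst)"
  then have [measurable]: "A \<in> sets P" by simp
  have m: "fst \<in> measurable plan P" by measurable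
  have s: "fst -` A \<inter> space (P \<Otimes>\<^sub>M Q) \<in> sets (P \<Otimes>\<^sub>M Q)"
    by (rule measurable_sets[OF measurable_fst]) simp
  have "emeasure (distr plan P fst) A = emeasure plan (fst -` A \<inter> space (P \<Otimes>\<^sub>M Q))"
    using m by (subst emeasure_distr) (auto simp: plan_def)
  also have "\<dots> = (\<integral>\<^sup>+z. ennreal (p (fst z) (snd z)) * indicator (fst -` A \<inter> space (P \<Otimes>\<^sub>M Q)) z \<partial>(P \<Otimes>\<^sub>M Q))"
    unfolding plan_def using s by (subst emeasure_density) auto
  also have "\<dots> = (\<integral>\<^sup>+z. indicator A (fst z) * ennreal (p (fst z) (snd z)) \<partial>(P \<Otimes>\<^sub>M Q))"
    by (intro nn_integral_cong) (auto split: split_indicator)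
  also have "\<dots> = (\<integral>\<^sup>+x. \<integral>\<^sup>+y. indicator A x * ennreal (p x y) \<partial>Q \<partial>P)"
    by (subst Q.nn_integral_fst[symmetric]) auto
  also have "\<dots> = (\<integral>\<^sup>+x. indicator A x \<partial>P)"
  proof (rule nn_integral_cong)
    fix x assume x: "x \<in> space P"
    have [measurable]: "p x \<in> borel_measurable Q" by (rule p_section[OF x])
    show "(\<integral>\<^sup>+y. indicator A x * ennreal (p x y) \<partial>Q) = indicator A x"
      by (subst nn_integral_cmult) (auto simp: nn_integral_p[OF x])
  qed
  finally show "emeasure (distr plan P fst) A = emeasure P A" by simp
qed simp

lemma distr_snd_plan: "distr plan Q snd = Q"
proof -
  interpret T: schrodinger_system Q P "\<lambda>y x. k x y" v u \<gamma> by (rule swap)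
  have Tp: "T.p y x = p x y" for x y by (simp add: p_def T.p_def mult_ac)
  have "plan = distr T.plan (P \<Otimes>\<^sub>M Q) (\<lambda>(y, x). (x, y))"
  proof -
    have "P \<Otimes>\<^sub>M Q = distr (Q \<Otimes>\<^sub>M P) (P \<Otimes>\<^sub>M Q) (\<lambda>(y, x). (x, y))"
      using PQ.distr_pair_swap by simp
    then have "plan = density (distr (Q \<Otimes>\<^sub>M P) (P \<Otimes>\<^sub>M Q) (\<lambda>(y, x). (x, y))) (\<lambda>z. ennreal (p (fst z) (snd z)))"
      unfolding plan_def by metis
    also have "\<dots> = distr (density (Q \<Otimes>\<^sub>M P) (\<lambda>z. ennreal (p (snd z) (fst z)))) (P \<Otimes>\<^sub>M Q) (\<lambda>(y, x). (x, y))"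
      by (subst density_distr) (auto simp: split_beta')
    finally show ?thesis by (simp add: T.plan_def Tp)
  qed
  then have "distr plan Q snd = distr T.plan Q (snd \<circ> (\<lambda>(y, x). (x, y)))"
    by (simp add: distr_distr)
  also have "snd \<circ> (\<lambda>(y, x). (x, y)) = fst" by (auto simp: fun_eq_iff)
  finally show ?thesis by (simp add: T.distr_fst_plan)
qed

lemma plan_in_couplings: "plan \<in> couplings P Q"
  by (simp add: couplings_def distr_fst_plan distr_snd_plan)

lemma prob_space_coupling:
  assumes "\<pi> \<in> couplings P Q"
  shows "prob_space \<pi>"
proof (rule prob_spaceI)
  have [measurable_cong]: "sets \<pi> = sets (P \<Otimes>\<^sub>M Q)" and d: "distr \<pi> P fst = P"
    by (rule couplingsD[OF assms])+
  have [measurable]: "fst \<in> measurable \<pi> P" by measurable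
  have "fst -` space P \<inter> space \<pi> = space \<pi>"
    using sets_eq_imp_space_eq[OF \<open>sets \<pi> = _\<close>] by (auto simp: space_pair_measure)
  then have "emeasure \<pi> (space \<pi>) = emeasure (distr \<pi> P fst) (space P)"
    by (subst emeasure_distr) auto
  also have "\<dots> = 1" by (simp add: d P.emeasure_space_1)
  finally show "emeasure \<pi> (space \<pi>) = 1" .
qed

lemma coupling_integrals:
  assumes "\<pi> \<in> couplings P Q"
  shows "integrable \<pi> (\<lambda>z. ln (u (fst z)))" "integrable \<pi> (\<lambda>z. ln (v (snd z)))"
    "integrable \<pi> (\<lambda>z. ln (k (fst z) (snd z)))"
    "(\<integral>z. ln (u (fst z)) \<partial>\<pi>) = (\<integral>x. ln (u x) \<partial>P)" "(\<integral>z. ln (v (snd z)) \<partial>\<pi>) = (\<integral>y. ln (v y) \<partial>Q)"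
proof -
  have s [measurable_cong]: "sets \<pi> = sets (P \<Otimes>\<^sub>M Q)" and d: "distr \<pi> P fst = P" "distr \<pi> Q snd = Q"
    by (rule couplingsD[OF assms])+
  interpret \<pi>: prob_space \<pi> by (rule prob_space_coupling[OF assms])
  have "space \<pi> = space P \<times> space Q"
    using sets_eq_imp_space_eq[OF s] unfolding space_pair_measure .
  then have sp: "fst z \<in> space P" "snd z \<in> space Q" if "z \<in> space \<pi>" for z
    using that by (simp_all add: mem_Times_iff)
  have [measurable]: "fst \<in> measurable \<pi> P" "snd \<in> measurable \<pi> Q" by measurable
  have km: "(\<lambda>z. k (fst z) (snd z)) \<in> borel_measurable \<pi>"
    using k_measurable by (simp add: split_beta' cong: measurable_cong_sets[OF s refl])
  show "integrable \<pi> (\<lambda>z. ln (u (fst z)))"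
    by (rule \<pi>.integrable_bounded[of _ "2 * \<gamma>"]) (use sp abs_ln_u in auto)
  show "integrable \<pi> (\<lambda>z. ln (v (snd z)))"
    by (rule \<pi>.integrable_bounded[of _ "2 * \<gamma>"]) (use sp abs_ln_v in auto)
  show "integrable \<pi> (\<lambda>z. ln (k (fst z) (snd z)))"
    by (rule \<pi>.integrable_bounded[of _ "\<gamma>"]) (use sp abs_ln_k km in auto)
  have "(\<integral>x. ln (u x) \<partial>P) = (\<integral>x. ln (u x) \<partial>distr \<pi> P fst)" by (simp add: d)
  also have "\<dots> = (\<integral>z. ln (u (fst z)) \<partial>\<pi>)" by (rule integral_distr) auto
  finally show "(\<integral>z. ln (u (fst z)) \<partial>\<pi>) = (\<integral>x. ln (u x) \<partial>P)" ..
  have "(\<integral>x. ln (v x) \<partial>Q) = (\<integral>x. ln (v x) \<partial>distr \<pi> Q snd)" by (simp add: d)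
  also have "\<dots> = (\<integral>z. ln (v (snd z)) \<partial>\<pi>)" by (rule integral_distr) auto
  finally show "(\<integral>z. ln (v (snd z)) \<partial>\<pi>) = (\<integral>y. ln (v y) \<partial>Q)" ..
qed

text \<open>
  Since \<open>ln p = ln u + ln v - c / \<epsilon>\<close> and the marginals of a coupling are fixed, the objective
  differs from \<open>\<epsilon> KL \<pi> plan\<close> by a constant.
\<close>

lemma eot_objective_eq:
  fixes c :: "'a \<Rightarrow> 'b \<Rightarrow> real"
  assumes \<epsilon>: "0 < \<epsilon>"
    and c [measurable]: "(\<lambda>(x, y). c x y) \<in> borel_measurable (P \<Otimes>\<^sub>M Q)"
    and kc: "AE z in P \<Otimes>\<^sub>M Q. k (fst z) (snd z) = exp (- c (fst z) (snd z) / \<epsilon>)"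
    and \<pi>: "\<pi> \<in> couplings P Q" and fin: "KL \<pi> (P \<Otimes>\<^sub>M Q) \<noteq> \<infinity>"
  shows "eot_objective c \<epsilon> P Q \<pi> = ereal (\<epsilon> * ((\<integral>x. ln (u x) \<partial>P) + (\<integral>y. ln (v y) \<partial>Q))
           + \<epsilon> * KL_divergence (exp 1) plan \<pi>)"
    and "\<pi> \<noteq> plan \<Longrightarrow> 0 < KL_divergence (exp 1) plan \<pi>"
proof -
  have s [measurable_cong]: "sets \<pi> = sets (P \<Otimes>\<^sub>M Q)" by (rule couplingsD[OF \<pi>])
  interpret \<pi>: prob_space \<pi> by (rule prob_space_coupling[OF \<pi>])
  interpret plan: prob_space plan by (rule prob_space_coupling[OF plan_in_couplings])
  interpret I: information_space plan "exp 1" by unfold_locales auto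
  let ?M = "P \<Otimes>\<^sub>M Q"
  let ?p = "\<lambda>z. p (fst z) (snd z)"
  have ac: "absolutely_continuous ?M \<pi>" and int: "integrable \<pi> (entropy_density (exp 1) ?M \<pi>)"
    using fin by (auto simp: KL_def split: if_splits)
  have "finite_measure \<pi>" by unfold_locales
  from PQ.real_RN_deriv[OF this ac s] obtain q
    where q: "q \<in> borel_measurable ?M" "AE z in ?M. RN_deriv ?M \<pi> z = ennreal (q z)"
      "AE z in \<pi>. 0 < q z" "\<And>z. 0 \<le> q z"
    by auto
  note [measurable] = q(1)
  have "\<pi> = density ?M (RN_deriv ?M \<pi>)" using ac s by (rule PQ.density_RN_deriv[symmetric])
  also have "\<dots> = density ?M q" using q by (intro density_cong) auto
  finally have dens: "\<pi> = density ?M q" .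
  \<comment> \<open>Finite divergence makes \<open>\<pi>\<close> absolutely continuous, so
    \<open>kc\<close> and the other facts known only almost everywhere for the product carry over to
    \<open>\<pi>\<close>.\<close>
  have AEM: "AE z in \<pi>. R z" if "AE z in ?M. R z" for R
    using absolutely_continuous_AE[OF s ac that] .
  have ppos: "AE z in ?M. 0 < ?p z" by (rule AE_I2) (auto simp: space_pair_measure p_pos)
  have lnq: "AE z in \<pi>. entropy_density (exp 1) ?M \<pi> z = ln (q z)"
    using AEM[OF q(2)] by eventually_elim (simp add: entropy_density_def log_exp1 q(4))
  have ed_meas: "entropy_density (exp 1) ?M \<pi> \<in> borel_measurable \<pi>"
    using int by (rule borel_measurable_integrable)
  have intq: "integrable \<pi> (\<lambda>z. ln (q z))"
    by (rule integrable_cong_AE[THEN iffD1, OF _ _ lnq int]) (use ed_meas in measurable)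
  note ci = coupling_integrals[OF \<pi>]
  have lnp: "AE z in \<pi>. ln (?p z) = ln (u (fst z)) + ln (v (snd z)) + ln (k (fst z) (snd z))"
    by (rule AEM, rule AE_I2) (auto simp: space_pair_measure ln_p)
  have pm: "?p \<in> borel_measurable \<pi>" by measurable
  have intp: "integrable \<pi> (\<lambda>z. ln (?p z))"
    by (rule integrable_cong_AE[THEN iffD2, OF _ _ lnp]) (use ci pm in auto)
  have intp_eq: "(\<integral>z. ln (?p z) \<partial>\<pi>) = (\<integral>x. ln (u x) \<partial>P) + (\<integral>y. ln (v y) \<partial>Q) + (\<integral>z. ln (k (fst z) (snd z)) \<partial>\<pi>)"
    using ci pm by (subst integral_cong_AE[OF _ _ lnp]) auto
  have km: "(\<lambda>z. k (fst z) (snd z)) \<in> borel_measurable \<pi>"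
    using k_measurable by (simp add: split_beta' cong: measurable_cong_sets[OF s refl])
  have cm: "(\<lambda>z. c (fst z) (snd z)) \<in> borel_measurable \<pi>"
    using c by (simp add: split_beta' cong: measurable_cong_sets[OF s refl])
  have "(\<integral>z. c (fst z) (snd z) \<partial>\<pi>) = (\<integral>z. - \<epsilon> * ln (k (fst z) (snd z)) \<partial>\<pi>)"
    by (rule integral_cong_AE) (use AEM[OF kc] km cm \<epsilon> in \<open>auto elim!: eventually_mono\<close>)
  then have cost: "(\<integral>z. c (fst z) (snd z) \<partial>\<pi>) = - \<epsilon> * (\<integral>z. ln (k (fst z) (snd z)) \<partial>\<pi>)"
    by simp
  have lnqp: "AE z in \<pi>. log (exp 1) (q z / ?p z) = ln (q z) - ln (?p z)"
    using AEM[OF ppos] q(3) by eventually_elim (simp add: log_exp1 ln_div)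
  have intqp: "integrable \<pi> (\<lambda>z. log (exp 1) (q z / ?p z))"
    by (rule integrable_cong_AE[THEN iffD2, OF _ _ lnqp]) (use intp intq in auto)
  have KLeq: "KL_divergence (exp 1) plan \<pi> = (\<integral>z. ln (q z) \<partial>\<pi>) - (\<integral>z. ln (?p z) \<partial>\<pi>)"
  proof -
    have "KL_divergence (exp 1) plan \<pi> = (\<integral>z. q z * log (exp 1) (q z / ?p z) \<partial>?M)"
      unfolding plan_def dens
      by (rule PQ.KL_density_density) (use ppos q in \<open>auto elim!: eventually_mono\<close>)
    also have "\<dots> = (\<integral>z. log (exp 1) (q z / ?p z) \<partial>\<pi>)"
      unfolding dens using q(4) by (subst integral_real_density) auto
    also have "\<dots> = (\<integral>z. ln (q z) - ln (?p z) \<partial>\<pi>)"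
      by (rule integral_cong_AE[OF _ _ lnqp]) (use intp intq in auto)
    also have "\<dots> = (\<integral>z. ln (q z) \<partial>\<pi>) - (\<integral>z. ln (?p z) \<partial>\<pi>)"
      using intp intq by simp
    finally show ?thesis .
  qed
  have "KL \<pi> ?M = ereal (\<integral>z. ln (q z) \<partial>\<pi>)"
  proof -
    have "KL_divergence (exp 1) ?M \<pi> = (\<integral>z. ln (q z) \<partial>\<pi>)"
      unfolding KL_divergence_def by (rule integral_cong_AE[OF _ _ lnq]) (use ed_meas intq in auto)
    then show ?thesis using ac int by (simp add: KL_def)
  qed
  then show "eot_objective c \<epsilon> P Q \<pi> = ereal (\<epsilon> * ((\<integral>x. ln (u x) \<partial>P) + (\<integral>y. ln (v y) \<partial>Q))
           + \<epsilon> * KL_divergence (exp 1) plan \<pi>)"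
    unfolding eot_objective_def cost KLeq intp_eq by (simp add: algebra_simps)
  \<comment> \<open>As \<open>p\<close> is positive, \<open>\<pi>\<close> has the density
    \<open>q / p\<close> with respect to \<open>plan\<close>. In this form strict positivity of
    relative entropy applies.\<close>
  have dd: "density plan (\<lambda>z. q z / ?p z) = \<pi>"
    unfolding plan_def dens by (rule density_density_divide) (use ppos q in \<open>auto elim!: eventually_mono\<close>)
  assume ne: "\<pi> \<noteq> plan"
  have "0 < KL_divergence (exp 1) plan (density plan (\<lambda>z. q z / ?p z))"
  proof (rule I.KL_gt_0)
    show "prob_space (density plan (\<lambda>z. ennreal (q z / ?p z)))" unfolding dd by (rule \<pi>.prob_space_axioms)
    show "(\<lambda>z. q z / ?p z) \<in> borel_measurable plan" by measurable
    show "AE z in plan. 0 \<le> q z / ?p z"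
      by (rule AE_I2) (use q(4) in \<open>auto simp: plan_def space_pair_measure p_pos less_imp_le\<close>)
    have "integrable (density plan (\<lambda>z. q z / ?p z)) (\<lambda>z. log (exp 1) (q z / ?p z))"
      using intqp by (simp only: dd)
    moreover have "AE z in plan. 0 \<le> q z / ?p z"
      by (rule AE_I2) (use q(4) in \<open>auto simp: plan_def space_pair_measure p_pos less_imp_le\<close>)
    ultimately show "integrable plan (\<lambda>z. q z / ?p z * log (exp 1) (q z / ?p z))"
      by (subst (asm) integrable_real_density) auto
    show "density plan (\<lambda>z. ennreal (q z / ?p z)) \<noteq> plan" unfolding dd by (rule ne)
  qed
  then show "0 < KL_divergence (exp 1) plan \<pi>" by (simp only: dd)
qed

text \<open>\<open>eot_objective_eq\<close> speaks of couplings with finite divergence.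
  \<open>plan\<close> is one of them since its log-density is bounded by
  \<open>5 * \<gamma>\<close>: two from \<open>u\<close>, two from \<open>v\<close> and one from
  \<open>k\<close>.\<close>

lemma KL_plan: "KL plan (P \<Otimes>\<^sub>M Q) \<noteq> \<infinity>"
proof -
  let ?M = "P \<Otimes>\<^sub>M Q"
  have ac: "absolutely_continuous ?M plan"
    unfolding plan_def by (rule absolutely_continuousI_density) auto
  interpret plan: prob_space plan by (rule prob_space_coupling[OF plan_in_couplings])
  have "AE z in ?M. ennreal (p (fst z) (snd z)) = RN_deriv ?M plan z"
    by (rule PQ.RN_deriv_unique) (auto simp: plan_def)
  then have *: "AE z in plan. ennreal (p (fst z) (snd z)) = RN_deriv ?M plan z"
    using absolutely_continuous_AE[OF _ ac] by (simp add: plan_def)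
  have m: "entropy_density (exp 1) ?M plan \<in> borel_measurable plan" by measurable
  have "integrable plan (entropy_density (exp 1) ?M plan)"
  proof (rule plan.integrable_const_bound[OF _ m, of "5 * \<gamma>"])
    show "AE z in plan. norm (entropy_density (exp 1) ?M plan z) \<le> 5 * \<gamma>"
      using * AE_space
    proof eventually_elim
      fix z assume z: "ennreal (p (fst z) (snd z)) = RN_deriv ?M plan z" "z \<in> space plan"
      then have sp: "fst z \<in> space P" "snd z \<in> space Q" by (auto simp: plan_def space_pair_measure)
      have "entropy_density (exp 1) ?M plan z = ln (p (fst z) (snd z))"
        using z(1)[symmetric] p_pos[OF sp] by (simp add: entropy_density_def log_exp1)
      then show "norm (entropy_density (exp 1) ?M plan z) \<le> 5 * \<gamma>"
        using abs_ln_u[OF sp(1)] abs_ln_v[OF sp(2)] abs_ln_k[OF sp] ln_p[OF sp] by auto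
    qed
  qed
  with ac show ?thesis by (simp add: KL_def)
qed

text \<open>The definite description is legitimate: every other coupling has infinite divergence
  from the product or, by strict positivity of its divergence from \<open>plan\<close>, a strictly
  larger objective.\<close>

lemma eot_plan_eq:
  fixes c :: "'a \<Rightarrow> 'b \<Rightarrow> real"
  assumes \<epsilon>: "0 < \<epsilon>"
    and c: "(\<lambda>(x, y). c x y) \<in> borel_measurable (P \<Otimes>\<^sub>M Q)"
    and kc: "AE z in P \<Otimes>\<^sub>M Q. k (fst z) (snd z) = exp (- c (fst z) (snd z) / \<epsilon>)"
  shows "eot_plan c \<epsilon> P Q = plan"
proof -
  interpret plan: prob_space plan by (rule prob_space_coupling[OF plan_in_couplings])
  let ?V = "\<epsilon> * ((\<integral>x. ln (u x) \<partial>P) + (\<integral>y. ln (v y) \<partial>Q))"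
  have Vplan: "eot_objective c \<epsilon> P Q plan = ereal ?V"
    using eot_objective_eq(1)[OF \<epsilon> c kc plan_in_couplings KL_plan] plan.KL_same_eq_0[of "exp 1"] by simp
  have gt: "ereal ?V < eot_objective c \<epsilon> P Q \<pi>" if "\<pi> \<in> couplings P Q" "\<pi> \<noteq> plan" for \<pi>
  proof (cases "KL \<pi> (P \<Otimes>\<^sub>M Q) = \<infinity>")
    case True
    then show ?thesis using \<epsilon> by (simp add: eot_objective_def)
  next
    case False
    show ?thesis
      using eot_objective_eq[OF \<epsilon> c kc that(1) False] that(2) \<epsilon> by simp
  qed
  have val: "eot_value c \<epsilon> P Q = ereal ?V"
    unfolding eot_value_def
  proof (rule antisym)
    show "(INF \<pi>\<in>couplings P Q. eot_objective c \<epsilon> P Q \<pi>) \<le> ereal ?V"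
      using plan_in_couplings Vplan by (metis INF_lower)
    show "ereal ?V \<le> (INF \<pi>\<in>couplings P Q. eot_objective c \<epsilon> P Q \<pi>)"
      using gt Vplan by (intro INF_greatest) (metis less_imp_le order_refl)
  qed
  show ?thesis
    unfolding eot_plan_def val
  proof (rule the_equality)
    show "plan \<in> couplings P Q \<and> eot_objective c \<epsilon> P Q plan = ereal ?V"
      using plan_in_couplings Vplan by simp
    fix \<pi> assume "\<pi> \<in> couplings P Q \<and> eot_objective c \<epsilon> P Q \<pi> = ereal ?V"
    then show "\<pi> = plan" using gt[of \<pi>] by auto
  qed
qed

lemma eot_density_AE:
  fixes c :: "'a \<Rightarrow> 'b \<Rightarrow> real"
  assumes "0 < \<epsilon>"
    and "(\<lambda>(x, y). c x y) \<in> borel_measurable (P \<Otimes>\<^sub>M Q)"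
    and "AE z in P \<Otimes>\<^sub>M Q. k (fst z) (snd z) = exp (- c (fst z) (snd z) / \<epsilon>)"
  shows "AE x in P. AE y in Q. eot_density c \<epsilon> P Q x y = p x y"
proof -
  have "AE z in P \<Otimes>\<^sub>M Q. ennreal (p (fst z) (snd z)) = RN_deriv (P \<Otimes>\<^sub>M Q) plan z"
    by (rule PQ.RN_deriv_unique) (auto simp: plan_def)
  then have "AE z in P \<Otimes>\<^sub>M Q. eot_density c \<epsilon> P Q (fst z) (snd z) = p (fst z) (snd z)"
    using AE_space
  proof eventually_elim
    fix z assume z: "ennreal (p (fst z) (snd z)) = RN_deriv (P \<Otimes>\<^sub>M Q) plan z" "z \<in> space (P \<Otimes>\<^sub>M Q)"
    then have sp: "fst z \<in> space P" "snd z \<in> space Q" by (auto simp: space_pair_measure)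
    show "eot_density c \<epsilon> P Q (fst z) (snd z) = p (fst z) (snd z)"
      unfolding eot_density_def eot_plan_eq[OF assms]
      using z(1)[symmetric] p_pos[OF sp] by simp
  qed
  from PQ.AE_pair[OF this] show ?thesis by simp
qed

end

lemma eot_density_measurable:
  assumes "x \<in> space P"
  shows "(\<lambda>y. eot_density c \<epsilon> P Q x y) \<in> borel_measurable Q"
proof -
  have "(\<lambda>z. enn2real (RN_deriv (P \<Otimes>\<^sub>M Q) (eot_plan c \<epsilon> P Q) z)) \<in> borel_measurable (P \<Otimes>\<^sub>M Q)"
    by measurable
  from measurable_compose[OF measurable_Pair1'[OF assms] this] show ?thesis
    unfolding eot_density_def .
qed

text \<open>The cost is bounded by one only almost everywhere, while the iteration needs a kernel
  bounded at every point. Clipping the cost to the interval from -1 to 1 achieves this with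
  \<open>\<gamma> = 1 / \<epsilon>\<close> and alters the kernel only on a null set.\<close>

definition gibbs_kernel :: "('a \<Rightarrow> 'b \<Rightarrow> real) \<Rightarrow> real \<Rightarrow> 'a \<Rightarrow> 'b \<Rightarrow> real" where
  "gibbs_kernel c \<epsilon> x y = exp (- max (- 1) (min 1 (c x y)) / \<epsilon>)"

lemma gibbs_kernel_eq: "\<bar>c x y\<bar> \<le> 1 \<Longrightarrow> gibbs_kernel c \<epsilon> x y = exp (- c x y / \<epsilon>)"
  by (simp add: gibbs_kernel_def max_def min_def abs_le_iff)

lemma gibbs_system_exists:
  fixes c :: "'a \<Rightarrow> 'b \<Rightarrow> real"
  assumes "prob_space P" "prob_space Q" and \<epsilon>: "0 < \<epsilon>"
    and c [measurable]: "(\<lambda>(x, y). c x y) \<in> borel_measurable (P \<Otimes>\<^sub>M Q)"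
  obtains u v where "schrodinger_system P Q (gibbs_kernel c \<epsilon>) u v (1 / \<epsilon>)"
proof -
  interpret P: prob_space P by fact
  interpret Q: prob_space Q by fact
  have km: "(\<lambda>(x, y). gibbs_kernel c \<epsilon> x y) \<in> borel_measurable (P \<Otimes>\<^sub>M Q)"
  proof -
    have "(\<lambda>z. exp (- max (- 1) (min 1 (case z of (x, y) \<Rightarrow> c x y)) / \<epsilon>)) \<in> borel_measurable (P \<Otimes>\<^sub>M Q)"
      by measurable
    then show ?thesis by (simp add: gibbs_kernel_def split_beta')
  qed
  have kr: "exp (- (1 / \<epsilon>)) \<le> gibbs_kernel c \<epsilon> x y \<and> gibbs_kernel c \<epsilon> x y \<le> exp (1 / \<epsilon>)" for x y
    using \<epsilon> by (auto simp: gibbs_kernel_def divide_simps)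
  interpret pos_kernel P Q "gibbs_kernel c \<epsilon>" "exp (- (1 / \<epsilon>))" "exp (1 / \<epsilon>)"
    by unfold_locales (use km kr in auto)
  obtain u v where "u \<in> borel_measurable P" "v \<in> borel_measurable Q"
    "\<And>x. x \<in> space P \<Longrightarrow> exp (- (2 * (1 / \<epsilon>))) \<le> u x \<and> u x \<le> exp (2 * (1 / \<epsilon>))"
    "\<And>y. y \<in> space Q \<Longrightarrow> exp (- (2 * (1 / \<epsilon>))) \<le> v y \<and> v y \<le> exp (2 * (1 / \<epsilon>))"
    "\<And>x. x \<in> space P \<Longrightarrow> u x * (\<integral>y. v y * gibbs_kernel c \<epsilon> x y \<partial>Q) = 1"
    "\<And>y. y \<in> space Q \<Longrightarrow> v y * (\<integral>x. u x * gibbs_kernel c \<epsilon> x y \<partial>P) = 1"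
    using normalized_potentials_exist[OF pos_kernel_axioms] by blast
  then have "schrodinger_system P Q (gibbs_kernel c \<epsilon>) u v (1 / \<epsilon>)"
    by unfold_locales (use km kr in auto)
  then show ?thesis by (rule that)
qed

lemma gibbs_kernel_AE_eq:
  assumes "AE z in P \<Otimes>\<^sub>M Q. \<bar>c (fst z) (snd z)\<bar> \<le> 1"
  shows "AE z in P \<Otimes>\<^sub>M Q. gibbs_kernel c \<epsilon> (fst z) (snd z) = exp (- c (fst z) (snd z) / \<epsilon>)"
  using assms by eventually_elim (rule gibbs_kernel_eq)

section \<open>Supports and covering numbers\<close>

lemma space_Rd: "space (Rd d) = (\<Pi>\<^sub>E i\<in>{..<d}. UNIV)"
  by (simp add: Rd_def space_PiM)

lemma coordinate_measurable: "i < d \<Longrightarrow> (\<lambda>x. x i) \<in> borel_measurable (Rd d)"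
  unfolding Rd_def by (rule measurable_component_singleton) simp

lemma edist_measurable [measurable]: "edist d a \<in> borel_measurable (Rd d)"
proof -
  have "(\<lambda>y. sqrt (\<Sum>i<d. (a i - y i)\<^sup>2)) \<in> borel_measurable (Rd d)"
    by (intro measurable_compose[OF _ borel_measurable_sqrt] borel_measurable_sum borel_measurable_power
        borel_measurable_diff borel_measurable_const coordinate_measurable) auto
  moreover have "edist d a = (\<lambda>y. sqrt (\<Sum>i<d. (a i - y i)\<^sup>2))"
    by (simp add: fun_eq_iff edist_def enorm_def L2_set_def)
  ultimately show ?thesis by simp
qed

lemma edist_commute: "edist d x y = edist d y x"
  by (simp add: edist_def enorm_def L2_set_def power2_commute)

lemma edist_triangle: "edist d x z \<le> edist d x y + edist d y z"
proof -
  have "edist d x z = L2_set (\<lambda>i. (x i - y i) + (y i - z i)) {..<d}"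
    by (simp add: edist_def enorm_def)
  also have "\<dots> \<le> edist d x y + edist d y z"
    unfolding edist_def enorm_def by (rule L2_set_triangle_ineq)
  finally show ?thesis .
qed

lemma edist_nonneg: "0 \<le> edist d x y"
  by (simp add: edist_def enorm_def L2_set_nonneg)

lemma edist_sq: "(edist d x y)\<^sup>2 = (\<Sum>i<d. (x i - y i)\<^sup>2)"
  by (simp add: edist_def enorm_def L2_set_def sum_nonneg)

lemma coordinate_le_edist: "i < d \<Longrightarrow> \<bar>x i - y i\<bar> \<le> edist d x y"
  unfolding edist_def enorm_def using member_le_L2_set[of "{..<d}" i "\<lambda>i. \<bar>x i - y i\<bar>"]
  by (simp add: L2_set_def)

lemma edist_le_of_coordinates:
  assumes "\<And>i. i < d \<Longrightarrow> \<bar>x i - y i\<bar> \<le> h"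
  shows "edist d x y \<le> d * h"
proof -
  have "edist d x y \<le> (\<Sum>i<d. \<bar>x i - y i\<bar>)"
    unfolding edist_def enorm_def by (rule L2_set_le_sum_abs)
  also have "\<dots> \<le> (\<Sum>i<d. h)" using assms by (intro sum_mono) auto
  finally show ?thesis by simp
qed

lemma ball_sets [measurable]:
  "{y \<in> space (Rd d). edist d a y < r} \<in> sets (Rd d)"
  "{y \<in> space (Rd d). edist d a y \<le> r} \<in> sets (Rd d)"
  by measurable

lemma singleton_sets_Rd: "s \<in> space (Rd d) \<Longrightarrow> {s} \<in> sets (Rd d)"
proof -
  assume s: "s \<in> space (Rd d)"
  have "{y \<in> space (Rd d). edist d s y \<le> 0} = {s}"
  proof (intro equalityI subsetI)
    fix y assume y: "y \<in> {y \<in> space (Rd d). edist d s y \<le> 0}"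
    have "s i = y i" for i
    proof (cases "i < d")
      case True
      then show ?thesis using coordinate_le_edist[OF True, of s y] y by auto
    next
      case False
      \<comment> \<open>Both points are extensional, so they agree outside \<open>{..<d}\<close>
        too.\<close>
      then show ?thesis using s y by (auto simp: space_Rd PiE_def extensional_def)
    qed
    then show "y \<in> {s}" by (auto simp: fun_eq_iff)
  qed (use s in \<open>auto simp: edist_def enorm_def L2_set_def\<close>)
  then show ?thesis using ball_sets(2)[of d s 0] by simp
qed

lemma rational_point_near:
  fixes h :: real
  assumes "0 < h"
  obtains a where "a \<in> (\<Pi>\<^sub>E i\<in>{..<d}. \<rat>)" "edist d a x \<le> d * h"
proof -
  have "\<exists>q\<in>\<rat>. \<bar>q - x i\<bar> \<le> h" for i
    using Rats_dense_in_real[of "x i - h" "x i + h"] assms by (force simp: abs_le_iff)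
  then obtain f where f: "\<And>i. f i \<in> \<rat>" "\<And>i. \<bar>f i - x i\<bar> \<le> h" by metis
  show ?thesis
  proof (rule that[of "restrict f {..<d}"])
    show "edist d (restrict f {..<d}) x \<le> d * h"
      by (rule edist_le_of_coordinates) (use f in auto)
  qed (use f in auto)
qed

text \<open>The complement of the support is covered by the countably many null balls with rational
  centre and radius.\<close>

lemma AE_in_supp:
  assumes "borel_prob d P"
  shows "AE x in P. x \<in> supp d P"
proof -
  interpret prob_space P using assms by (simp add: borel_prob_def)
  have sets: "sets P = sets (Rd d)" using assms by (simp add: borel_prob_def)
  have sp: "space P = space (Rd d)" by (rule sets_eq_imp_space_eq[OF sets])
  define B where "B z = {y \<in> space (Rd d). edist d (fst z) y < snd z}" for z
  define G where "G = {z \<in> (\<Pi>\<^sub>E i\<in>{..<d}. \<rat>) \<times> \<rat>. emeasure P (B z) = 0}"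
  have "countable ((\<Pi>\<^sub>E i\<in>{..<d}. (\<rat> :: real set)) \<times> (\<rat> :: real set))"
    by (intro countable_SIGMA countable_PiE) (auto simp: countable_rat)
  then have "countable G" unfolding G_def by (rule countable_subset[rotated]) auto
  then have null: "(\<Union>z\<in>G. B z) \<in> null_sets P"
    by (rule null_sets_UN') (auto simp: G_def null_sets_def B_def sets)
  have "x \<in> (\<Union>z\<in>G. B z)" if x: "x \<in> space P" "x \<notin> supp d P" for x
  proof -
    obtain r where r: "0 < r" "emeasure P {y \<in> space (Rd d). edist d x y < r} = 0"
      using x by (auto simp: supp_def sp)
    obtain s where s: "s \<in> \<rat>" "0 < s" "s < r / 2" using Rats_dense_in_real[of 0 "r / 2"] r by auto
    \<comment> \<open>The choice gives \<open>d * h \<le> s / 2\<close>, so the rational centre is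
      closer to \<open>x\<close> than \<open>s\<close>; the summand 1 keeps the denominator positive
      for \<open>d = 0\<close>.\<close>
    define h where "h = s / (2 * (real d + 1))"
    have h: "0 < h" using s by (simp add: h_def)
    have "real d * h \<le> (real d + 1) * h" using h by (simp add: algebra_simps)
    also have "\<dots> = s / 2" by (simp add: h_def field_simps)
    finally have h_s: "real d * h < s" using s by simp
    obtain a where a: "a \<in> (\<Pi>\<^sub>E i\<in>{..<d}. \<rat>)" "edist d a x \<le> d * h" by (rule rational_point_near[OF h])
    have ax: "edist d a x < s" using a(2) h_s by linarith
    have "B (a, s) \<subseteq> {y \<in> space (Rd d). edist d x y < r}"
    proof
      fix y assume y: "y \<in> B (a, s)"
      have "edist d x y \<le> edist d x a + edist d a y" by (rule edist_triangle)
      also have "\<dots> < r" using y ax s by (simp add: B_def edist_commute[of d x a])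
      finally show "y \<in> {y \<in> space (Rd d). edist d x y < r}" using y by (simp add: B_def)
    qed
    then have "emeasure P (B (a, s)) \<le> emeasure P {y \<in> space (Rd d). edist d x y < r}"
      by (rule emeasure_mono) (simp add: sets)
    then have "(a, s) \<in> G" using a s r by (simp add: G_def)
    moreover have "x \<in> B (a, s)" using ax x sp by (simp add: B_def)
    ultimately show ?thesis by blast
  qed
  then show ?thesis by (intro AE_I'[OF null]) blast
qed

lemma supp_nonempty:
  assumes "borel_prob d P"
  shows "supp d P \<noteq> {}"
proof
  interpret prob_space P using assms by (simp add: borel_prob_def)
  assume "supp d P = {}"
  with AE_in_supp[OF assms] have "AE x in P. False" by simp
  then show False by simp
qed

text \<open>The centres form a grid of mesh \<open>h\<close> around \<open>y0\<close>. Rounding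
  every coordinate down to the grid moves a point by at most
  \<open>d * h \<le> \<delta>\<close>.\<close>

lemma finite_cover_of_bounded:
  assumes S: "S \<subseteq> space (Rd d)" "\<And>y. y \<in> S \<Longrightarrow> edist d y0 y \<le> R" and \<delta>: "0 < \<delta>"
  obtains F where "finite F" "F \<subseteq> space (Rd d)" "S \<subseteq> (\<Union>a\<in>F. {y \<in> space (Rd d). edist d a y \<le> \<delta>})"
proof -
  define h where "h = \<delta> / (real d + 1)"
  have h: "0 < h" "real d * h \<le> \<delta>" using \<delta> by (auto simp: h_def field_simps)
  \<comment> \<open>Rounding down can land one grid step below \<open>- R / h\<close>, hence the
    extra 1.\<close>
  define M where "M = \<lceil>R / h\<rceil> + 1"
  define F where "F = (\<Pi>\<^sub>E i\<in>{..<d}. (\<lambda>m. y0 i + real_of_int m * h) ` {- M..M})"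
  show ?thesis
  proof (rule that[of F])
    show "finite F" unfolding F_def by (intro finite_PiE) auto
    show "F \<subseteq> space (Rd d)" by (auto simp: F_def space_Rd PiE_def)
    show "S \<subseteq> (\<Union>a\<in>F. {y \<in> space (Rd d). edist d a y \<le> \<delta>})"
    proof
      fix y assume y: "y \<in> S"
      define a where "a = (\<lambda>i\<in>{..<d}. y0 i + real_of_int \<lfloor>(y i - y0 i) / h\<rfloor> * h)"
      have "\<bar>a i - y i\<bar> \<le> h" if i: "i < d" for i
      proof -
        define t where "t = (y i - y0 i) / h"
        have t: "y i = y0 i + t * h" using h by (simp add: t_def)
        have "\<bar>real_of_int \<lfloor>t\<rfloor> - t\<bar> \<le> 1" by linarith
        then have "\<bar>real_of_int \<lfloor>t\<rfloor> - t\<bar> * h \<le> 1 * h" using h by (intro mult_right_mono) auto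
        then have "\<bar>(real_of_int \<lfloor>t\<rfloor> - t) * h\<bar> \<le> h" using h by (simp add: abs_mult)
        moreover have "a i - y i = (real_of_int \<lfloor>t\<rfloor> - t) * h"
          using i unfolding t by (simp add: a_def t_def algebra_simps)
        ultimately show ?thesis by simp
      qed
      then have "edist d a y \<le> d * h" by (rule edist_le_of_coordinates)
      moreover have "a \<in> F"
        unfolding F_def
      proof (rule PiE_I)
        fix i assume i: "i \<in> {..<d}"
        have "\<bar>y i - y0 i\<bar> \<le> R" using coordinate_le_edist[of i d y0 y] S(2)[OF y] i by auto
        then have "- (R / h) \<le> (y i - y0 i) / h" "(y i - y0 i) / h \<le> R / h"
          using h by (auto simp: pos_divide_le_eq pos_le_divide_eq)
        then have "\<lfloor>(y i - y0 i) / h\<rfloor> \<le> \<lceil>R / h\<rceil> + 1" "- (\<lceil>R / h\<rceil> + 1) \<le> \<lfloor>(y i - y0 i) / h\<rfloor>"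
          by linarith+
        then have "\<lfloor>(y i - y0 i) / h\<rfloor> \<in> {- M..M}" unfolding M_def by simp
        then show "a i \<in> (\<lambda>m. y0 i + real_of_int m * h) ` {- M..M}"
          using i by (auto simp: a_def)
      qed (simp add: a_def)
      ultimately show "y \<in> (\<Union>a\<in>F. {y \<in> space (Rd d). edist d a y \<le> \<delta>})"
        using y S(1) h by force
    qed
  qed
qed

text \<open>A finite infimum in \<open>enat\<close> is attained: the empty set would give
  \<infinity>, and a nonempty set has a least element.\<close>

lemma covering_number_attained:
  assumes "covering_number d P \<delta> = enat N"
  obtains F where "finite F" "card F = N" "F \<subseteq> space (Rd d)"
    "supp d P \<subseteq> (\<Union>a\<in>F. {y \<in> space (Rd d). edist d a y \<le> \<delta>})"
proof -
  define \<F> where "\<F> = {F. finite F \<and> F \<subseteq> space (Rd d) \<and>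
                  supp d P \<subseteq> (\<Union>a\<in>F. {y \<in> space (Rd d). edist d a y \<le> \<delta>})}"
  have eq: "Inf ((\<lambda>F. enat (card F)) ` \<F>) = enat N"
    using assms by (simp add: covering_number_def \<F>_def)
  then have "(\<lambda>F. enat (card F)) ` \<F> \<noteq> {}" by (auto simp: Inf_enat_def split: if_splits)
  then have "Inf ((\<lambda>F. enat (card F)) ` \<F>) \<in> (\<lambda>F. enat (card F)) ` \<F>"
    unfolding Inf_enat_def by (auto intro: LeastI)
  then obtain F where "F \<in> \<F>" "card F = N" unfolding eq by auto
  then show ?thesis using that by (auto simp: \<F>_def)
qed

text \<open>Applied to \<open>\<nu>\<close>, whose support has bounded diameter; then the minimum in
  \<open>min_covering\<close> is finite and its conversion to a real is faithful, even if the
  support of \<open>\<mu>\<close> is unbounded.\<close>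

lemma covering_number_finite:
  assumes "\<And>y y'. y \<in> supp d P \<Longrightarrow> y' \<in> supp d P \<Longrightarrow> edist d y y' \<le> R" "0 < \<delta>" "borel_prob d P"
  shows "covering_number d P \<delta> \<noteq> \<infinity>"
proof -
  obtain y0 where y0: "y0 \<in> supp d P" using supp_nonempty[OF assms(3)] by auto
  obtain F where F: "finite F" "F \<subseteq> space (Rd d)" "supp d P \<subseteq> (\<Union>a\<in>F. {y \<in> space (Rd d). edist d a y \<le> \<delta>})"
    by (rule finite_cover_of_bounded[of "supp d P" d y0 R \<delta>])
      (use assms y0 in \<open>auto simp: supp_def\<close>)
  then have "covering_number d P \<delta> \<le> enat (card F)"
    unfolding covering_number_def by (intro INF_lower) auto
  also have "\<dots> < \<infinity>" by simp
  finally show ?thesis by simp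
qed

section \<open>Second moment of the optimal density and covering numbers\<close>

context schrodinger_system
begin

lemma nn_integral_p_right:
  assumes "y \<in> space Q"
  shows "(\<integral>\<^sup>+x. ennreal (p x y) \<partial>P) = 1"
proof -
  interpret T: schrodinger_system Q P "\<lambda>y x. k x y" v u \<gamma> by (rule swap)
  have "T.p y x = p x y" for x by (simp add: p_def T.p_def mult_ac)
  then show ?thesis using T.nn_integral_p[OF assms] by simp
qed

definition p_norm_sq :: ennreal where
  "p_norm_sq = (\<integral>\<^sup>+x. \<integral>\<^sup>+y. ennreal ((p x y)\<^sup>2) \<partial>Q \<partial>P)"

lemma p_sq_measurable [measurable]: "(\<lambda>(x, y). ennreal ((p x y)\<^sup>2)) \<in> borel_measurable (P \<Otimes>\<^sub>M Q)"
proof -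
  have "(\<lambda>z. ennreal ((p (fst z) (snd z))\<^sup>2)) \<in> borel_measurable (P \<Otimes>\<^sub>M Q)" by measurable
  then show ?thesis by (simp add: split_beta')
qed

text \<open>On a cell \<open>A\<close> on which \<open>p\<close> is comparable, \<open>p\<close> is at most \<open>\<kappa>\<^sup>2 / P A\<close> because its
  integral over \<open>A\<close> is at most one.\<close>

lemma cell_bound:
  assumes A [measurable]: "A \<in> sets P" and X: "AE x in P. x \<in> X" and Y: "AE y in Q. y \<in> Y"
    and \<kappa>: "0 < \<kappa>"
    and cmp: "\<And>x x' y. x \<in> A \<Longrightarrow> x \<in> X \<Longrightarrow> x' \<in> A \<Longrightarrow> x' \<in> X \<Longrightarrow> y \<in> Y \<Longrightarrow> k x y \<le> \<kappa> * k x' y"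
  shows "(\<integral>\<^sup>+x. indicator A x * (\<integral>\<^sup>+y. ennreal ((p x y)\<^sup>2) \<partial>Q) \<partial>P) \<le> ennreal (\<kappa>\<^sup>2)"
proof (cases "measure P A = 0")
  case True
  then have "AE x in P. x \<notin> A"
    using A P.emeasure_eq_measure by (intro AE_not_in null_setsI) auto
  then have "(\<integral>\<^sup>+x. indicator A x * (\<integral>\<^sup>+y. ennreal ((p x y)\<^sup>2) \<partial>Q) \<partial>P) = (\<integral>\<^sup>+x. 0 \<partial>P)"
    by (intro nn_integral_cong_AE) (auto elim!: eventually_mono)
  then show ?thesis by simp
next
  case False
  then have PA: "0 < measure P A" by (simp add: less_le)
  have As: "x \<in> space P" if "x \<in> A" for x using that sets.sets_into_space[OF A] by auto
  \<comment> \<open>\<open>1 / u x\<close> is the average of \<open>k x\<close> against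
    \<open>v\<close>, so \<open>u\<close> inherits the comparison of the kernel with the same
    \<kappa>. With the kernel itself this makes \<open>\<kappa>^2\<close> for \<open>p\<close>, as
    \<open>v\<close> does not depend on \<open>x\<close>.\<close>
  have ucmp: "u x \<le> \<kappa> * u x'" if x: "x \<in> A" "x \<in> X" "x' \<in> A" "x' \<in> X" for x x'
  proof -
    have vint: "integrable Q (\<lambda>y. v y * k z y)" "0 < (\<integral>y. v y * k z y \<partial>Q)" if z: "z \<in> space P" for z
    proof -
      have v: "pos_bounded Q v" unfolding pos_bounded_def using v_range by (meson exp_gt_zero v_measurable)
      show "integrable Q (\<lambda>y. v y * k z y)" "0 < (\<integral>y. v y * k z y \<partial>Q)"
        using integrable_section[OF v z] integral_section_pos[OF v z] by auto
    qed
    have ueq: "u z = 1 / (\<integral>y. v y * k z y \<partial>Q)" if "z \<in> space P" for z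
      using marginal_left[OF that] vint(2)[OF that] by (simp add: eq_divide_eq)
    have "(\<integral>y. v y * k x' y \<partial>Q) \<le> (\<integral>y. \<kappa> * (v y * k x y) \<partial>Q)"
    proof (rule integral_mono_AE)
      show "AE y in Q. v y * k x' y \<le> \<kappa> * (v y * k x y)"
        using Y AE_space
      proof eventually_elim
        fix y assume y: "y \<in> Y" "y \<in> space Q"
        have "v y * k x' y \<le> v y * (\<kappa> * k x y)"
          using cmp[OF x(3,4,1,2) y(1)] v_pos[OF y(2)] by (intro mult_left_mono) auto
        then show "v y * k x' y \<le> \<kappa> * (v y * k x y)" by (simp add: mult_ac)
      qed
    qed (use vint As x in auto)
    then have "(\<integral>y. v y * k x' y \<partial>Q) \<le> \<kappa> * (\<integral>y. v y * k x y \<partial>Q)" by simp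
    then show ?thesis
      using vint(2)[OF As[OF x(1)]] vint(2)[OF As[OF x(3)]]
      by (simp add: ueq As x pos_divide_le_eq pos_le_divide_eq mult_ac)
  qed
  have pcmp: "p x y \<le> \<kappa>\<^sup>2 * p x' y" if x: "x \<in> A" "x \<in> X" "x' \<in> A" "x' \<in> X" and y: "y \<in> Y" "y \<in> space Q" for x x' y
  proof -
    have "u x * v y * k x y \<le> (\<kappa> * u x') * v y * (\<kappa> * k x' y)"
      using ucmp[OF x] cmp[OF x y(1)] u_pos[OF As] v_pos[OF y(2)] k_pos[OF As y(2)] x \<kappa>
      by (intro mult_mono) (auto simp: less_imp_le intro!: mult_nonneg_nonneg)
    then show ?thesis by (simp add: p_def power2_eq_square mult_ac)
  qed
  have pb: "p x y * measure P A \<le> \<kappa>\<^sup>2" if x: "x \<in> A" "x \<in> X" and y: "y \<in> Y" "y \<in> space Q" for x y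
  proof -
    have "(\<lambda>x. p x y) \<in> borel_measurable P"
      using measurable_compose[OF measurable_Pair2'[OF y(2)] p_measurable(2)] by simp
    note [measurable] = this
    have "ennreal (p x y * measure P A) = (\<integral>\<^sup>+x'. ennreal (p x y) * indicator A x' \<partial>P)"
      using p_pos[OF As[OF x(1)] y(2)]
      by (subst nn_integral_cmult_indicator) (auto simp: P.emeasure_eq_measure ennreal_mult less_imp_le)
    also have "\<dots> \<le> (\<integral>\<^sup>+x'. ennreal (\<kappa>\<^sup>2) * ennreal (p x' y) \<partial>P)"
    proof (rule nn_integral_mono_AE)
      show "AE x' in P. ennreal (p x y) * indicator A x' \<le> ennreal (\<kappa>\<^sup>2) * ennreal (p x' y)"
        using X
      proof eventually_elim
        fix x' assume x': "x' \<in> X"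
        show "ennreal (p x y) * indicator A x' \<le> ennreal (\<kappa>\<^sup>2) * ennreal (p x' y)"
        proof (cases "x' \<in> A")
          case True
          then show ?thesis
            using pcmp[OF x True x' y] p_pos[OF As y(2)] by (simp add: ennreal_leI flip: ennreal_mult')
        qed simp
      qed
    qed
    also have "\<dots> = ennreal (\<kappa>\<^sup>2)"
      by (subst nn_integral_cmult) (auto simp: nn_integral_p_right[OF y(2)])
    finally show ?thesis by (simp add: ennreal_le_iff)
  qed
  define K where "K = \<kappa>\<^sup>2 / measure P A"
  have K: "0 \<le> K" using PA by (simp add: K_def)
  \<comment> \<open>One factor of the square is bounded by \<open>K\<close>, and the other
    integrates to one. The mass of the cell then cancels against the denominator of
    \<open>K\<close>.\<close>
  have inner: "(\<integral>\<^sup>+y. ennreal ((p x y)\<^sup>2) \<partial>Q) \<le> ennreal K" if x: "x \<in> A" "x \<in> X" for x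
  proof -
    have "(\<integral>\<^sup>+y. ennreal ((p x y)\<^sup>2) \<partial>Q) \<le> (\<integral>\<^sup>+y. ennreal K * ennreal (p x y) \<partial>Q)"
    proof (rule nn_integral_mono_AE)
      show "AE y in Q. ennreal ((p x y)\<^sup>2) \<le> ennreal K * ennreal (p x y)"
        using Y AE_space
      proof eventually_elim
        fix y assume y: "y \<in> Y" "y \<in> space Q"
        have "p x y \<le> K" using pb[OF x y] PA by (simp add: K_def pos_le_divide_eq)
        then have "(p x y)\<^sup>2 \<le> K * p x y"
          using p_pos[OF As[OF x(1)] y(2)] by (simp add: power2_eq_square mult_right_mono)
        then show "ennreal ((p x y)\<^sup>2) \<le> ennreal K * ennreal (p x y)"
          using K by (simp add: ennreal_leI flip: ennreal_mult')
      qed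
    qed
    also have "\<dots> = ennreal K * (\<integral>\<^sup>+y. ennreal (p x y) \<partial>Q)"
      using p_section[OF As[OF x(1)]] by (intro nn_integral_cmult) auto
    also have "\<dots> = ennreal K" by (simp add: nn_integral_p[OF As[OF x(1)]])
    finally show ?thesis .
  qed
  have "(\<integral>\<^sup>+x. indicator A x * (\<integral>\<^sup>+y. ennreal ((p x y)\<^sup>2) \<partial>Q) \<partial>P) \<le> (\<integral>\<^sup>+x. ennreal K * indicator A x \<partial>P)"
    using X by (intro nn_integral_mono_AE) (auto elim!: eventually_mono simp: inner split: split_indicator)
  also have "\<dots> = ennreal K * emeasure P A" by (rule nn_integral_cmult_indicator) simp
  also have "\<dots> = ennreal (\<kappa>\<^sup>2)"
    using K PA by (simp add: P.emeasure_eq_measure K_def flip: ennreal_mult')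
  finally show ?thesis .
qed

text \<open>A cell contributes at most \<open>\<kappa>^2\<close> whatever its mass, so only the
  number of cells counts. The cells are balls and may overlap, hence an inequality with a sum of
  indicators in place of a partition.\<close>

lemma p_norm_sq_le:
  assumes F: "finite F" "\<And>a. a \<in> F \<Longrightarrow> A a \<in> sets P" and X: "AE x in P. x \<in> X" and Y: "AE y in Q. y \<in> Y"
    and cover: "X \<subseteq> (\<Union>a\<in>F. A a)" and \<kappa>: "0 < \<kappa>"
    and cmp: "\<And>a x x' y. a \<in> F \<Longrightarrow> x \<in> A a \<Longrightarrow> x \<in> X \<Longrightarrow> x' \<in> A a \<Longrightarrow> x' \<in> X \<Longrightarrow> y \<in> Y \<Longrightarrow> k x y \<le> \<kappa> * k x' y"
  shows "p_norm_sq \<le> ennreal (\<kappa>\<^sup>2 * card F)"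
proof -
  have [measurable]: "A a \<in> sets P" if "a \<in> F" for a using F that by auto
  have "p_norm_sq \<le> (\<integral>\<^sup>+x. (\<Sum>a\<in>F. indicator (A a) x * (\<integral>\<^sup>+y. ennreal ((p x y)\<^sup>2) \<partial>Q)) \<partial>P)"
    unfolding p_norm_sq_def
  proof (rule nn_integral_mono_AE)
    show "AE x in P. (\<integral>\<^sup>+y. ennreal ((p x y)\<^sup>2) \<partial>Q)
        \<le> (\<Sum>a\<in>F. indicator (A a) x * (\<integral>\<^sup>+y. ennreal ((p x y)\<^sup>2) \<partial>Q))"
      using X
    proof eventually_elim
      fix x assume "x \<in> X"
      then obtain a where a: "a \<in> F" "x \<in> A a" using cover by auto
      have "(\<integral>\<^sup>+y. ennreal ((p x y)\<^sup>2) \<partial>Q) = indicator (A a) x * (\<integral>\<^sup>+y. ennreal ((p x y)\<^sup>2) \<partial>Q)"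
        using a by simp
      also have "\<dots> \<le> (\<Sum>a\<in>F. indicator (A a) x * (\<integral>\<^sup>+y. ennreal ((p x y)\<^sup>2) \<partial>Q))"
        using F a by (intro member_le_sum[where f = "\<lambda>a. indicator (A a) x * (\<integral>\<^sup>+y. ennreal ((p x y)\<^sup>2) \<partial>Q)"]) auto
      finally show "(\<integral>\<^sup>+y. ennreal ((p x y)\<^sup>2) \<partial>Q)
        \<le> (\<Sum>a\<in>F. indicator (A a) x * (\<integral>\<^sup>+y. ennreal ((p x y)\<^sup>2) \<partial>Q))" .
    qed
  qed
  also have "\<dots> = (\<Sum>a\<in>F. \<integral>\<^sup>+x. indicator (A a) x * (\<integral>\<^sup>+y. ennreal ((p x y)\<^sup>2) \<partial>Q) \<partial>P)"
    by (rule nn_integral_sum) measurable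
  also have "\<dots> \<le> (\<Sum>a\<in>F. ennreal (\<kappa>\<^sup>2))"
    using F by (intro sum_mono cell_bound[OF _ X Y \<kappa>]) (auto intro: cmp)
  also have "\<dots> = ennreal (\<kappa>\<^sup>2 * card F)"
    by (simp add: mult.commute ennreal_mult' flip: ennreal_of_nat_eq_real_of_nat)
  finally show ?thesis .
qed

end

text \<open>Clipping does not increase differences. The allowance \<open>2 * \<epsilon>\<close> is
  the variation of the cost over a ball of radius \<open>\<epsilon> / L\<close>, whose diameter is
  twice that radius; squaring \<open>exp 2\<close> later gives \<open>exp 4\<close>.\<close>

lemma gibbs_kernel_ratio:
  assumes "\<bar>c x y - c x' y'\<bar> \<le> 2 * \<epsilon>" "0 < \<epsilon>"
  shows "gibbs_kernel c \<epsilon> x y \<le> exp 2 * gibbs_kernel c \<epsilon> x' y'"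
proof -
  have "\<bar>max (- 1) (min 1 (c x y)) - max (- 1) (min 1 (c x' y'))\<bar> \<le> 2 * \<epsilon>"
    using assms(1) by (auto simp: max_def min_def abs_le_iff)
  then have "- max (- 1) (min 1 (c x y)) / \<epsilon> \<le> (2 * \<epsilon> - max (- 1) (min 1 (c x' y'))) / \<epsilon>"
    using assms(2) by (intro divide_right_mono) (auto simp: abs_le_iff)
  also have "\<dots> = 2 + - max (- 1) (min 1 (c x' y')) / \<epsilon>" using assms(2) by (simp add: field_simps)
  finally show ?thesis unfolding gibbs_kernel_def by (simp flip: exp_add)
qed

lemma p_norm_sq_le_covering:
  assumes sys: "schrodinger_system P Q k u v \<gamma>"
    and P: "borel_prob d P" and Q: "borel_prob d Q" and L: "0 < L" and \<epsilon>: "0 < \<epsilon>"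
    and cmp: "\<And>x x' y. x \<in> supp d P \<Longrightarrow> x' \<in> supp d P \<Longrightarrow> y \<in> supp d Q \<Longrightarrow> edist d x x' \<le> 2 * (\<epsilon> / L)
       \<Longrightarrow> k x y \<le> exp 2 * k x' y"
    and N: "covering_number d P (\<epsilon> / L) = enat N"
  shows "schrodinger_system.p_norm_sq P Q k u v \<le> ennreal (exp 4 * N)"
proof -
  interpret schrodinger_system P Q k u v \<gamma> by fact
  obtain F where F: "finite F" "card F = N" "F \<subseteq> space (Rd d)"
    "supp d P \<subseteq> (\<Union>a\<in>F. {y \<in> space (Rd d). edist d a y \<le> \<epsilon> / L})"
    by (rule covering_number_attained[OF N])
  have "p_norm_sq \<le> ennreal ((exp 2)\<^sup>2 * card F)"
  proof (rule p_norm_sq_le[OF F(1) _ AE_in_supp[OF P] AE_in_supp[OF Q] F(4)])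
    fix a x x' y
    assume *: "x \<in> {y \<in> space (Rd d). edist d a y \<le> \<epsilon> / L}" "x' \<in> {y \<in> space (Rd d). edist d a y \<le> \<epsilon> / L}"
      and **: "x \<in> supp d P" "x' \<in> supp d P" "y \<in> supp d Q"
    have "edist d x x' \<le> edist d x a + edist d a x'" by (rule edist_triangle)
    also have "\<dots> \<le> 2 * (\<epsilon> / L)" using * by (simp add: edist_commute[of d x a])
    finally show "k x y \<le> exp 2 * k x' y" by (rule cmp[OF **])
  qed (use P in \<open>auto simp: borel_prob_def\<close>)
  also have "(exp 2)\<^sup>2 = (exp 4 :: real)" by (simp flip: exp_double)
  finally show ?thesis by (simp add: F(2))
qed

section \<open>Fluctuations of sample averages\<close>

lemma (in prob_space) integral_bounded_sq:
  fixes f :: "'a \<Rightarrow> real"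
  assumes f [measurable]: "f \<in> borel_measurable M" and B: "\<And>x. x \<in> space M \<Longrightarrow> \<bar>f x\<bar> \<le> B"
  shows "integrable M f" "integrable M (\<lambda>x. (f x)\<^sup>2)"
    "(\<integral>x. (f x - (\<integral>x. f x \<partial>M))\<^sup>2 \<partial>M) = (\<integral>x. (f x)\<^sup>2 \<partial>M) - (\<integral>x. f x \<partial>M)\<^sup>2"
proof -
  show i1: "integrable M f" by (rule integrable_bounded[OF f B])
  show i2: "integrable M (\<lambda>x. (f x)\<^sup>2)"
  proof (rule integrable_bounded[of _ "B\<^sup>2"])
    fix x assume "x \<in> space M"
    from power_mono[OF B[OF this], of 2] show "\<bar>(f x)\<^sup>2\<bar> \<le> B\<^sup>2" by simp
  qed simp
  show "(\<integral>x. (f x - (\<integral>x. f x \<partial>M))\<^sup>2 \<partial>M) = (\<integral>x. (f x)\<^sup>2 \<partial>M) - (\<integral>x. f x \<partial>M)\<^sup>2"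
    using i1 i2 by (rule variance_eq)
qed

text \<open>This is nonnegativity of the variance of the absolute value.\<close>

lemma (in prob_space) integral_abs_le_sqrt:
  fixes f :: "'a \<Rightarrow> real"
  assumes f [measurable]: "f \<in> borel_measurable M" and B: "\<And>x. x \<in> space M \<Longrightarrow> \<bar>f x\<bar> \<le> B"
  shows "(\<integral>x. \<bar>f x\<bar> \<partial>M) \<le> sqrt (\<integral>x. (f x)\<^sup>2 \<partial>M)"
proof -
  have "0 \<le> (\<integral>x. (\<bar>f x\<bar> - (\<integral>x. \<bar>f x\<bar> \<partial>M))\<^sup>2 \<partial>M)" by simp
  also have "\<dots> = (\<integral>x. (f x)\<^sup>2 \<partial>M) - (\<integral>x. \<bar>f x\<bar> \<partial>M)\<^sup>2"
    using integral_bounded_sq(3)[of "\<lambda>x. \<bar>f x\<bar>" B] B by simp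
  finally show ?thesis by (simp add: real_le_rsqrt)
qed

lemma integral_PiM_component:
  fixes h :: "'a \<Rightarrow> real" and n :: nat
  assumes Q: "prob_space Q" and [measurable]: "h \<in> borel_measurable Q" and j: "j < n"
  shows "(\<integral>y. h (y j) \<partial>(\<Pi>\<^sub>M j\<in>{..<n}. Q)) = (\<integral>y. h y \<partial>Q)"
proof -
  have "(\<integral>y. h y \<partial>Q) = (\<integral>y. h y \<partial>distr (\<Pi>\<^sub>M j\<in>{..<n}. Q) Q (\<lambda>\<omega>. \<omega> j))"
    using distr_PiM_component[of "{..<n}" "\<lambda>_. Q" j] Q j by simp
  also have "\<dots> = (\<integral>y. h (y j) \<partial>(\<Pi>\<^sub>M j\<in>{..<n}. Q))"
    by (rule integral_distr) (use j in auto)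
  finally show ?thesis ..
qed

lemma prob_space_PiM_const: "prob_space Q \<Longrightarrow> prob_space (\<Pi>\<^sub>M j\<in>{..<n}. Q)"
  by (rule prob_space_PiM)

text \<open>After centring, the off-diagonal products have mean zero by independence. The variance
  is then relaxed to the second moment, which is the quantity that the covering argument
  controls.\<close>

lemma iid_mean_variance:
  fixes \<phi> :: "'a \<Rightarrow> real" and n :: nat
  assumes Q: "prob_space Q" and \<phi> [measurable]: "\<phi> \<in> borel_measurable Q"
    and B: "\<And>y. y \<in> space Q \<Longrightarrow> \<bar>\<phi> y\<bar> \<le> B" and n: "1 \<le> n"
  shows "(\<integral>y. ((\<Sum>j<n. \<phi> (y j)) / n - (\<integral>y. \<phi> y \<partial>Q))\<^sup>2 \<partial>(\<Pi>\<^sub>M j\<in>{..<n}. Q)) \<le> (\<integral>y. (\<phi> y)\<^sup>2 \<partial>Q) / n"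
proof -
  interpret Q: prob_space Q by fact
  let ?Pi = "\<Pi>\<^sub>M j\<in>{..<n}. Q"
  interpret Pi: prob_space ?Pi by (rule prob_space_PiM_const[OF Q])
  interpret product_sigma_finite "\<lambda>_::nat. Q" by unfold_locales
  define m where "m = (\<integral>y. \<phi> y \<partial>Q)"
  define \<psi> where "\<psi> y = \<phi> y - m" for y
  have [measurable]: "\<psi> \<in> borel_measurable Q" unfolding \<psi>_def[abs_def] by measurable
  have \<psi>B: "\<bar>\<psi> y\<bar> \<le> B + \<bar>m\<bar>" if "y \<in> space Q" for y using B[OF that] by (simp add: \<psi>_def)
  have \<phi>i: "integrable Q \<phi>" by (rule Q.integrable_bounded[OF \<phi> B])
  have \<psi>i: "integrable Q \<psi>" unfolding \<psi>_def using \<phi>i by simp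
  have \<psi>0: "(\<integral>y. \<psi> y \<partial>Q) = 0" unfolding \<psi>_def using \<phi>i by (simp add: m_def Q.prob_space)
  have comp: "y j \<in> space Q" if "y \<in> space ?Pi" "j < n" for y j
    using that by (auto simp: space_PiM)
  have prodi: "integrable ?Pi (\<lambda>y. \<psi> (y j) * \<psi> (y l))" if "j < n" "l < n" for j l
  proof (rule Pi.integrable_bounded[of _ "(B + \<bar>m\<bar>) * (B + \<bar>m\<bar>)"])
    show "(\<lambda>y. \<psi> (y j) * \<psi> (y l)) \<in> borel_measurable ?Pi"
      using that by (intro borel_measurable_times measurable_compose[OF measurable_component_singleton]) auto
    fix y assume y: "y \<in> space ?Pi"
    show "\<bar>\<psi> (y j) * \<psi> (y l)\<bar> \<le> (B + \<bar>m\<bar>) * (B + \<bar>m\<bar>)"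
      unfolding abs_mult using \<psi>B[OF comp[OF y]] that
      by (intro mult_mono) (auto intro: order_trans[OF abs_ge_zero])
  qed
  have cross: "(\<integral>y. \<psi> (y j) * \<psi> (y l) \<partial>?Pi) = (if j = l then (\<integral>y. (\<psi> y)\<^sup>2 \<partial>Q) else 0)" if jl: "j < n" "l < n" for j l
  proof (cases "j = l")
    case True
    then show ?thesis
      using integral_PiM_component[OF Q, of "\<lambda>y. \<psi> y * \<psi> y" j n] jl by (simp add: power2_eq_square)
  next
    case False
    \<comment> \<open>Constant factors one in the other coordinates turn the product of two factors
      into a full product, to which the product formula for integrals applies.\<close>
    define f where "f i = (if i = j \<or> i = l then \<psi> else (\<lambda>_. 1))" for i
    have "(\<integral>y. \<psi> (y j) * \<psi> (y l) \<partial>?Pi) = (\<integral>y. (\<Prod>i<n. f i (y i)) \<partial>?Pi)"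
    proof (rule Bochner_Integration.integral_cong[OF refl])
      fix y
      have "(\<Prod>i<n. f i (y i)) = (\<Prod>i\<in>{j, l}. f i (y i))"
        using jl by (intro prod.mono_neutral_right) (auto simp: f_def)
      then show "\<psi> (y j) * \<psi> (y l) = (\<Prod>i<n. f i (y i))" using False by (simp add: f_def)
    qed
    also have "\<dots> = (\<Prod>i<n. \<integral>y. f i y \<partial>Q)"
      by (rule product_integral_prod) (use \<psi>i in \<open>auto simp: f_def\<close>)
    also have "\<dots> = 0" using jl \<psi>0 by (auto intro!: prod_zero bexI[of _ j] simp: f_def)
    finally show ?thesis using False by simp
  qed
  have "(\<integral>y. ((\<Sum>j<n. \<phi> (y j)) / n - m)\<^sup>2 \<partial>?Pi) = (\<integral>y. (\<Sum>j<n. \<Sum>l<n. \<psi> (y j) * \<psi> (y l)) / n\<^sup>2 \<partial>?Pi)"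
  proof (rule Bochner_Integration.integral_cong[OF refl])
    fix y
    have "(\<Sum>j<n. \<psi> (y j)) = (\<Sum>j<n. \<phi> (y j)) - n * m" by (simp add: \<psi>_def sum_subtractf)
    then have "(\<Sum>j<n. \<phi> (y j)) / n - m = (\<Sum>j<n. \<psi> (y j)) / n" using n by (simp add: field_simps)
    then show "((\<Sum>j<n. \<phi> (y j)) / n - m)\<^sup>2 = (\<Sum>j<n. \<Sum>l<n. \<psi> (y j) * \<psi> (y l)) / n\<^sup>2"
      by (simp add: power_divide power2_eq_square sum_product)
  qed
  also have "\<dots> = (\<Sum>j<n. \<Sum>l<n. \<integral>y. \<psi> (y j) * \<psi> (y l) \<partial>?Pi) / n\<^sup>2"
  proof -
    have "(\<integral>y. (\<Sum>j<n. \<Sum>l<n. \<psi> (y j) * \<psi> (y l)) \<partial>?Pi) = (\<Sum>j<n. \<integral>y. (\<Sum>l<n. \<psi> (y j) * \<psi> (y l)) \<partial>?Pi)"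
      by (intro Bochner_Integration.integral_sum Bochner_Integration.integrable_sum prodi) auto
    also have "\<dots> = (\<Sum>j<n. \<Sum>l<n. \<integral>y. \<psi> (y j) * \<psi> (y l) \<partial>?Pi)"
      by (intro sum.cong refl Bochner_Integration.integral_sum prodi) auto
    finally show ?thesis by simp
  qed
  also have "\<dots> = (\<Sum>j<n. \<Sum>l<n. if j = l then (\<integral>y. (\<psi> y)\<^sup>2 \<partial>Q) else 0) / n\<^sup>2"
    by (simp add: cross)
  also have "\<dots> = (\<integral>y. (\<psi> y)\<^sup>2 \<partial>Q) / n" using n by (simp add: power2_eq_square)
  also have "\<dots> \<le> (\<integral>y. (\<phi> y)\<^sup>2 \<partial>Q) / n"
    using Q.integral_bounded_sq(3)[OF \<phi> B] by (intro divide_right_mono) (auto simp: \<psi>_def m_def)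
  finally show ?thesis by (simp add: m_def)
qed

lemma sample_pair_measurable:
  fixes n :: nat
  assumes w: "(\<lambda>(x, y). w x y) \<in> borel_measurable (P \<Otimes>\<^sub>M Q)" and ij: "i < n" "j < n"
  shows "(\<lambda>s. w (fst s i) (snd s j)) \<in> borel_measurable ((\<Pi>\<^sub>M i\<in>{..<n}. P) \<Otimes>\<^sub>M (\<Pi>\<^sub>M j\<in>{..<n}. Q))"
proof -
  have "(\<lambda>s. (fst s i, snd s j)) \<in> measurable ((\<Pi>\<^sub>M i\<in>{..<n}. P) \<Otimes>\<^sub>M (\<Pi>\<^sub>M j\<in>{..<n}. Q)) (P \<Otimes>\<^sub>M Q)"
    using ij by (intro measurable_Pair measurable_compose[OF measurable_fst measurable_component_singleton]
        measurable_compose[OF measurable_snd measurable_component_singleton]) auto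
  from measurable_compose[OF this w] show ?thesis by simp
qed

text \<open>Given the point \<open>fst s i\<close>, the values along the row are independent and
  identically distributed. The variance bound applies conditionally and is then integrated over that
  point. \<open>B\<close> secures integrability and is absent from the second moment estimate, which
  matters since it will be of size \<open>exp (5 / \<epsilon>)\<close>.\<close>

lemma sample_row_error:
  fixes w :: "'a \<Rightarrow> 'b \<Rightarrow> real" and n :: nat
  assumes P: "prob_space P" and Q: "prob_space Q"
    and w [measurable]: "(\<lambda>(x, y). w x y) \<in> borel_measurable (P \<Otimes>\<^sub>M Q)"
    and B: "\<And>x y. x \<in> space P \<Longrightarrow> y \<in> space Q \<Longrightarrow> \<bar>w x y\<bar> \<le> B" and n: "1 \<le> n" and i: "i < n"
  defines "S \<equiv> (\<Pi>\<^sub>M i\<in>{..<n}. P) \<Otimes>\<^sub>M (\<Pi>\<^sub>M j\<in>{..<n}. Q)"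
    and "X \<equiv> \<lambda>s. (\<Sum>j<n. w (fst s i) (snd s j)) / n - (\<integral>y. w (fst s i) y \<partial>Q)"
  shows "X \<in> borel_measurable S" "\<And>s. s \<in> space S \<Longrightarrow> \<bar>X s\<bar> \<le> 2 * B"
    "(\<integral>s. (X s)\<^sup>2 \<partial>S) \<le> (\<integral>z. (w (fst z) (snd z))\<^sup>2 \<partial>(P \<Otimes>\<^sub>M Q)) / n"
proof -
  interpret P: prob_space P by fact
  interpret Q: prob_space Q by fact
  interpret PQ: pair_prob_space P Q ..
  interpret A: prob_space "\<Pi>\<^sub>M i\<in>{..<n}. P" by (rule prob_space_PiM_const[OF P])
  interpret B: prob_space "\<Pi>\<^sub>M j\<in>{..<n}. Q" by (rule prob_space_PiM_const[OF Q])
  interpret AB: pair_prob_space "\<Pi>\<^sub>M i\<in>{..<n}. P" "\<Pi>\<^sub>M j\<in>{..<n}. Q" ..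
  interpret S: prob_space S unfolding S_def by unfold_locales
  have sec: "w x \<in> borel_measurable Q" if "x \<in> space P" for x
    using measurable_compose[OF measurable_Pair1'[OF that] w] by simp
  have compA: "x i \<in> space P" if "x \<in> space (\<Pi>\<^sub>M i\<in>{..<n}. P)" for x using that i by (auto simp: space_PiM)
  have compB: "y j \<in> space Q" if "y \<in> space (\<Pi>\<^sub>M j\<in>{..<n}. Q)" "j < n" for y j using that by (auto simp: space_PiM)
  have mean: "(\<lambda>s. \<integral>y. w (fst s i) y \<partial>Q) \<in> borel_measurable S"
  proof -
    have "(\<lambda>x. \<integral>y. w x y \<partial>Q) \<in> borel_measurable P" by measurable
    moreover have "(\<lambda>s. fst s i) \<in> measurable S P" unfolding S_def
      using i by (intro measurable_compose[OF measurable_fst measurable_component_singleton]) auto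
    ultimately show ?thesis by (rule measurable_compose[rotated])
  qed
  show Xm: "X \<in> borel_measurable S"
    using mean sample_pair_measurable[OF w i] unfolding X_def S_def by measurable
  show XB: "\<bar>X s\<bar> \<le> 2 * B" if s: "s \<in> space S" for s
  proof -
    have f: "fst s i \<in> space P" "\<And>j. j < n \<Longrightarrow> snd s j \<in> space Q"
      using s compA compB by (auto simp: S_def space_pair_measure)
    have "\<bar>\<Sum>j<n. w (fst s i) (snd s j)\<bar> \<le> (\<Sum>j<n. B)"
      using B f by (intro order_trans[OF sum_abs] sum_mono) auto
    then have "\<bar>(\<Sum>j<n. w (fst s i) (snd s j)) / n\<bar> \<le> B" using n by (simp add: field_simps)
    moreover have "- B \<le> (\<integral>y. w (fst s i) y \<partial>Q)" "(\<integral>y. w (fst s i) y \<partial>Q) \<le> B"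
      using Q.integral_bounds[OF sec[OF f(1)], of "- B" B] B[OF f(1)] by (auto simp: abs_le_iff minus_le_iff)
    ultimately show ?thesis unfolding X_def by linarith
  qed
  have X2: "integrable S (\<lambda>s. (X s)\<^sup>2)" using S.integral_bounded_sq(2)[OF Xm XB] .
  have w2: "integrable (P \<Otimes>\<^sub>M Q) (\<lambda>(x, y). (w x y)\<^sup>2)"
  proof -
    have "integrable (P \<Otimes>\<^sub>M Q) (\<lambda>z. (case z of (x, y) \<Rightarrow> w x y)\<^sup>2)"
      by (rule PQ.P.integral_bounded_sq(2)[OF w, of B]) (use B in \<open>auto simp: space_pair_measure\<close>)
    then show ?thesis by (simp add: split_beta')
  qed
  have "(\<integral>s. (X s)\<^sup>2 \<partial>S) = (\<integral>x. \<integral>y. (X (x, y))\<^sup>2 \<partial>(\<Pi>\<^sub>M j\<in>{..<n}. Q) \<partial>(\<Pi>\<^sub>M i\<in>{..<n}. P))"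
    using AB.integral_fst'[of "\<lambda>s. (X s)\<^sup>2"] X2 unfolding S_def by simp
  also have "\<dots> \<le> (\<integral>x. (\<integral>y. (w (x i) y)\<^sup>2 \<partial>Q) / n \<partial>(\<Pi>\<^sub>M i\<in>{..<n}. P))"
  proof (rule integral_mono)
    show "integrable (\<Pi>\<^sub>M i\<in>{..<n}. P) (\<lambda>x. \<integral>y. (X (x, y))\<^sup>2 \<partial>(\<Pi>\<^sub>M j\<in>{..<n}. Q))"
      using AB.integrable_fst'[of "\<lambda>s. (X s)\<^sup>2"] X2 unfolding S_def by simp
    have m: "(\<lambda>x. \<integral>y. (w x y)\<^sup>2 \<partial>Q) \<in> borel_measurable P"
      using w2[THEN borel_measurable_integrable] by measurable
    show "integrable (\<Pi>\<^sub>M i\<in>{..<n}. P) (\<lambda>x. (\<integral>y. (w (x i) y)\<^sup>2 \<partial>Q) / n)"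
    proof (rule integrable_divide, rule A.integrable_bounded[of _ "B\<^sup>2"])
      show "(\<lambda>x. \<integral>y. (w (x i) y)\<^sup>2 \<partial>Q) \<in> borel_measurable (\<Pi>\<^sub>M i\<in>{..<n}. P)"
        using measurable_compose[OF measurable_component_singleton[of i "{..<n}" "\<lambda>_. P"] m] i by simp
      fix x assume "x \<in> space (\<Pi>\<^sub>M i\<in>{..<n}. P)"
      from compA[OF this] have x: "x i \<in> space P" .
      have "0 \<le> (w (x i) y)\<^sup>2 \<and> (w (x i) y)\<^sup>2 \<le> B\<^sup>2" if "y \<in> space Q" for y
        using power_mono[OF B[OF x that], of 2] by simp
      then have "0 \<le> (\<integral>y. (w (x i) y)\<^sup>2 \<partial>Q)" "(\<integral>y. (w (x i) y)\<^sup>2 \<partial>Q) \<le> B\<^sup>2"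
        using Q.integral_bounds[of "\<lambda>y. (w (x i) y)\<^sup>2" 0 "B\<^sup>2"] sec[OF x] by auto
      then show "\<bar>\<integral>y. (w (x i) y)\<^sup>2 \<partial>Q\<bar> \<le> B\<^sup>2" by simp
    qed
    fix x assume "x \<in> space (\<Pi>\<^sub>M i\<in>{..<n}. P)"
    from compA[OF this] have x: "x i \<in> space P" .
    show "(\<integral>y. (X (x, y))\<^sup>2 \<partial>(\<Pi>\<^sub>M j\<in>{..<n}. Q)) \<le> (\<integral>y. (w (x i) y)\<^sup>2 \<partial>Q) / n"
      using iid_mean_variance[OF Q sec[OF x] B[OF x] n] by (simp add: X_def)
  qed
  also have "\<dots> = (\<integral>x. \<integral>y. (w x y)\<^sup>2 \<partial>Q \<partial>P) / n"
  proof -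
    have "(\<lambda>x. \<integral>y. (w x y)\<^sup>2 \<partial>Q) \<in> borel_measurable P"
      using w2[THEN borel_measurable_integrable] by measurable
    from integral_PiM_component[OF P this i] show ?thesis by simp
  qed
  also have "(\<integral>x. \<integral>y. (w x y)\<^sup>2 \<partial>Q \<partial>P) = (\<integral>z. (w (fst z) (snd z))\<^sup>2 \<partial>(P \<Otimes>\<^sub>M Q))"
    using PQ.integral_fst'[OF w2] by (simp add: split_beta')
  finally show "(\<integral>s. (X s)\<^sup>2 \<partial>S) \<le> (\<integral>z. (w (fst z) (snd z))\<^sup>2 \<partial>(P \<Otimes>\<^sub>M Q)) / n" .
qed

text \<open>This is the row estimate with the two samples exchanged; its right-hand side is
  symmetric in them.\<close>

lemma sample_column_error:
  fixes w :: "'a \<Rightarrow> 'b \<Rightarrow> real" and n :: nat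
  assumes P: "prob_space P" and Q: "prob_space Q"
    and w [measurable]: "(\<lambda>(x, y). w x y) \<in> borel_measurable (P \<Otimes>\<^sub>M Q)"
    and B: "\<And>x y. x \<in> space P \<Longrightarrow> y \<in> space Q \<Longrightarrow> \<bar>w x y\<bar> \<le> B" and n: "1 \<le> n" and j: "j < n"
  defines "S \<equiv> (\<Pi>\<^sub>M i\<in>{..<n}. P) \<Otimes>\<^sub>M (\<Pi>\<^sub>M j\<in>{..<n}. Q)"
    and "X \<equiv> \<lambda>s. (\<Sum>i<n. w (fst s i) (snd s j)) / n - (\<integral>x. w x (snd s j) \<partial>P)"
  shows "X \<in> borel_measurable S" "\<And>s. s \<in> space S \<Longrightarrow> \<bar>X s\<bar> \<le> 2 * B"
    "(\<integral>s. (X s)\<^sup>2 \<partial>S) \<le> (\<integral>z. (w (fst z) (snd z))\<^sup>2 \<partial>(P \<Otimes>\<^sub>M Q)) / n"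
proof -
  interpret P: prob_space P by fact
  interpret Q: prob_space Q by fact
  interpret PQ: pair_prob_space P Q ..
  interpret A: prob_space "\<Pi>\<^sub>M i\<in>{..<n}. P" by (rule prob_space_PiM_const[OF P])
  interpret B: prob_space "\<Pi>\<^sub>M j\<in>{..<n}. Q" by (rule prob_space_PiM_const[OF Q])
  interpret AB: pair_prob_space "\<Pi>\<^sub>M i\<in>{..<n}. P" "\<Pi>\<^sub>M j\<in>{..<n}. Q" ..
  let ?T = "(\<Pi>\<^sub>M j\<in>{..<n}. Q) \<Otimes>\<^sub>M (\<Pi>\<^sub>M i\<in>{..<n}. P)"
  define Y where "Y = (\<lambda>s. (\<Sum>i<n. w (snd s i) (fst s j)) / n - (\<integral>x. w x (fst s j) \<partial>P))"
  have wm: "(\<lambda>(y, x). w x y) \<in> borel_measurable (Q \<Otimes>\<^sub>M P)"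
    using measurable_compose[OF measurable_pair_swap' w] by (simp add: split_beta')
  have B': "\<bar>w x y\<bar> \<le> B" if "y \<in> space Q" "x \<in> space P" for y x using B[OF that(2,1)] .
  note row = sample_row_error[OF Q P wm B' n j]
  have Y: "Y \<in> borel_measurable ?T" unfolding Y_def using row(1) by simp
  have Y2: "\<bar>Y s\<bar> \<le> 2 * B" if "s \<in> space ?T" for s unfolding Y_def using row(2)[where s = s] that by simp
  have Y3: "(\<integral>s. (Y s)\<^sup>2 \<partial>?T) \<le> (\<integral>z. (w (snd z) (fst z))\<^sup>2 \<partial>(Q \<Otimes>\<^sub>M P)) / n"
    unfolding Y_def using row(3) by simp
  have XY: "X = (\<lambda>s. Y (snd s, fst s))" by (simp add: X_def Y_def)
  have "(\<lambda>s. Y (snd s, fst s)) \<in> borel_measurable S"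
    using measurable_compose[OF measurable_pair_swap' Y] unfolding S_def by (simp add: split_beta')
  then show Xm: "X \<in> borel_measurable S" by (simp add: XY)
  show "\<bar>X s\<bar> \<le> 2 * B" if "s \<in> space S" for s
    using Y2[of "(snd s, fst s)"] that by (auto simp: XY S_def space_pair_measure)
  have "(\<integral>s. (X s)\<^sup>2 \<partial>S) = (\<integral>(y, x). (X (x, y))\<^sup>2 \<partial>?T)"
    using AB.integral_product_swap[of "\<lambda>s. (X s)\<^sup>2"] Xm unfolding S_def by simp
  also have "\<dots> = (\<integral>s. (Y s)\<^sup>2 \<partial>?T)" by (simp add: XY split_beta')
  also have "\<dots> \<le> (\<integral>z. (w (snd z) (fst z))\<^sup>2 \<partial>(Q \<Otimes>\<^sub>M P)) / n" by (rule Y3)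
  also have "(\<integral>z. (w (snd z) (fst z))\<^sup>2 \<partial>(Q \<Otimes>\<^sub>M P)) = (\<integral>z. (w (fst z) (snd z))\<^sup>2 \<partial>(P \<Otimes>\<^sub>M Q))"
  proof -
    have "(\<lambda>z. (w (fst z) (snd z))\<^sup>2) \<in> borel_measurable (P \<Otimes>\<^sub>M Q)"
      using w by (simp add: split_beta')
    from PQ.integral_product_swap[OF this] show ?thesis by (simp add: split_beta')
  qed
  finally show "(\<integral>s. (X s)\<^sup>2 \<partial>S) \<le> (\<integral>z. (w (fst z) (snd z))\<^sup>2 \<partial>(P \<Otimes>\<^sub>M Q)) / n" .
qed

section \<open>Comparison of densities on a sample\<close>

text \<open>From \<open>ln t \<le> t - 1\<close> at the quotient of the smaller by the larger number
  one gets the bound with the larger one as prefactor. It is relaxed to \<open>a + b\<close>, whose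
  sum over a row is just the total mass.\<close>

lemma sq_diff_le_log_diff:
  fixes a b :: real
  assumes "0 < a" "0 < b"
  shows "(a - b)\<^sup>2 \<le> (a + b) * ((a - b) * (ln a - ln b))"
  using assms
proof (induction a b rule: linorder_wlog)
  case (sym a b)
  have "(b - a)\<^sup>2 = (a - b)\<^sup>2" "(b + a) * ((b - a) * (ln b - ln a)) = (a + b) * ((a - b) * (ln a - ln b))"
    by (simp_all add: power2_commute algebra_simps)
  with sym show ?case by simp
next
  case (le a b)
  have "ln (a / b) \<le> a / b - 1" using le by (intro ln_le_minus_one) simp
  then have "1 - a / b \<le> ln b - ln a" using le by (simp add: ln_div)
  then have "(b - a) / b \<le> ln b - ln a" using le by (simp add: diff_divide_distrib)
  then have "(b - a) * ((b - a) / b) \<le> (b - a) * (ln b - ln a)" using le by (intro mult_left_mono) auto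
  then have "b * ((b - a) * ((b - a) / b)) \<le> b * ((b - a) * (ln b - ln a))"
    by (rule mult_left_mono) (use le in auto)
  also have "\<dots> \<le> (a + b) * ((b - a) * (ln b - ln a))"
    using le by (intro mult_right_mono mult_nonneg_nonneg) auto
  also have "b * ((b - a) * ((b - a) / b)) = (b - a) * (b - a)" using le by simp
  also have "(b - a) * (b - a) = (a - b)\<^sup>2" by (simp add: power2_eq_square algebra_simps)
  also have "(b - a) * (ln b - ln a) = (a - b) * (ln a - ln b)" by (simp add: algebra_simps)
  finally show ?case .
qed

lemma log_diff_nonneg:
  fixes a b :: real
  assumes "0 < a" "0 < b"
  shows "0 \<le> (a - b) * (ln a - ln b)"
  using assms by (cases "a \<le> b") (auto simp: zero_le_mult_iff)

text \<open>A Pinsker inequality for the symmetrised divergence, by Cauchy-Schwarz from the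
  pointwise bound. It is stated for unnormalised weights, because the rows of the population density
  on the sample do not sum to \<open>n\<close>.\<close>

lemma sum_abs_diff_sq_le:
  fixes p q :: "nat \<Rightarrow> real"
  assumes "\<And>j. j < n \<Longrightarrow> 0 < p j \<and> 0 < q j"
  shows "(\<Sum>j<n. \<bar>q j - p j\<bar>)\<^sup>2 \<le> (\<Sum>j<n. q j + p j) * (\<Sum>j<n. (q j - p j) * (ln (q j) - ln (p j)))"
proof -
  define f where "f j = sqrt (q j + p j)" for j
  define g where "g j = sqrt ((q j - p j) * (ln (q j) - ln (p j)))" for j
  have nn: "0 \<le> q j + p j" "0 \<le> (q j - p j) * (ln (q j) - ln (p j))" if "j < n" for j
    using assms[OF that] log_diff_nonneg[of "q j" "p j"] by auto
  have "\<bar>q j - p j\<bar> \<le> f j * g j" if "j < n" for j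
  proof -
    have "\<bar>q j - p j\<bar> = sqrt ((q j - p j)\<^sup>2)" by simp
    also have "\<dots> \<le> sqrt ((q j + p j) * ((q j - p j) * (ln (q j) - ln (p j))))"
      using assms[OF that] by (intro real_sqrt_le_mono sq_diff_le_log_diff) auto
    also have "\<dots> = f j * g j" by (simp add: f_def g_def real_sqrt_mult)
    finally show ?thesis .
  qed
  then have "(\<Sum>j<n. \<bar>q j - p j\<bar>) \<le> (\<Sum>j<n. f j * g j)" by (intro sum_mono) auto
  then have "(\<Sum>j<n. \<bar>q j - p j\<bar>)\<^sup>2 \<le> (\<Sum>j<n. f j * g j)\<^sup>2" by (intro power_mono sum_nonneg) auto
  also have "\<dots> \<le> (\<Sum>j<n. (f j)\<^sup>2) * (\<Sum>j<n. (g j)\<^sup>2)" by (rule Cauchy_Schwarz_ineq_sum)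
  also have "\<dots> = (\<Sum>j<n. q j + p j) * (\<Sum>j<n. (q j - p j) * (ln (q j) - ln (p j)))"
    using nn by (simp add: f_def g_def)
  finally show ?thesis .
qed

text \<open>The squared triangle inequality for vectors of norm at most \<open>R\<close>.
  Cauchy-Schwarz with weights \<open>\<bar>e j\<bar>\<close> is applied in each coordinate, and the
  coordinates are summed before \<open>R\<close> is inserted, so no factor \<open>d\<close>
  arises.\<close>

lemma weighted_vector_sum_le:
  fixes e :: "nat \<Rightarrow> real" and z :: "nat \<Rightarrow> nat \<Rightarrow> real"
  assumes z: "\<And>j. j < n \<Longrightarrow> (\<Sum>k<d. (z k j)\<^sup>2) \<le> R\<^sup>2"
  shows "(\<Sum>k<d. (\<Sum>j<n. e j * z k j)\<^sup>2) \<le> (\<Sum>j<n. \<bar>e j\<bar>)\<^sup>2 * R\<^sup>2"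
proof -
  have "(\<Sum>j<n. e j * z k j)\<^sup>2 \<le> (\<Sum>j<n. \<bar>e j\<bar>) * (\<Sum>j<n. \<bar>e j\<bar> * (z k j)\<^sup>2)" for k
  proof -
    have sq: "sqrt \<bar>e j\<bar> * sqrt \<bar>e j\<bar> = \<bar>e j\<bar>" for j by simp
    have "(\<Sum>j<n. e j * z k j) = (\<Sum>j<n. sqrt \<bar>e j\<bar> * (sgn (e j) * sqrt \<bar>e j\<bar> * z k j))"
    proof (intro sum.cong refl)
      fix j
      have "sqrt \<bar>e j\<bar> * (sgn (e j) * sqrt \<bar>e j\<bar> * z k j) = sgn (e j) * (sqrt \<bar>e j\<bar> * sqrt \<bar>e j\<bar>) * z k j"
        by (simp only: mult_ac)
      also have "\<dots> = e j * z k j" unfolding sq by (simp add: sgn_mult_abs)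
      finally show "e j * z k j = sqrt \<bar>e j\<bar> * (sgn (e j) * sqrt \<bar>e j\<bar> * z k j)" ..
    qed
    also have "\<dots>\<^sup>2 \<le> (\<Sum>j<n. (sqrt \<bar>e j\<bar>)\<^sup>2) * (\<Sum>j<n. (sgn (e j) * sqrt \<bar>e j\<bar> * z k j)\<^sup>2)"
      by (rule Cauchy_Schwarz_ineq_sum)
    also have "\<dots> = (\<Sum>j<n. \<bar>e j\<bar>) * (\<Sum>j<n. \<bar>e j\<bar> * (z k j)\<^sup>2)"
      by (intro arg_cong2[of _ _ _ _ "(*)"] sum.cong refl) (auto simp: power_mult_distrib sgn_if)
    finally show ?thesis .
  qed
  then have "(\<Sum>k<d. (\<Sum>j<n. e j * z k j)\<^sup>2) \<le> (\<Sum>k<d. (\<Sum>j<n. \<bar>e j\<bar>) * (\<Sum>j<n. \<bar>e j\<bar> * (z k j)\<^sup>2))"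
    by (rule sum_mono)
  also have "\<dots> = (\<Sum>j<n. \<bar>e j\<bar>) * (\<Sum>k<d. \<Sum>j<n. \<bar>e j\<bar> * (z k j)\<^sup>2)" by (simp add: sum_distrib_left)
  also have "(\<Sum>k<d. \<Sum>j<n. \<bar>e j\<bar> * (z k j)\<^sup>2) = (\<Sum>j<n. \<bar>e j\<bar> * (\<Sum>k<d. (z k j)\<^sup>2))"
    by (subst sum.swap) (simp add: sum_distrib_left)
  also have "(\<Sum>j<n. \<bar>e j\<bar>) * \<dots> \<le> (\<Sum>j<n. \<bar>e j\<bar>) * (\<Sum>j<n. \<bar>e j\<bar> * R\<^sup>2)"
    using z by (intro mult_left_mono sum_mono sum_nonneg) auto
  also have "\<dots> = (\<Sum>j<n. \<bar>e j\<bar>)\<^sup>2 * R\<^sup>2" by (simp add: power2_eq_square flip: sum_distrib_right)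
  finally show ?thesis .
qed

lemma sum_sq_add_le:
  fixes f g :: "nat \<Rightarrow> real"
  shows "(\<Sum>k<d. (f k + g k)\<^sup>2) \<le> 2 * (\<Sum>k<d. (f k)\<^sup>2) + 2 * (\<Sum>k<d. (g k)\<^sup>2)"
proof -
  have "(f k + g k)\<^sup>2 \<le> 2 * (f k)\<^sup>2 + 2 * (g k)\<^sup>2" for k
    using zero_le_power2[of "f k - g k"] by (simp add: power2_eq_square algebra_simps)
  then have "(\<Sum>k<d. (f k + g k)\<^sup>2) \<le> (\<Sum>k<d. 2 * (f k)\<^sup>2 + 2 * (g k)\<^sup>2)" by (rule sum_mono)
  then show ?thesis by (simp add: sum.distrib sum_distrib_left)
qed

text \<open>
  The row sums of the population density \<open>p\<close> on the sample are not bounded. When the normalised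
  row sum exceeds \<open>2\<close>, the trivial bound \<open>4 R\<^sup>2\<close> is at most \<open>4 R\<^sup>2 (row sum - 1)\<^sup>2\<close>.
\<close>

lemma barycentre_row_bound:
  fixes p q :: "nat \<Rightarrow> real" and z :: "nat \<Rightarrow> nat \<Rightarrow> real" and m :: "nat \<Rightarrow> real"
  assumes n: "1 \<le> n" and pq: "\<And>j. j < n \<Longrightarrow> 0 < p j \<and> 0 < q j" and q1: "(\<Sum>j<n. q j) = n"
    and z: "\<And>j. j < n \<Longrightarrow> (\<Sum>k<d. (z k j)\<^sup>2) \<le> R\<^sup>2" and m: "(\<Sum>k<d. (m k)\<^sup>2) \<le> R\<^sup>2"
  defines "b \<equiv> (\<Sum>j<n. p j) / n" and "D \<equiv> (\<Sum>j<n. (q j - p j) * (ln (q j) - ln (p j))) / n"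
    and "E \<equiv> (\<Sum>k<d. ((\<Sum>j<n. q j * z k j) / n - m k)\<^sup>2)"
  shows "E \<le> 4 * R\<^sup>2"
    and "E \<le> 2 * (\<Sum>k<d. ((\<Sum>j<n. p j * z k j) / n - m k)\<^sup>2) + 6 * R\<^sup>2 * D + 4 * R\<^sup>2 * (b - 1)\<^sup>2"
proof -
  have npos: "0 < real n" using n by simp
  have D0: "0 \<le> D" unfolding D_def
    using pq log_diff_nonneg by (intro divide_nonneg_nonneg sum_nonneg) auto
  have div: "(\<Sum>k<d. ((\<Sum>j<n. e j * z k j) / n)\<^sup>2) \<le> ((\<Sum>j<n. \<bar>e j\<bar>) / n)\<^sup>2 * R\<^sup>2" for e
  proof -
    have "(\<Sum>k<d. ((\<Sum>j<n. e j * z k j) / n)\<^sup>2) = (\<Sum>k<d. (\<Sum>j<n. e j * z k j)\<^sup>2) / n\<^sup>2"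
      by (simp only: power_divide sum_divide_distrib[symmetric] of_nat_power)
    also have "\<dots> \<le> (\<Sum>j<n. \<bar>e j\<bar>)\<^sup>2 * R\<^sup>2 / n\<^sup>2"
      by (intro divide_right_mono weighted_vector_sum_le z) auto
    finally show ?thesis by (simp add: power_divide)
  qed
  have absq: "(\<Sum>j<n. \<bar>q j\<bar>) = n" using pq q1 by (simp add: abs_of_pos)
  have "E \<le> 2 * (\<Sum>k<d. ((\<Sum>j<n. q j * z k j) / n)\<^sup>2) + 2 * (\<Sum>k<d. (- m k)\<^sup>2)"
    unfolding E_def using sum_sq_add_le[where d = d and f = "\<lambda>k. (\<Sum>j<n. q j * z k j) / n" and g = "\<lambda>k. - m k"] by simp
  also have "\<dots> \<le> 2 * R\<^sup>2 + 2 * R\<^sup>2" using div[of q] m npos by (simp add: absq)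
  finally show E4: "E \<le> 4 * R\<^sup>2" by simp
  show "E \<le> 2 * (\<Sum>k<d. ((\<Sum>j<n. p j * z k j) / n - m k)\<^sup>2) + 6 * R\<^sup>2 * D + 4 * R\<^sup>2 * (b - 1)\<^sup>2"
  proof (cases "b \<le> 2")
    case True
    have "E = (\<Sum>k<d. (((\<Sum>j<n. p j * z k j) / n - m k) + (\<Sum>j<n. (q j - p j) * z k j) / n)\<^sup>2)"
      unfolding E_def by (intro sum.cong refl) (simp add: left_diff_distrib sum_subtractf diff_divide_distrib)
    also have "\<dots> \<le> 2 * (\<Sum>k<d. ((\<Sum>j<n. p j * z k j) / n - m k)\<^sup>2) + 2 * (\<Sum>k<d. ((\<Sum>j<n. (q j - p j) * z k j) / n)\<^sup>2)"
      by (rule sum_sq_add_le)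
    also have "(\<Sum>k<d. ((\<Sum>j<n. (q j - p j) * z k j) / n)\<^sup>2) \<le> ((\<Sum>j<n. \<bar>q j - p j\<bar>) / n)\<^sup>2 * R\<^sup>2"
      by (rule div)
    \<comment> \<open>The two rows have total masses \<open>n\<close> and \<open>n * b\<close>,
      whence \<open>1 + b\<close>. With \<open>b \<le> 2\<close> and the factor 2 from splitting the
      square this becomes the constant 6.\<close>
    also have "((\<Sum>j<n. \<bar>q j - p j\<bar>) / n)\<^sup>2 \<le> (1 + b) * D"
    proof -
      have "((\<Sum>j<n. \<bar>q j - p j\<bar>) / n)\<^sup>2 \<le> ((\<Sum>j<n. q j + p j) * (\<Sum>j<n. (q j - p j) * (ln (q j) - ln (p j)))) / n\<^sup>2"
        unfolding power_divide of_nat_power by (intro divide_right_mono sum_abs_diff_sq_le pq) auto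
      also have "\<dots> = (1 + b) * D"
        using npos by (simp add: b_def D_def sum.distrib q1 field_simps power2_eq_square)
      finally show ?thesis .
    qed
    also have "(1 + b) * D \<le> 3 * D" using True D0 by (intro mult_right_mono) auto
    finally have "E \<le> 2 * (\<Sum>k<d. ((\<Sum>j<n. p j * z k j) / n - m k)\<^sup>2) + 6 * R\<^sup>2 * D"
      by (simp add: mult_right_mono mult_ac)
    moreover have "0 \<le> 4 * R\<^sup>2 * (b - 1)\<^sup>2" by simp
    ultimately show ?thesis by linarith
  next
    case False
    then have "1 \<le> (b - 1)\<^sup>2" by (simp add: one_le_power)
    then have "4 * R\<^sup>2 * 1 \<le> 4 * R\<^sup>2 * (b - 1)\<^sup>2" by (intro mult_left_mono) auto
    moreover have "0 \<le> 2 * (\<Sum>k<d. ((\<Sum>j<n. p j * z k j) / n - m k)\<^sup>2)" "0 \<le> 6 * R\<^sup>2 * D"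
      using D0 by (auto intro!: sum_nonneg)
    ultimately show ?thesis using E4 by linarith
  qed
qed

text \<open>
  Since \<open>ln q - ln p\<close> splits as a sum and \<open>q\<close> is doubly stochastic, the symmetrised divergence
  only sees the marginal defects of \<open>p\<close>.
\<close>

lemma symmetrised_divergence_le:
  fixes p q :: "nat \<Rightarrow> nat \<Rightarrow> real" and n :: nat
  assumes n: "1 \<le> n"
    and split: "\<And>i j. i < n \<Longrightarrow> j < n \<Longrightarrow> ln (q i j) - ln (p i j) = \<alpha> i + \<beta> j"
    and \<alpha>: "\<And>i. i < n \<Longrightarrow> \<bar>\<alpha> i\<bar> \<le> a" and \<beta>: "\<And>j. j < n \<Longrightarrow> \<bar>\<beta> j\<bar> \<le> a"
    and row: "\<And>i. i < n \<Longrightarrow> (\<Sum>j<n. q i j) = n" and col: "\<And>j. j < n \<Longrightarrow> (\<Sum>i<n. q i j) = n"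
  shows "(\<Sum>i<n. (\<Sum>j<n. (q i j - p i j) * (ln (q i j) - ln (p i j))) / n)
    \<le> a * ((\<Sum>i<n. \<bar>(\<Sum>j<n. p i j) / n - 1\<bar>) + (\<Sum>j<n. \<bar>(\<Sum>i<n. p i j) / n - 1\<bar>))"
proof -
  have npos: "0 < real n" using n by simp
  have "(\<Sum>i<n. (\<Sum>j<n. (q i j - p i j) * (ln (q i j) - ln (p i j))) / n)
      = (\<Sum>i<n. \<Sum>j<n. (q i j - p i j) * (\<alpha> i + \<beta> j)) / n"
    unfolding sum_divide_distrib[symmetric] using split by (intro arg_cong2[of _ _ _ _ "(/)"] sum.cong refl) auto
  also have "(\<Sum>i<n. \<Sum>j<n. (q i j - p i j) * (\<alpha> i + \<beta> j))
      = (\<Sum>i<n. \<alpha> i * (\<Sum>j<n. q i j - p i j)) + (\<Sum>j<n. \<beta> j * (\<Sum>i<n. q i j - p i j))"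
  proof -
    have "(\<Sum>i<n. \<Sum>j<n. (q i j - p i j) * (\<alpha> i + \<beta> j))
      = (\<Sum>i<n. \<Sum>j<n. \<alpha> i * (q i j - p i j)) + (\<Sum>i<n. \<Sum>j<n. \<beta> j * (q i j - p i j))"
      by (simp add: algebra_simps sum.distrib sum_subtractf)
    also have "(\<Sum>i<n. \<Sum>j<n. \<beta> j * (q i j - p i j)) = (\<Sum>j<n. \<Sum>i<n. \<beta> j * (q i j - p i j))"
      by (rule sum.swap)
    finally show ?thesis by (simp add: sum_distrib_left)
  qed
  also have "\<dots> / n = (\<Sum>i<n. \<alpha> i * (1 - (\<Sum>j<n. p i j) / n)) + (\<Sum>j<n. \<beta> j * (1 - (\<Sum>i<n. p i j) / n))"
  proof -
    have "\<alpha> i * (\<Sum>j<n. q i j - p i j) / n = \<alpha> i * (1 - (\<Sum>j<n. p i j) / n)" if "i < n" for i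
      using npos row[OF that] by (simp add: sum_subtractf diff_divide_distrib flip: times_divide_eq_right)
    moreover have "\<beta> j * (\<Sum>i<n. q i j - p i j) / n = \<beta> j * (1 - (\<Sum>i<n. p i j) / n)" if "j < n" for j
      using npos col[OF that] by (simp add: sum_subtractf diff_divide_distrib flip: times_divide_eq_right)
    ultimately show ?thesis
      unfolding add_divide_distrib by (subst (1 2) sum_divide_distrib) simp
  qed
  also have "\<dots> \<le> (\<Sum>i<n. a * \<bar>(\<Sum>j<n. p i j) / n - 1\<bar>) + (\<Sum>j<n. a * \<bar>(\<Sum>i<n. p i j) / n - 1\<bar>)"
  proof (intro add_mono sum_mono)
    have le: "s * (1 - t) \<le> a * \<bar>t - 1\<bar>" if "\<bar>s\<bar> \<le> a" for s t :: real
    proof -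
      have "s * (1 - t) \<le> \<bar>s\<bar> * \<bar>1 - t\<bar>" unfolding abs_mult[symmetric] by (rule abs_ge_self)
      also have "\<dots> \<le> a * \<bar>1 - t\<bar>" using that by (rule mult_right_mono) simp
      finally show ?thesis by (simp add: abs_minus_commute)
    qed
    fix i assume "i \<in> {..<n}"
    then show "\<alpha> i * (1 - (\<Sum>j<n. p i j) / n) \<le> a * \<bar>(\<Sum>j<n. p i j) / n - 1\<bar>"
      "\<beta> i * (1 - (\<Sum>j<n. p j i) / n) \<le> a * \<bar>(\<Sum>j<n. p j i) / n - 1\<bar>"
      using \<alpha> \<beta> le by auto
  qed
  also have "\<dots> = a * ((\<Sum>i<n. \<bar>(\<Sum>j<n. p i j) / n - 1\<bar>) + (\<Sum>j<n. \<bar>(\<Sum>i<n. p i j) / n - 1\<bar>))"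
    by (simp add: sum_distrib_left distrib_left)
  finally show ?thesis .
qed

section \<open>Empirical measures\<close>

lemma sets_empirical [simp, measurable_cong]: "sets (empirical d n x) = sets (Rd d)"
  by (simp add: empirical_def)

lemma space_empirical [simp]: "space (empirical d n x) = space (Rd d)"
  by (simp add: empirical_def)

context
  fixes d n :: nat and x :: "nat \<Rightarrow> point"
  assumes n: "1 \<le> n" and x: "\<And>i. i < n \<Longrightarrow> x i \<in> space (Rd d)"
begin

lemma sample_measurable: "x \<in> measurable (uniform_count_measure {..<n}) (Rd d)"
  using x by (auto simp: measurable_def space_uniform_count_measure sets_uniform_count_measure)

lemma prob_space_empirical: "prob_space (empirical d n x)"
  unfolding empirical_def
  by (intro prob_space.prob_space_distr prob_space_uniform_count_measure sample_measurable) (use n in \<open>auto simp: lessThan_empty_iff\<close>)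

text \<open>The property may be any set of points: the finite set of sample points is itself
  measurable and carries all the mass.\<close>

lemma AE_empirical: "(AE z in empirical d n x. R z) \<longleftrightarrow> (\<forall>i<n. R (x i))"
proof
  assume "AE z in empirical d n x. R z"
  then have "AE i in uniform_count_measure {..<n}. R (x i)"
    unfolding empirical_def by (rule AE_distrD[OF sample_measurable])
  then show "\<forall>i<n. R (x i)"
    unfolding uniform_count_measure_def AE_point_measure using n by simp
next
  assume *: "\<forall>i<n. R (x i)"
  have fin: "x ` {..<n} \<in> sets (Rd d)"
  proof -
    have "(\<Union>i<n. {x i}) \<in> sets (Rd d)" using x by (intro sets.finite_UN singleton_sets_Rd) auto
    moreover have "(\<Union>i<n. {x i}) = x ` {..<n}" by auto
    ultimately show ?thesis by simp
  qed
  have "AE z in empirical d n x. z \<in> x ` {..<n}"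
  proof -
    have "{z \<in> space (Rd d). z \<in> x ` {..<n}} = x ` {..<n}" using x by auto
    then have "{z \<in> space (Rd d). z \<in> x ` {..<n}} \<in> sets (Rd d)" using fin by simp
    then show ?thesis unfolding empirical_def
      by (subst AE_distr_iff[OF sample_measurable]) (auto simp: space_uniform_count_measure)
  qed
  then show "AE z in empirical d n x. R z" by eventually_elim (use * in auto)
qed

lemma integral_empirical:
  fixes f :: "point \<Rightarrow> real"
  assumes "f \<in> borel_measurable (Rd d)"
  shows "(\<integral>z. f z \<partial>empirical d n x) = (\<Sum>i<n. f (x i)) / n"
  unfolding empirical_def using assms
  by (subst integral_distr[OF sample_measurable]) (auto simp: integral_uniform_count_measure)

text \<open>\<open>f\<close> may be any function, which suits the entropic maps, as they are built
  from a choice of density. It is exchanged for a finite combination of indicators that agrees with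
  it on the sample.\<close>

lemma nn_integral_empirical_le:
  assumes "\<And>i. i < n \<Longrightarrow> f (x i) \<le> ennreal (g i)" "\<And>i. i < n \<Longrightarrow> 0 \<le> g i"
  shows "(\<integral>\<^sup>+z. f z \<partial>empirical d n x) \<le> ennreal ((\<Sum>i<n. g i) / n)"
proof -
  \<comment> \<open>The sum runs over the set of sample points, so a repeated point occurs once
    here; its multiplicity comes from the uniform measure on indices.\<close>
  define h where "h z = (\<Sum>s\<in>x ` {..<n}. f s * indicator {s} z)" for z
  have hx: "h (x i) = f (x i)" if i: "i < n" for i
  proof -
    have "h (x i) = (\<Sum>s\<in>{x i}. f s * indicator {s} (x i))"
      unfolding h_def using i by (intro sum.mono_neutral_right) auto
    then show ?thesis by simp
  qed
  have hm: "h \<in> borel_measurable (Rd d)"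
    unfolding h_def[abs_def]
    by (intro borel_measurable_sum borel_measurable_times_ennreal borel_measurable_const
        borel_measurable_indicator singleton_sets_Rd) (use x in auto)
  have "(\<integral>\<^sup>+z. f z \<partial>empirical d n x) = (\<integral>\<^sup>+z. h z \<partial>empirical d n x)"
    by (intro nn_integral_cong_AE) (simp add: AE_empirical hx)
  also have "\<dots> = (\<integral>\<^sup>+i. h (x i) \<partial>uniform_count_measure {..<n})"
    unfolding empirical_def by (subst nn_integral_distr[OF sample_measurable]) (use hm in auto)
  also have "\<dots> = (\<Sum>i<n. ennreal (1 / n) * h (x i))"
    by (simp add: uniform_count_measure_def nn_integral_point_measure_finite)
  also have "\<dots> \<le> (\<Sum>i<n. ennreal (1 / n) * ennreal (g i))"
    using assms by (intro sum_mono mult_left_mono) (auto simp: hx)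
  also have "\<dots> = (\<Sum>i<n. ennreal (g i / n))"
    using assms by (intro sum.cong refl) (simp flip: ennreal_mult')
  also have "\<dots> = ennreal ((\<Sum>i<n. g i) / n)"
    using assms by (subst sum_ennreal) (auto simp: sum_divide_distrib)
  finally show ?thesis .
qed

end

lemma AE_empirical_pair:
  assumes n: "1 \<le> n" and x: "\<And>i. i < n \<Longrightarrow> x i \<in> space (Rd d)" and y: "\<And>j. j < n \<Longrightarrow> y j \<in> space (Rd d)"
    and m: "{z \<in> space (Rd d \<Otimes>\<^sub>M Rd d). R z} \<in> sets (Rd d \<Otimes>\<^sub>M Rd d)"
    and R: "\<And>i j. i < n \<Longrightarrow> j < n \<Longrightarrow> R (x i, y j)"
  shows "AE z in empirical d n x \<Otimes>\<^sub>M empirical d n y. R z"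
proof -
  interpret X: prob_space "empirical d n x" by (rule prob_space_empirical[OF n x])
  interpret Y: prob_space "empirical d n y" by (rule prob_space_empirical[OF n y])
  interpret XY: pair_prob_space "empirical d n x" "empirical d n y" ..
  have s: "sets (empirical d n x \<Otimes>\<^sub>M empirical d n y) = sets (Rd d \<Otimes>\<^sub>M Rd d)"
    by (intro sets_pair_measure_cong) auto
  show ?thesis
  proof (rule XY.AE_pair_measure)
    show "{z \<in> space (empirical d n x \<Otimes>\<^sub>M empirical d n y). R z} \<in> sets (empirical d n x \<Otimes>\<^sub>M empirical d n y)"
      unfolding s sets_eq_imp_space_eq[OF s] by (rule m)
    show "AE xa in empirical d n x. AE ya in empirical d n y. R (xa, ya)"
      using R by (simp add: AE_empirical[OF n x] AE_empirical[OF n y])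
  qed
qed

section \<open>Almost sure properties of the two samples\<close>

lemma AE_pair_snd:
  assumes "sigma_finite_measure Q" "AE y in Q. R y"
  shows "AE z in P \<Otimes>\<^sub>M Q. R (snd z)"
proof -
  interpret sigma_finite_measure Q by fact
  obtain N where N: "N \<in> null_sets Q" "{y \<in> space Q. \<not> R y} \<subseteq> N"
    using assms(2) by (auto simp: eventually_ae_filter)
  have "space P \<times> N \<in> null_sets (P \<Otimes>\<^sub>M Q)"
    using null_setsD1[OF N(1)] null_setsD2[OF N(1)] by (intro null_setsI) (auto simp: emeasure_pair_measure_Times)
  then show ?thesis by (rule AE_I') (use N(2) in \<open>auto simp: space_pair_measure\<close>)
qed

lemma AE_pair_fst:
  assumes "prob_space Q" "AE x in P. R x"
  shows "AE z in P \<Otimes>\<^sub>M Q. R (fst z)"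
proof -
  have "AE x in distr (P \<Otimes>\<^sub>M Q) P fst. R x"
    unfolding prob_space.distr_pair_fst[OF assms(1)] by (rule assms(2))
  then show ?thesis by (rule AE_distrD[OF measurable_fst])
qed

lemma AE_sample_fst:
  assumes "prob_space P" "prob_space Q" "AE x in P. R x"
  shows "AE s in (\<Pi>\<^sub>M i\<in>{..<n}. P) \<Otimes>\<^sub>M (\<Pi>\<^sub>M j\<in>{..<n}. Q). \<forall>i\<in>{..<n::nat}. R (fst s i)"
  by (intro eventually_ball_finite ballI AE_pair_fst prob_space_PiM_const
      AE_PiM_component[where M = "\<lambda>_. P"]) (use assms in auto)

lemma AE_sample_snd:
  assumes "prob_space P" "prob_space Q" "AE y in Q. R y"
  shows "AE s in (\<Pi>\<^sub>M i\<in>{..<n}. P) \<Otimes>\<^sub>M (\<Pi>\<^sub>M j\<in>{..<n}. Q). \<forall>j\<in>{..<n::nat}. R (snd s j)"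
  by (intro eventually_ball_finite ballI AE_pair_snd prob_space_imp_sigma_finite prob_space_PiM_const
      AE_PiM_component[where M = "\<lambda>_. Q"]) (use assms in auto)

text \<open>By independence each pair of one point from either sample avoids a given null set of the
  product almost surely. This makes the cost bound, valid only almost everywhere, available at all
  sample pairs.\<close>

lemma AE_sample_pair:
  assumes P: "prob_space P" and Q: "prob_space Q"
    and m: "{z \<in> space (P \<Otimes>\<^sub>M Q). R z} \<in> sets (P \<Otimes>\<^sub>M Q)" and R: "AE z in P \<Otimes>\<^sub>M Q. R z"
  shows "AE s in (\<Pi>\<^sub>M i\<in>{..<n}. P) \<Otimes>\<^sub>M (\<Pi>\<^sub>M j\<in>{..<n}. Q). \<forall>i\<in>{..<n::nat}. \<forall>j\<in>{..<n}. R (fst s i, snd s j)"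
proof (intro eventually_ball_finite ballI)
  fix i j assume ij: "i \<in> {..<n}" "j \<in> {..<n}"
  interpret P: prob_space P by fact
  interpret Q: prob_space Q by fact
  interpret PQ: pair_prob_space P Q ..
  let ?A = "\<Pi>\<^sub>M i\<in>{..<n}. P" and ?B = "\<Pi>\<^sub>M j\<in>{..<n}. Q"
  interpret A: prob_space ?A by (rule prob_space_PiM_const[OF P])
  interpret B: prob_space ?B by (rule prob_space_PiM_const[OF Q])
  interpret AB: pair_prob_space ?A ?B ..
  have meas: "(\<lambda>s. (fst s i, snd s j)) \<in> measurable (?A \<Otimes>\<^sub>M ?B) (P \<Otimes>\<^sub>M Q)"
    using ij by (intro measurable_Pair measurable_compose[OF measurable_fst measurable_component_singleton]
        measurable_compose[OF measurable_snd measurable_component_singleton]) auto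
  show "AE s in ?A \<Otimes>\<^sub>M ?B. R (fst s i, snd s j)"
  proof (rule AB.AE_pair_measure)
    have "{s \<in> space (?A \<Otimes>\<^sub>M ?B). R (fst s i, snd s j)} =
        (\<lambda>s. (fst s i, snd s j)) -` {z \<in> space (P \<Otimes>\<^sub>M Q). R z} \<inter> space (?A \<Otimes>\<^sub>M ?B)"
      using measurable_space[OF meas] by blast
    then show "{s \<in> space (?A \<Otimes>\<^sub>M ?B). R (fst s i, snd s j)} \<in> sets (?A \<Otimes>\<^sub>M ?B)"
      using measurable_sets[OF meas m] by simp
    have "AE X in ?A. AE y in Q. R (X i, y)"
      by (rule AE_PiM_component[where M = "\<lambda>_. P" and P = "\<lambda>x. AE y in Q. R (x, y)"])
        (use P ij PQ.AE_pair[OF R] in auto)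
    then show "AE X in ?A. AE Y in ?B. R (fst (X, Y) i, snd (X, Y) j)"
    proof eventually_elim
      fix X assume "AE y in Q. R (X i, y)"
      then have "AE Y in ?B. R (X i, Y j)"
        by (intro AE_PiM_component[where M = "\<lambda>_. Q" and P = "\<lambda>y. R (X i, y)"]) (use Q ij in auto)
      then show "AE Y in ?B. R (fst (X, Y) i, snd (X, Y) j)" by simp
    qed
  qed
qed auto

text \<open>For an empirical \<open>P\<close> the conclusion holds at every sample point, by
  \<open>AE_empirical\<close>.\<close>

lemma entropic_map_AE:
  fixes P Q :: "point measure"
  assumes sys: "schrodinger_system P Q k u v \<gamma>" and Q: "sets Q = sets (Rd d)"
    and \<epsilon>: "0 < \<epsilon>" and c: "(\<lambda>(x, y). c x y) \<in> borel_measurable (P \<Otimes>\<^sub>M Q)"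
    and kc: "AE z in P \<Otimes>\<^sub>M Q. k (fst z) (snd z) = exp (- c (fst z) (snd z) / \<epsilon>)"
  shows "AE x in P. \<forall>i<d. entropic_map d c \<epsilon> P Q x i = (\<integral>y. y i * schrodinger_system.p k u v x y \<partial>Q)"
proof -
  interpret schrodinger_system P Q k u v \<gamma> by fact
  show ?thesis
    using eot_density_AE[OF \<epsilon> c kc] AE_space
  proof eventually_elim
    fix x assume x: "AE y in Q. eot_density c \<epsilon> P Q x y = p x y" "x \<in> space P"
    note [measurable] = p_section[OF x(2)] eot_density_measurable[OF x(2), where Q = Q and c = c and \<epsilon> = \<epsilon>]
    show "\<forall>i<d. entropic_map d c \<epsilon> P Q x i = (\<integral>y. y i * p x y \<partial>Q)"
    proof (intro allI impI)
      fix i assume i: "i < d"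
      have [measurable]: "(\<lambda>y. y i) \<in> borel_measurable Q"
        using coordinate_measurable[OF i] by (simp add: measurable_cong_sets[OF Q refl])
      have "(\<integral>y. y i * eot_density c \<epsilon> P Q x y \<partial>Q) = (\<integral>y. y i * p x y \<partial>Q)"
        by (rule integral_cong_AE) (use x(1) in \<open>measurable, auto elim!: eventually_mono\<close>)
      then show "entropic_map d c \<epsilon> P Q x i = (\<integral>y. y i * p x y \<partial>Q)"
        using i by (simp add: entropic_map_def)
    qed
  qed
qed

context schrodinger_system
begin

text \<open>The real counterpart of \<open>p_norm_sq\<close>. The nonnegative iterated integral
  suits the covering argument, the Bochner integral over the product suits the variance estimates;
  \<open>p_norm_sq_eq\<close> joins them.\<close>

definition p_sq :: real where
  "p_sq = (\<integral>z. (p (fst z) (snd z))\<^sup>2 \<partial>(P \<Otimes>\<^sub>M Q))"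

lemma p_abs_le: "x \<in> space P \<Longrightarrow> y \<in> space Q \<Longrightarrow> \<bar>p x y\<bar> \<le> exp (5 * \<gamma>)"
  using p_pos[of x y] p_le[of x y] by simp

lemma integrable_p_sq: "integrable (P \<Otimes>\<^sub>M Q) (\<lambda>z. (p (fst z) (snd z))\<^sup>2)"
  by (rule PQ.P.integral_bounded_sq(2)[of _ "exp (5 * \<gamma>)"]) (auto simp: space_pair_measure intro: p_abs_le)

lemma p_sq_nonneg: "0 \<le> p_sq"
  by (simp add: p_sq_def)

lemma p_norm_sq_eq: "p_norm_sq = ennreal p_sq"
proof -
  have "p_norm_sq = (\<integral>\<^sup>+z. ennreal ((p (fst z) (snd z))\<^sup>2) \<partial>(P \<Otimes>\<^sub>M Q))"
    unfolding p_norm_sq_def by (subst Q.nn_integral_fst[symmetric]) auto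
  also have "\<dots> = ennreal p_sq"
    unfolding p_sq_def by (rule nn_integral_eq_integral[OF integrable_p_sq]) simp
  finally show ?thesis .
qed

lemma p_norm_sq_swap: "schrodinger_system.p_norm_sq Q P (\<lambda>y x. k x y) v u = p_norm_sq"
proof -
  interpret T: schrodinger_system Q P "\<lambda>y x. k x y" v u \<gamma> by (rule swap)
  have Tp: "T.p y x = p x y" for x y by (simp add: p_def T.p_def mult_ac)
  show ?thesis
    unfolding p_norm_sq_def T.p_norm_sq_def Tp
    using PQ.Fubini[OF p_sq_measurable] by simp
qed

lemma integral_p_right: "y \<in> space Q \<Longrightarrow> (\<integral>x. p x y \<partial>P) = 1"
proof -
  assume y: "y \<in> space Q"
  interpret T: schrodinger_system Q P "\<lambda>y x. k x y" v u \<gamma> by (rule swap)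
  have Tp: "T.p y x = p x y" for x y by (simp add: p_def T.p_def mult_ac)
  show ?thesis using T.integral_p[OF y] by (simp add: Tp)
qed

end

section \<open>The expected error of the entropic map\<close>

text \<open>Shifting by the base point \<open>y0\<close> of the support turns the diameter bound
  into a norm bound. The second moments are then governed by \<open>R\<close> and not by the
  distance of the support from the origin.\<close>

locale entropic_sampling = schrodinger_system \<mu> \<nu> "gibbs_kernel c \<epsilon>" u v "1 / \<epsilon>"
  for \<mu> \<nu> :: "point measure" and c :: "point \<Rightarrow> point \<Rightarrow> real" and \<epsilon> :: real and u v :: "point \<Rightarrow> real" +
  fixes d n :: nat and R :: real and y0 :: point
  assumes \<mu>: "borel_prob d \<mu>" and \<nu>: "borel_prob d \<nu>"
    and c_measurable: "(\<lambda>(x, y). c x y) \<in> borel_measurable (Rd d \<Otimes>\<^sub>M Rd d)"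
    and c_bound: "AE z in \<mu> \<Otimes>\<^sub>M \<nu>. \<bar>c (fst z) (snd z)\<bar> \<le> 1"
    and \<epsilon>_pos: "0 < \<epsilon>" and n_pos: "1 \<le> n" and R_pos: "0 < R"
    and y0: "y0 \<in> supp d \<nu>"
    and diam: "\<And>y y'. y \<in> supp d \<nu> \<Longrightarrow> y' \<in> supp d \<nu> \<Longrightarrow> edist d y y' \<le> R"
begin

lemma sets_\<mu>: "sets \<mu> = sets (Rd d)" and sets_\<nu>: "sets \<nu> = sets (Rd d)"
  using \<mu> \<nu> by (auto simp: borel_prob_def)

lemma space_\<mu>: "space \<mu> = space (Rd d)" and space_\<nu>: "space \<nu> = space (Rd d)"
  using sets_\<mu> sets_\<nu> by (auto dest: sets_eq_imp_space_eq)

lemma AE_supp_\<nu>: "AE y in \<nu>. y \<in> supp d \<nu>"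
  by (rule AE_in_supp[OF \<nu>])

text \<open>On the support of \<open>\<nu>\<close> the truncation is inactive; it only makes \<open>zc\<close> bounded everywhere.\<close>

definition zc :: "nat \<Rightarrow> point \<Rightarrow> real" where
  "zc i y = max (- R) (min R (y i - y0 i))"

lemma zc_measurable: "i < d \<Longrightarrow> zc i \<in> borel_measurable \<nu>"
proof -
  assume "i < d"
  then have [measurable]: "(\<lambda>y. y i) \<in> borel_measurable \<nu>"
    using coordinate_measurable by (simp add: measurable_cong_sets[OF sets_\<nu> refl])
  show ?thesis unfolding zc_def[abs_def] by measurable
qed

lemma zc_abs_le: "\<bar>zc i y\<bar> \<le> R"
  using R_pos by (auto simp: zc_def max_def min_def)

lemma zc_supp:
  assumes "y \<in> supp d \<nu>" "i < d"
  shows "zc i y = y i - y0 i"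
  using coordinate_le_edist[OF assms(2), of y y0] diam[OF assms(1) y0] by (auto simp: zc_def max_def min_def)

lemma zc_sq_sum:
  assumes "y \<in> supp d \<nu>"
  shows "(\<Sum>i<d. (zc i y)\<^sup>2) \<le> R\<^sup>2"
proof -
  have "(\<Sum>i<d. (zc i y)\<^sup>2) = (edist d y y0)\<^sup>2"
    unfolding edist_sq using zc_supp[OF assms] by (intro sum.cong) auto
  also have "\<dots> \<le> R\<^sup>2" using diam[OF assms y0] by (intro power_mono edist_nonneg) auto
  finally show ?thesis .
qed

text \<open>The population map relative to the base point \<open>y0\<close>, in the version given by
  \<open>p\<close>.\<close>

definition mean :: "nat \<Rightarrow> point \<Rightarrow> real" where
  "mean i x = (\<integral>y. p x y * zc i y \<partial>\<nu>)"

lemma pz_abs_le: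
  assumes "x \<in> space \<mu>" "y \<in> space \<nu>"
  shows "\<bar>p x y * zc i y\<bar> \<le> exp (5 * (1 / \<epsilon>)) * R"
  unfolding abs_mult using p_abs_le[OF assms] zc_abs_le[of i y] by (intro mult_mono) auto

lemma pz_measurable: "i < d \<Longrightarrow> (\<lambda>(x, y). p x y * zc i y) \<in> borel_measurable (\<mu> \<Otimes>\<^sub>M \<nu>)"
proof -
  assume i: "i < d"
  have "(\<lambda>z. p (fst z) (snd z) * zc i (snd z)) \<in> borel_measurable (\<mu> \<Otimes>\<^sub>M \<nu>)"
    by (intro borel_measurable_times p_measurable measurable_compose[OF measurable_snd zc_measurable[OF i]])
  then show ?thesis by (simp add: split_beta')
qed

lemma pz_integrable:
  assumes "x \<in> space \<mu>" "i < d"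
  shows "integrable \<nu> (\<lambda>y. p x y * zc i y)" "integrable \<nu> (\<lambda>y. p x y * (zc i y)\<^sup>2)"
proof -
  note [measurable] = p_section[OF assms(1)] zc_measurable[OF assms(2)]
  show "integrable \<nu> (\<lambda>y. p x y * zc i y)"
    by (rule Q.integrable_bounded[OF _ pz_abs_le[OF assms(1)]]) measurable
  show "integrable \<nu> (\<lambda>y. p x y * (zc i y)\<^sup>2)"
  proof (rule Q.integrable_bounded)
    show "\<bar>p x y * (zc i y)\<^sup>2\<bar> \<le> exp (5 * (1 / \<epsilon>)) * R\<^sup>2" if "y \<in> space \<nu>" for y
      unfolding abs_mult using p_abs_le[OF assms(1) that] power_mono[OF zc_abs_le[of i y], of 2]
      by (intro mult_mono) auto
  qed measurable
qed

text \<open>Jensen's inequality for the probability density \<open>p x\<close>, obtained in each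
  coordinate from a nonnegative variance; the norm bound enters after summation over the
  coordinates.\<close>

lemma mean_sq_sum:
  assumes x: "x \<in> space \<mu>"
  shows "(\<Sum>i<d. (mean i x)\<^sup>2) \<le> R\<^sup>2"
proof -
  have "(mean i x)\<^sup>2 \<le> (\<integral>y. p x y * (zc i y)\<^sup>2 \<partial>\<nu>)" if i: "i < d" for i
  proof -
    let ?m = "mean i x"
    note int = pz_integrable[OF x i] integrable_p[OF x]
    have "0 \<le> (\<integral>y. p x y * (zc i y - ?m)\<^sup>2 \<partial>\<nu>)"
      using p_pos[OF x] by (intro integral_nonneg_AE AE_I2) (auto simp: less_imp_le)
    also have "(\<lambda>y. p x y * (zc i y - ?m)\<^sup>2)
        = (\<lambda>y. p x y * (zc i y)\<^sup>2 - 2 * ?m * (p x y * zc i y) + ?m\<^sup>2 * p x y)"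
      by (simp add: fun_eq_iff power2_eq_square algebra_simps)
    also have "(\<integral>y. p x y * (zc i y)\<^sup>2 - 2 * ?m * (p x y * zc i y) + ?m\<^sup>2 * p x y \<partial>\<nu>)
        = (\<integral>y. p x y * (zc i y)\<^sup>2 \<partial>\<nu>) - 2 * ?m * ?m + ?m\<^sup>2 * 1"
      using int by (simp add: mean_def integral_p[OF x])
    finally show ?thesis by (simp add: power2_eq_square)
  qed
  then have "(\<Sum>i<d. (mean i x)\<^sup>2) \<le> (\<Sum>i<d. \<integral>y. p x y * (zc i y)\<^sup>2 \<partial>\<nu>)" by (intro sum_mono) auto
  also have "\<dots> = (\<integral>y. (\<Sum>i<d. p x y * (zc i y)\<^sup>2) \<partial>\<nu>)"
    using pz_integrable(2)[OF x] by (intro Bochner_Integration.integral_sum[symmetric]) auto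
  also have "\<dots> \<le> (\<integral>y. R\<^sup>2 * p x y \<partial>\<nu>)"
  proof (rule integral_mono_AE)
    show "integrable \<nu> (\<lambda>y. \<Sum>i<d. p x y * (zc i y)\<^sup>2)"
      using pz_integrable(2)[OF x] by (intro Bochner_Integration.integrable_sum) auto
    show "integrable \<nu> (\<lambda>y. R\<^sup>2 * p x y)" using integrable_p[OF x] by simp
    show "AE y in \<nu>. (\<Sum>i<d. p x y * (zc i y)\<^sup>2) \<le> R\<^sup>2 * p x y"
      using AE_supp_\<nu> AE_space
    proof eventually_elim
      fix y assume y: "y \<in> supp d \<nu>" "y \<in> space \<nu>"
      have "p x y * (\<Sum>i<d. (zc i y)\<^sup>2) \<le> p x y * R\<^sup>2"
        using zc_sq_sum[OF y(1)] p_pos[OF x y(2)] by (intro mult_left_mono) auto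
      then show "(\<Sum>i<d. p x y * (zc i y)\<^sup>2) \<le> R\<^sup>2 * p x y" by (simp add: sum_distrib_left mult.commute)
    qed
  qed
  also have "\<dots> = R\<^sup>2" by (simp add: integral_p[OF x])
  finally show ?thesis .
qed

lemma c_measurable_cong:
  assumes "sets P = sets (Rd d)" "sets Q = sets (Rd d)"
  shows "(\<lambda>(x, y). c x y) \<in> borel_measurable (P \<Otimes>\<^sub>M Q)"
  using c_measurable measurable_cong_sets[OF sets_pair_measure_cong[OF assms] refl] by blast

lemma population_map_AE:
  "AE x in \<mu>. \<forall>i<d. entropic_map d c \<epsilon> \<mu> \<nu> x i = y0 i + mean i x"
proof -
  have "AE x in \<mu>. \<forall>i<d. entropic_map d c \<epsilon> \<mu> \<nu> x i = (\<integral>y. y i * p x y \<partial>\<nu>)"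
    by (rule entropic_map_AE[OF schrodinger_system_axioms sets_\<nu> \<epsilon>_pos
          c_measurable_cong[OF sets_\<mu> sets_\<nu>] gibbs_kernel_AE_eq[OF c_bound]])
  then show ?thesis using AE_space
  proof eventually_elim
    fix x assume x: "\<forall>i<d. entropic_map d c \<epsilon> \<mu> \<nu> x i = (\<integral>y. y i * p x y \<partial>\<nu>)" "x \<in> space \<mu>"
    show "\<forall>i<d. entropic_map d c \<epsilon> \<mu> \<nu> x i = y0 i + mean i x"
    proof (intro allI impI)
      fix i assume i: "i < d"
      have [measurable]: "(\<lambda>y. y i) \<in> borel_measurable \<nu>"
        using coordinate_measurable[OF i] by (simp add: measurable_cong_sets[OF sets_\<nu> refl])
      note [measurable] = p_section[OF x(2)] zc_measurable[OF i]
      have "(\<integral>y. y i * p x y \<partial>\<nu>) = (\<integral>y. y0 i * p x y + p x y * zc i y \<partial>\<nu>)"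
      proof (rule integral_cong_AE)
        show "AE y in \<nu>. y i * p x y = y0 i * p x y + p x y * zc i y"
          using AE_supp_\<nu> by eventually_elim (simp add: zc_supp[OF _ i] algebra_simps)
      qed measurable
      also have "\<dots> = y0 i + mean i x"
        using integrable_p[OF x(2)] pz_integrable(1)[OF x(2) i] by (simp add: mean_def integral_p[OF x(2)])
      finally show "entropic_map d c \<epsilon> \<mu> \<nu> x i = y0 i + mean i x" using x(1) i by simp
    qed
  qed
qed

type_synonym sample = "(nat \<Rightarrow> point) \<times> (nat \<Rightarrow> point)"

text \<open>This gathers everything that can fail on a null set: the version of the population map,
  membership of the second sample in the support, and the cost bound at all pairs. On a good sample
  the comparison is deterministic.\<close>

definition good :: "sample \<Rightarrow> bool" where
  "good s \<longleftrightarrow>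
     (\<forall>i\<in>{..<n}. fst s i \<in> space (Rd d) \<and> (\<forall>k<d. entropic_map d c \<epsilon> \<mu> \<nu> (fst s i) k = y0 k + mean k (fst s i))) \<and>
     (\<forall>j\<in>{..<n}. snd s j \<in> supp d \<nu>) \<and>
     (\<forall>i\<in>{..<n}. \<forall>j\<in>{..<n}. \<bar>c (fst s i) (snd s j)\<bar> \<le> 1)"

lemma AE_good: "AE s in sample_law n \<mu> \<nu>. good s"
proof -
  have ps: "prob_space \<mu>" "prob_space \<nu>" by unfold_locales
  have "AE x in \<mu>. x \<in> space (Rd d) \<and> (\<forall>k<d. entropic_map d c \<epsilon> \<mu> \<nu> x k = y0 k + mean k x)"
    using population_map_AE AE_space by eventually_elim (simp add: space_\<mu>)
  from AE_sample_fst[OF ps this]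
  have 1: "AE s in sample_law n \<mu> \<nu>. \<forall>i\<in>{..<n}. fst s i \<in> space (Rd d) \<and>
      (\<forall>k<d. entropic_map d c \<epsilon> \<mu> \<nu> (fst s i) k = y0 k + mean k (fst s i))"
    unfolding sample_law_def .
  have 2: "AE s in sample_law n \<mu> \<nu>. \<forall>j\<in>{..<n}. snd s j \<in> supp d \<nu>"
    unfolding sample_law_def by (rule AE_sample_snd[OF ps AE_supp_\<nu>])
  have cm: "(\<lambda>z. c (fst z) (snd z)) \<in> borel_measurable (\<mu> \<Otimes>\<^sub>M \<nu>)"
    using c_measurable_cong[OF sets_\<mu> sets_\<nu>] by (simp add: split_beta')
  have "{z \<in> space (\<mu> \<Otimes>\<^sub>M \<nu>). \<bar>c (fst z) (snd z)\<bar> \<le> 1} \<in> sets (\<mu> \<Otimes>\<^sub>M \<nu>)"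
    using cm by measurable
  from AE_sample_pair[OF ps this c_bound]
  have 3: "AE s in sample_law n \<mu> \<nu>. \<forall>i\<in>{..<n}. \<forall>j\<in>{..<n}. \<bar>c (fst s i) (snd s j)\<bar> \<le> 1"
    unfolding sample_law_def by simp
  show ?thesis using 1 2 3 unfolding good_def by eventually_elim blast
qed

definition map_error :: "nat \<Rightarrow> nat \<Rightarrow> sample \<Rightarrow> real" where
  "map_error k i s = (\<Sum>j<n. p (fst s i) (snd s j) * zc k (snd s j)) / n - mean k (fst s i)"

text \<open>The subtracted integral equals one; it is kept to match the form of
  \<open>sample_row_error\<close>.\<close>

definition row_error :: "nat \<Rightarrow> sample \<Rightarrow> real" where
  "row_error i s = (\<Sum>j<n. p (fst s i) (snd s j)) / n - (\<integral>y. p (fst s i) y \<partial>\<nu>)"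

definition column_error :: "nat \<Rightarrow> sample \<Rightarrow> real" where
  "column_error j s = (\<Sum>i<n. p (fst s i) (snd s j)) / n - (\<integral>x. p x (snd s j) \<partial>\<mu>)"

text \<open>The constant 24 is 6 from \<open>barycentre_row_bound\<close> times 4, where
  \<open>4 / \<epsilon>\<close> bounds the differences of the log-potentials.\<close>

definition error_bound :: "sample \<Rightarrow> real" where
  "error_bound s =
     (\<Sum>i<n. 2 * (\<Sum>k<d. (map_error k i s)\<^sup>2) + 4 * R\<^sup>2 * (row_error i s)\<^sup>2) / n
     + 24 * R\<^sup>2 / \<epsilon> * ((\<Sum>i<n. \<bar>row_error i s\<bar>) / n + (\<Sum>j<n. \<bar>column_error j s\<bar>) / n)"

text \<open>The first bound serves when the covering number is large compared with \<open>n\<close>.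
  The second averages the row bounds over the sample: only the mean of the divergences
  \<open>D i\<close> is controlled, not each single one.\<close>

lemma L2_error_le:
  assumes "good s"
  defines "E \<equiv> L2_norm_sq d (empirical d n (fst s))
                (\<lambda>x k. entropic_map d c \<epsilon> (empirical d n (fst s)) (empirical d n (snd s)) x k
                        - entropic_map d c \<epsilon> \<mu> \<nu> x k)"
  shows "E \<le> ennreal (4 * R\<^sup>2)" and "E \<le> ennreal (error_bound s)"
proof -
  define x y where "x = fst s" and "y = snd s"
  have x: "\<And>i. i < n \<Longrightarrow> x i \<in> space (Rd d)"
    and T: "\<And>i k. i < n \<Longrightarrow> k < d \<Longrightarrow> entropic_map d c \<epsilon> \<mu> \<nu> (x i) k = y0 k + mean k (x i)"
    and ys: "\<And>j. j < n \<Longrightarrow> y j \<in> supp d \<nu>"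
    and cb: "\<And>i j. i < n \<Longrightarrow> j < n \<Longrightarrow> \<bar>c (x i) (y j)\<bar> \<le> 1"
    using assms(1) by (auto simp: good_def x_def y_def)
  have y: "y j \<in> space (Rd d)" if "j < n" for j using ys[OF that] by (simp add: supp_def)
  let ?P = "empirical d n x" and ?Q = "empirical d n y"
  have ps: "prob_space ?P" "prob_space ?Q"
    using prob_space_empirical[OF n_pos x] prob_space_empirical[OF n_pos y] by auto
  have cm: "(\<lambda>(x, y). c x y) \<in> borel_measurable (?P \<Otimes>\<^sub>M ?Q)" by (rule c_measurable_cong) auto
  obtain u' v' where "schrodinger_system ?P ?Q (gibbs_kernel c \<epsilon>) u' v' (1 / \<epsilon>)"
    using gibbs_system_exists[OF ps \<epsilon>_pos cm] by blast
  then interpret E: schrodinger_system ?P ?Q "gibbs_kernel c \<epsilon>" u' v' "1 / \<epsilon>" .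
  define q where "q i j = E.p (x i) (y j)" for i j
  define r where "r i j = p (x i) (y j)" for i j
  have n: "0 < real n" using n_pos by simp
  have "AE z in ?P \<Otimes>\<^sub>M ?Q. \<bar>c (fst z) (snd z)\<bar> \<le> 1"
  proof (rule AE_empirical_pair[OF n_pos x y])
    have "(\<lambda>z. c (fst z) (snd z)) \<in> borel_measurable (Rd d \<Otimes>\<^sub>M Rd d)"
      using c_measurable by (simp add: split_beta')
    then show "{z \<in> space (Rd d \<Otimes>\<^sub>M Rd d). \<bar>c (fst z) (snd z)\<bar> \<le> 1} \<in> sets (Rd d \<Otimes>\<^sub>M Rd d)" by measurable
  qed (use cb in auto)
  from gibbs_kernel_AE_eq[OF this]
  have kc: "AE z in ?P \<Otimes>\<^sub>M ?Q. gibbs_kernel c \<epsilon> (fst z) (snd z) = exp (- c (fst z) (snd z) / \<epsilon>)" .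
  have "AE z in ?P. \<forall>k<d. entropic_map d c \<epsilon> ?P ?Q z k = (\<integral>w. w k * E.p z w \<partial>?Q)"
    by (rule entropic_map_AE[OF E.schrodinger_system_axioms sets_empirical \<epsilon>_pos cm kc])
  then have That: "entropic_map d c \<epsilon> ?P ?Q (x i) k = (\<integral>w. w k * E.p (x i) w \<partial>?Q)" if "i < n" "k < d" for i k
    using that by (simp add: AE_empirical[OF n_pos x])
  have xE: "i < n \<Longrightarrow> x i \<in> space ?P" "i < n \<Longrightarrow> x i \<in> space \<mu>" for i using x by (simp_all add: space_\<mu>)
  have yE: "i < n \<Longrightarrow> y i \<in> space ?Q" "i < n \<Longrightarrow> y i \<in> space \<nu>" for i using y by (simp_all add: space_\<nu>)
  have row: "(\<Sum>j<n. q i j) = n" if i: "i < n" for i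
  proof -
    have "E.p (x i) \<in> borel_measurable (Rd d)"
      using E.p_section[OF xE(1)[OF i]] by (simp add: measurable_cong_sets[OF sets_empirical refl])
    from integral_empirical[OF n_pos y this] show ?thesis
      using E.integral_p[OF xE(1)[OF i]] n by (simp add: q_def)
  qed
  have col: "(\<Sum>i<n. q i j) = n" if j: "j < n" for j
  proof -
    have "(\<lambda>z. E.p z (y j)) \<in> borel_measurable ?P"
      using measurable_compose[OF measurable_Pair2'[OF yE(1)[OF j]] E.p_measurable(2)] by simp
    then have "(\<lambda>z. E.p z (y j)) \<in> borel_measurable (Rd d)"
      by (simp add: measurable_cong_sets[OF sets_empirical refl])
    from integral_empirical[OF n_pos x this] show ?thesis
      using E.integral_p_right[OF yE(1)[OF j]] n by (simp add: q_def)
  qed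
  \<comment> \<open>The base point drops out because the rows of \<open>q\<close> average to exactly
    one and \<open>p\<close> has integral one in its second argument.\<close>
  have diff: "entropic_map d c \<epsilon> ?P ?Q (x i) k - entropic_map d c \<epsilon> \<mu> \<nu> (x i) k
      = (\<Sum>j<n. q i j * zc k (y j)) / n - mean k (x i)" if i: "i < n" and k: "k < d" for i k
  proof -
    have "(\<lambda>w. w k * E.p (x i) w) \<in> borel_measurable ?Q"
      using coordinate_measurable[OF k]
      by (intro borel_measurable_times E.p_section[OF xE(1)[OF i]]) (simp add: measurable_cong_sets[OF sets_empirical refl])
    then have "(\<lambda>w. w k * E.p (x i) w) \<in> borel_measurable (Rd d)"
      by (simp add: measurable_cong_sets[OF sets_empirical refl])
    from integral_empirical[OF n_pos y this]
    have "entropic_map d c \<epsilon> ?P ?Q (x i) k = (\<Sum>j<n. y j k * q i j) / n"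
      by (simp add: That[OF i k] q_def)
    also have "(\<Sum>j<n. y j k * q i j) = (\<Sum>j<n. q i j * zc k (y j) + y0 k * q i j)"
      by (intro sum.cong refl) (simp add: zc_supp[OF ys k] algebra_simps)
    also have "\<dots> = (\<Sum>j<n. q i j * zc k (y j)) + y0 k * n"
      by (simp add: sum.distrib row[OF i] flip: sum_distrib_left)
    also have "\<dots> / n = (\<Sum>j<n. q i j * zc k (y j)) / n + y0 k" using n by (simp add: add_divide_distrib)
    finally show ?thesis by (simp add: T[OF i k])
  qed
  define D where "D i = (\<Sum>j<n. (q i j - r i j) * (ln (q i j) - ln (r i j))) / n" for i
  have pos: "0 < r i j \<and> 0 < q i j" if "i < n" "j < n" for i j
    using p_pos[OF xE(2) yE(2)] E.p_pos[OF xE(1) yE(1)] that by (simp add: r_def q_def)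
  have re: "(\<Sum>j<n. r i j) / n - 1 = row_error i s" if "i < n" for i
    by (simp add: row_error_def r_def x_def y_def integral_p[OF xE(2)[OF that], unfolded x_def])
  have ce: "(\<Sum>i<n. r i j) / n - 1 = column_error j s" if "j < n" for j
    by (simp add: column_error_def r_def x_def y_def integral_p_right[OF yE(2)[OF that], unfolded y_def])
  define F where "F i = (\<Sum>k<d. ((\<Sum>j<n. q i j * zc k (y j)) / n - mean k (x i))\<^sup>2)" for i
  have F: "F i \<le> 4 * R\<^sup>2"
    "F i \<le> 2 * (\<Sum>k<d. (map_error k i s)\<^sup>2) + 6 * R\<^sup>2 * D i + 4 * R\<^sup>2 * (row_error i s)\<^sup>2" if i: "i < n" for i
  proof -
    note b = barycentre_row_bound[where p = "r i" and q = "q i" and z = "\<lambda>k j. zc k (y j)" and m = "\<lambda>k. mean k (x i)"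
        and R = R and d = d, OF n_pos pos[OF i] row[OF i] zc_sq_sum[OF ys] mean_sq_sum[OF xE(2)[OF i]]]
    show "F i \<le> 4 * R\<^sup>2" using b(1) by (simp add: F_def)
    show "F i \<le> 2 * (\<Sum>k<d. (map_error k i s)\<^sup>2) + 6 * R\<^sup>2 * D i + 4 * R\<^sup>2 * (row_error i s)\<^sup>2"
      using b(2) re[OF i] by (simp add: F_def D_def map_error_def r_def x_def y_def)
  qed
  have Fe: "ennreal ((enorm d (\<lambda>k. entropic_map d c \<epsilon> ?P ?Q (x i) k - entropic_map d c \<epsilon> \<mu> \<nu> (x i) k))\<^sup>2) = ennreal (F i)"
    if i: "i < n" for i
  proof -
    have "(enorm d (\<lambda>k. entropic_map d c \<epsilon> ?P ?Q (x i) k - entropic_map d c \<epsilon> \<mu> \<nu> (x i) k))\<^sup>2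
        = (\<Sum>k<d. (entropic_map d c \<epsilon> ?P ?Q (x i) k - entropic_map d c \<epsilon> \<mu> \<nu> (x i) k)\<^sup>2)"
      by (simp add: enorm_def L2_set_def sum_nonneg)
    also have "\<dots> = F i" unfolding F_def by (intro sum.cong refl) (simp add: diff[OF i])
    finally show ?thesis by simp
  qed
  have Ele: "E \<le> ennreal ((\<Sum>i<n. g i) / n)" if "\<And>i. i < n \<Longrightarrow> F i \<le> g i" for g
    unfolding E_def x_def[symmetric] y_def[symmetric] L2_norm_sq_def
  proof (rule nn_integral_empirical_le[OF n_pos x])
    fix i assume i: "i < n"
    show "ennreal ((enorm d (\<lambda>k. entropic_map d c \<epsilon> ?P ?Q (x i) k - entropic_map d c \<epsilon> \<mu> \<nu> (x i) k))\<^sup>2) \<le> ennreal (g i)"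
      unfolding Fe[OF i] by (rule ennreal_leI[OF that[OF i]])
    have "0 \<le> F i" unfolding F_def by (rule sum_nonneg) simp
    then show "0 \<le> g i" using that[OF i] by simp
  qed
  show "E \<le> ennreal (4 * R\<^sup>2)" using Ele[of "\<lambda>_. 4 * R\<^sup>2"] F(1) n by simp
  have lnsplit: "ln (q i j) - ln (r i j) = (ln (u' (x i)) - ln (u (x i))) + (ln (v' (y j)) - ln (v (y j)))"
    if "i < n" "j < n" for i j
    unfolding q_def r_def using ln_p[OF xE(2) yE(2)] E.ln_p[OF xE(1) yE(1)] that by simp
  have Dsum: "(\<Sum>i<n. D i) \<le> 4 / \<epsilon> * ((\<Sum>i<n. \<bar>(\<Sum>j<n. r i j) / n - 1\<bar>) + (\<Sum>j<n. \<bar>(\<Sum>i<n. r i j) / n - 1\<bar>))"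
    unfolding D_def
  proof (rule symmetrised_divergence_le[OF n_pos lnsplit _ _ row col])
    \<comment> \<open>Each of the two log-potentials is bounded by
      \<open>2 / \<epsilon>\<close>.\<close>
    show "\<bar>ln (u' (x i)) - ln (u (x i))\<bar> \<le> 4 / \<epsilon>" if "i < n" for i
      using abs_ln_u[OF xE(2)[OF that]] E.abs_ln_u[OF xE(1)[OF that]] by (simp add: abs_le_iff)
    show "\<bar>ln (v' (y i)) - ln (v (y i))\<bar> \<le> 4 / \<epsilon>" if "i < n" for i
      using abs_ln_v[OF yE(2)[OF that]] E.abs_ln_v[OF yE(1)[OF that]] by (simp add: abs_le_iff)
  qed
  have Dsum': "(\<Sum>i<n. D i) \<le> 4 / \<epsilon> * ((\<Sum>i<n. \<bar>row_error i s\<bar>) + (\<Sum>j<n. \<bar>column_error j s\<bar>))"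
    using Dsum by (simp add: re ce cong: sum.cong_simp)
  have "E \<le> ennreal ((\<Sum>i<n. 2 * (\<Sum>k<d. (map_error k i s)\<^sup>2) + 6 * R\<^sup>2 * D i + 4 * R\<^sup>2 * (row_error i s)\<^sup>2) / n)"
    by (rule Ele[OF F(2)])
  also have "\<dots> \<le> ennreal (error_bound s)"
  proof (rule ennreal_leI)
    have "(\<Sum>i<n. 2 * (\<Sum>k<d. (map_error k i s)\<^sup>2) + 6 * R\<^sup>2 * D i + 4 * R\<^sup>2 * (row_error i s)\<^sup>2)
       = (\<Sum>i<n. 2 * (\<Sum>k<d. (map_error k i s)\<^sup>2) + 4 * R\<^sup>2 * (row_error i s)\<^sup>2) + 6 * R\<^sup>2 * (\<Sum>i<n. D i)"
      by (simp add: sum.distrib sum_distrib_left)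
    also have "6 * R\<^sup>2 * (\<Sum>i<n. D i) \<le> 6 * R\<^sup>2 * (4 / \<epsilon> * ((\<Sum>i<n. \<bar>row_error i s\<bar>) + (\<Sum>j<n. \<bar>column_error j s\<bar>)))"
      by (rule mult_left_mono[OF Dsum']) simp
    finally have "(\<Sum>i<n. 2 * (\<Sum>k<d. (map_error k i s)\<^sup>2) + 6 * R\<^sup>2 * D i + 4 * R\<^sup>2 * (row_error i s)\<^sup>2) / n
       \<le> ((\<Sum>i<n. 2 * (\<Sum>k<d. (map_error k i s)\<^sup>2) + 4 * R\<^sup>2 * (row_error i s)\<^sup>2)
          + 6 * R\<^sup>2 * (4 / \<epsilon> * ((\<Sum>i<n. \<bar>row_error i s\<bar>) + (\<Sum>j<n. \<bar>column_error j s\<bar>)))) / n"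
      using n by (intro divide_right_mono) auto
    also have "\<dots> = error_bound s"
      by (simp add: error_bound_def add_divide_distrib distrib_left)
    finally show "(\<Sum>i<n. 2 * (\<Sum>k<d. (map_error k i s)\<^sup>2) + 6 * R\<^sup>2 * D i + 4 * R\<^sup>2 * (row_error i s)\<^sup>2) / n
        \<le> error_bound s" .
  qed
  finally show "E \<le> ennreal (error_bound s)" .
qed

section \<open>Expectations over the sample\<close>

lemma prob_space_sample_law: "prob_space (sample_law n \<mu> \<nu>)"
proof -
  interpret A: prob_space "\<Pi>\<^sub>M i\<in>{..<n}. \<mu>" by (rule prob_space_PiM_const) unfold_locales
  interpret B: prob_space "\<Pi>\<^sub>M j\<in>{..<n}. \<nu>" by (rule prob_space_PiM_const) unfold_locales
  interpret AB: pair_prob_space "\<Pi>\<^sub>M i\<in>{..<n}. \<mu>" "\<Pi>\<^sub>M j\<in>{..<n}. \<nu>" ..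
  show ?thesis unfolding sample_law_def by unfold_locales
qed

text \<open>Summing over the coordinates inside the integral lets the norm bound \<open>R\<close>
  act once, instead of once per coordinate.\<close>

lemma pz_sq_sum_le:
  "(\<Sum>k<d. \<integral>z. (p (fst z) (snd z) * zc k (snd z))\<^sup>2 \<partial>(\<mu> \<Otimes>\<^sub>M \<nu>)) \<le> R\<^sup>2 * p_sq"
proof -
  have int: "integrable (\<mu> \<Otimes>\<^sub>M \<nu>) (\<lambda>z. (p (fst z) (snd z) * zc k (snd z))\<^sup>2)" if "k < d" for k
    by (rule PQ.P.integral_bounded_sq(2)[of _ "exp (5 * (1 / \<epsilon>)) * R"])
      (use pz_measurable[OF that] in \<open>auto simp: split_beta' space_pair_measure intro!: pz_abs_le[simplified]\<close>)
  have "(\<Sum>k<d. \<integral>z. (p (fst z) (snd z) * zc k (snd z))\<^sup>2 \<partial>(\<mu> \<Otimes>\<^sub>M \<nu>))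
      = (\<integral>z. (\<Sum>k<d. (p (fst z) (snd z) * zc k (snd z))\<^sup>2) \<partial>(\<mu> \<Otimes>\<^sub>M \<nu>))"
    using int by (intro Bochner_Integration.integral_sum[symmetric]) auto
  also have "\<dots> \<le> (\<integral>z. R\<^sup>2 * (p (fst z) (snd z))\<^sup>2 \<partial>(\<mu> \<Otimes>\<^sub>M \<nu>))"
  proof (rule integral_mono_AE)
    show "integrable (\<mu> \<Otimes>\<^sub>M \<nu>) (\<lambda>z. \<Sum>k<d. (p (fst z) (snd z) * zc k (snd z))\<^sup>2)"
      using int by (intro Bochner_Integration.integrable_sum) auto
    show "integrable (\<mu> \<Otimes>\<^sub>M \<nu>) (\<lambda>z. R\<^sup>2 * (p (fst z) (snd z))\<^sup>2)" using integrable_p_sq by simp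
    have "AE z in \<mu> \<Otimes>\<^sub>M \<nu>. snd z \<in> supp d \<nu>"
      by (rule AE_pair_snd[OF Q.sigma_finite_measure_axioms AE_supp_\<nu>])
    then show "AE z in \<mu> \<Otimes>\<^sub>M \<nu>. (\<Sum>k<d. (p (fst z) (snd z) * zc k (snd z))\<^sup>2) \<le> R\<^sup>2 * (p (fst z) (snd z))\<^sup>2"
    proof eventually_elim
      fix z :: "point \<times> point" assume "snd z \<in> supp d \<nu>"
      then have "(p (fst z) (snd z))\<^sup>2 * (\<Sum>k<d. (zc k (snd z))\<^sup>2) \<le> (p (fst z) (snd z))\<^sup>2 * R\<^sup>2"
        by (intro mult_left_mono zc_sq_sum) auto
      then show "(\<Sum>k<d. (p (fst z) (snd z) * zc k (snd z))\<^sup>2) \<le> R\<^sup>2 * (p (fst z) (snd z))\<^sup>2"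
        by (simp add: power_mult_distrib mult.commute[of "R\<^sup>2"] flip: sum_distrib_left)
    qed
  qed
  also have "\<dots> = R\<^sup>2 * p_sq" by (simp add: p_sq_def)
  finally show ?thesis .
qed

text \<open>The 6 is 2 from the map error plus 4 from the squared row error; the 48 is 24 for each
  of the mean absolute row and column errors, which are reduced to second moments by
  \<open>integral_abs_le_sqrt\<close>.\<close>

lemma integral_error_bound:
  "integrable (sample_law n \<mu> \<nu>) error_bound"
  "(\<integral>s. error_bound s \<partial>sample_law n \<mu> \<nu>) \<le> 6 * R\<^sup>2 * (p_sq / n) + 48 * R\<^sup>2 / \<epsilon> * sqrt (p_sq / n)"
proof -
  let ?S = "sample_law n \<mu> \<nu>"
  have ps: "prob_space \<mu>" "prob_space \<nu>" by unfold_locales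
  interpret S: prob_space ?S by (rule prob_space_sample_law)
  have n: "0 < real n" using n_pos by simp
  have A: "integrable ?S (\<lambda>s. (map_error k i s)\<^sup>2)"
    "(\<integral>s. (map_error k i s)\<^sup>2 \<partial>?S) \<le> (\<integral>z. (p (fst z) (snd z) * zc k (snd z))\<^sup>2 \<partial>(\<mu> \<Otimes>\<^sub>M \<nu>)) / n"
    if i: "i < n" and k: "k < d" for i k
  proof -
    note r = sample_row_error[OF ps pz_measurable[OF k] pz_abs_le n_pos i, folded sample_law_def mean_def]
    have m: "map_error k i \<in> borel_measurable ?S" "\<And>s. s \<in> space ?S \<Longrightarrow> \<bar>map_error k i s\<bar> \<le> 2 * (exp (5 * (1 / \<epsilon>)) * R)"
      using r(1,2) unfolding map_error_def[abs_def] by auto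
    show "integrable ?S (\<lambda>s. (map_error k i s)\<^sup>2)" using m by (rule S.integral_bounded_sq(2))
    show "(\<integral>s. (map_error k i s)\<^sup>2 \<partial>?S) \<le> (\<integral>z. (p (fst z) (snd z) * zc k (snd z))\<^sup>2 \<partial>(\<mu> \<Otimes>\<^sub>M \<nu>)) / n"
      using r(3) unfolding map_error_def[abs_def] by simp
  qed
  have B: "integrable ?S (\<lambda>s. (row_error i s)\<^sup>2)" "integrable ?S (\<lambda>s. \<bar>row_error i s\<bar>)"
    "(\<integral>s. (row_error i s)\<^sup>2 \<partial>?S) \<le> p_sq / n" "(\<integral>s. \<bar>row_error i s\<bar> \<partial>?S) \<le> sqrt (p_sq / n)"
    if i: "i < n" for i
  proof -
    note r = sample_row_error[OF ps p_measurable(2) p_abs_le n_pos i, folded sample_law_def]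
    have m: "row_error i \<in> borel_measurable ?S" "\<And>s. s \<in> space ?S \<Longrightarrow> \<bar>row_error i s\<bar> \<le> 2 * exp (5 * (1 / \<epsilon>))"
      using r(1,2) unfolding row_error_def[abs_def] by auto
    show "integrable ?S (\<lambda>s. (row_error i s)\<^sup>2)" using m by (rule S.integral_bounded_sq(2))
    show "integrable ?S (\<lambda>s. \<bar>row_error i s\<bar>)" using S.integral_bounded_sq(1)[OF m] by simp
    show le: "(\<integral>s. (row_error i s)\<^sup>2 \<partial>?S) \<le> p_sq / n"
      using r(3) unfolding row_error_def[abs_def] p_sq_def by simp
    show "(\<integral>s. \<bar>row_error i s\<bar> \<partial>?S) \<le> sqrt (p_sq / n)"
      using S.integral_abs_le_sqrt[OF m] real_sqrt_le_mono[OF le] by linarith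
  qed
  have C: "integrable ?S (\<lambda>s. \<bar>column_error j s\<bar>)" "(\<integral>s. \<bar>column_error j s\<bar> \<partial>?S) \<le> sqrt (p_sq / n)"
    if j: "j < n" for j
  proof -
    note r = sample_column_error[OF ps p_measurable(2) p_abs_le n_pos j, folded sample_law_def]
    have m: "column_error j \<in> borel_measurable ?S" "\<And>s. s \<in> space ?S \<Longrightarrow> \<bar>column_error j s\<bar> \<le> 2 * exp (5 * (1 / \<epsilon>))"
      using r(1,2) unfolding column_error_def[abs_def] by auto
    show "integrable ?S (\<lambda>s. \<bar>column_error j s\<bar>)" using S.integral_bounded_sq(1)[OF m] by simp
    have le: "(\<integral>s. (column_error j s)\<^sup>2 \<partial>?S) \<le> p_sq / n"
      using r(3) unfolding column_error_def[abs_def] p_sq_def by simp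
    show "(\<integral>s. \<bar>column_error j s\<bar> \<partial>?S) \<le> sqrt (p_sq / n)"
      using S.integral_abs_le_sqrt[OF m] real_sqrt_le_mono[OF le] by linarith
  qed
  define G1 where "G1 i s = 2 * (\<Sum>k<d. (map_error k i s)\<^sup>2) + 4 * R\<^sup>2 * (row_error i s)\<^sup>2" for i s
  have G1i: "integrable ?S (G1 i)" if "i < n" for i
    unfolding G1_def[abs_def] using A(1)[OF that] B(1)[OF that]
    by (intro Bochner_Integration.integrable_add integrable_mult_right Bochner_Integration.integrable_sum) auto
  have G1le: "(\<integral>s. G1 i s \<partial>?S) \<le> 6 * R\<^sup>2 * (p_sq / n)" if i: "i < n" for i
  proof -
    have eq: "(\<integral>s. G1 i s \<partial>?S) = 2 * (\<Sum>k<d. \<integral>s. (map_error k i s)\<^sup>2 \<partial>?S) + 4 * R\<^sup>2 * (\<integral>s. (row_error i s)\<^sup>2 \<partial>?S)"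
    proof -
      have "(\<integral>s. (\<Sum>k<d. (map_error k i s)\<^sup>2) \<partial>?S) = (\<Sum>k<d. \<integral>s. (map_error k i s)\<^sup>2 \<partial>?S)"
        using A(1)[OF i] by (intro Bochner_Integration.integral_sum) auto
      moreover have "integrable ?S (\<lambda>s. \<Sum>k<d. (map_error k i s)\<^sup>2)"
        using A(1)[OF i] by (intro Bochner_Integration.integrable_sum) auto
      ultimately show ?thesis unfolding G1_def using B(1)[OF i] by simp
    qed
    have "(\<Sum>k<d. \<integral>s. (map_error k i s)\<^sup>2 \<partial>?S) \<le> (\<Sum>k<d. (\<integral>z. (p (fst z) (snd z) * zc k (snd z))\<^sup>2 \<partial>(\<mu> \<Otimes>\<^sub>M \<nu>)) / n)"
      using A(2)[OF i] by (intro sum_mono) auto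
    also have "\<dots> \<le> R\<^sup>2 * p_sq / n"
      unfolding sum_divide_distrib[symmetric] by (rule divide_right_mono[OF pz_sq_sum_le]) simp
    finally have "(\<Sum>k<d. \<integral>s. (map_error k i s)\<^sup>2 \<partial>?S) \<le> R\<^sup>2 * (p_sq / n)" by simp
    moreover have "4 * R\<^sup>2 * (\<integral>s. (row_error i s)\<^sup>2 \<partial>?S) \<le> 4 * R\<^sup>2 * (p_sq / n)"
      using B(3)[OF i] by (intro mult_left_mono) auto
    ultimately show ?thesis unfolding eq by linarith
  qed
  have eb: "error_bound = (\<lambda>s. (\<Sum>i<n. G1 i s) / n
      + 24 * R\<^sup>2 / \<epsilon> * ((\<Sum>i<n. \<bar>row_error i s\<bar>) / n + (\<Sum>j<n. \<bar>column_error j s\<bar>) / n))"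
    by (simp add: fun_eq_iff error_bound_def G1_def)
  have i1: "integrable ?S (\<lambda>s. \<Sum>i<n. G1 i s)" "integrable ?S (\<lambda>s. \<Sum>i<n. \<bar>row_error i s\<bar>)"
    "integrable ?S (\<lambda>s. \<Sum>j<n. \<bar>column_error j s\<bar>)"
    using G1i B(2) C(1) by (auto intro!: Bochner_Integration.integrable_sum)
  show "integrable ?S error_bound" unfolding eb using i1 by simp
  have avg: "(\<integral>s. (\<Sum>i<n. h i s) \<partial>?S) / n \<le> K" if h: "\<And>i. i < n \<Longrightarrow> integrable ?S (h i)" "\<And>i. i < n \<Longrightarrow> (\<integral>s. h i s \<partial>?S) \<le> K" for h K
  proof -
    have "(\<integral>s. (\<Sum>i<n. h i s) \<partial>?S) = (\<Sum>i<n. \<integral>s. h i s \<partial>?S)"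
      using h(1) by (intro Bochner_Integration.integral_sum) auto
    also have "\<dots> \<le> (\<Sum>i<n. K)" using h(2) by (intro sum_mono) auto
    finally show ?thesis using n by (simp add: pos_divide_le_eq mult.commute)
  qed
  have "(\<integral>s. error_bound s \<partial>?S) = (\<integral>s. (\<Sum>i<n. G1 i s) \<partial>?S) / n
      + 24 * R\<^sup>2 / \<epsilon> * ((\<integral>s. (\<Sum>i<n. \<bar>row_error i s\<bar>) \<partial>?S) / n + (\<integral>s. (\<Sum>j<n. \<bar>column_error j s\<bar>) \<partial>?S) / n)"
    unfolding eb using i1 by simp
  also have "\<dots> \<le> 6 * R\<^sup>2 * (p_sq / n) + 24 * R\<^sup>2 / \<epsilon> * (sqrt (p_sq / n) + sqrt (p_sq / n))"
    using \<epsilon>_pos by (intro add_mono mult_left_mono avg G1i G1le B(2,4) C) auto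
  also have "\<dots> = 6 * R\<^sup>2 * (p_sq / n) + 48 * R\<^sup>2 / \<epsilon> * sqrt (p_sq / n)" by simp
  finally show "(\<integral>s. error_bound s \<partial>?S) \<le> 6 * R\<^sup>2 * (p_sq / n) + 48 * R\<^sup>2 / \<epsilon> * sqrt (p_sq / n)" .
qed

lemma error_bound_nonneg: "0 \<le> error_bound s"
  unfolding error_bound_def using \<epsilon>_pos
  by (intro add_nonneg_nonneg mult_nonneg_nonneg divide_nonneg_nonneg sum_nonneg) auto

text \<open>With \<open>t = exp 4 * N / n\<close>, the trivial bound wins for \<open>t > 1\<close>.
  For \<open>t \<le> 1\<close> one has \<open>t \<le> sqrt t\<close>, which absorbs the quadratic
  errors into the root, so the linear errors dictate the constant 48. The factor
  \<open>exp 2\<close> is the root of \<open>exp 4\<close>.\<close>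

lemma expected_error_le:
  assumes N: "p_sq \<le> exp 4 * N" and N0: "0 \<le> N"
  shows "(\<integral>\<^sup>+ s. L2_norm_sq d (empirical d n (fst s))
                (\<lambda>x k. entropic_map d c \<epsilon> (empirical d n (fst s)) (empirical d n (snd s)) x k
                        - entropic_map d c \<epsilon> \<mu> \<nu> x k) \<partial>sample_law n \<mu> \<nu>)
       \<le> ennreal (48 * exp 2 * R\<^sup>2 * (1 + 1 / \<epsilon>) * sqrt (N / n))" (is "?E \<le> _")
proof -
  interpret S: prob_space "sample_law n \<mu> \<nu>" by (rule prob_space_sample_law)
  have n: "0 < real n" using n_pos by simp
  define t where "t = exp 4 * N / n"
  have t0: "0 \<le> t" using N0 n by (simp add: t_def)
  have "sqrt t = sqrt ((exp 2)\<^sup>2 * (N / n))" by (simp add: t_def flip: exp_double)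
  then have sqt: "sqrt t = exp 2 * sqrt (N / n)" by (simp only: real_sqrt_mult) simp
  have goal: "48 * exp 2 * R\<^sup>2 * (1 + 1 / \<epsilon>) * sqrt (N / n) = 48 * R\<^sup>2 * (1 + 1 / \<epsilon>) * sqrt t"
    by (simp add: sqt mult_ac)
  have exp_le: "1 \<le> 1 + 1 / \<epsilon>" using \<epsilon>_pos by simp
  show ?thesis
  proof (cases "t \<le> 1")
    case False
    then have "1 \<le> sqrt t" by simp
    have "?E \<le> (\<integral>\<^sup>+ s. ennreal (4 * R\<^sup>2) \<partial>sample_law n \<mu> \<nu>)"
      using AE_good by (intro nn_integral_mono_AE) (auto elim!: eventually_mono intro: L2_error_le(1))
    also have "\<dots> = ennreal (4 * R\<^sup>2)" by (simp add: S.emeasure_space_1)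
    also have "\<dots> \<le> ennreal (48 * R\<^sup>2 * (1 + 1 / \<epsilon>) * sqrt t)"
    proof (rule ennreal_leI)
      have "4 * R\<^sup>2 * 1 * 1 \<le> 48 * R\<^sup>2 * (1 + 1 / \<epsilon>) * sqrt t"
        using exp_le \<open>1 \<le> sqrt t\<close> by (intro mult_mono) auto
      then show "4 * R\<^sup>2 \<le> 48 * R\<^sup>2 * (1 + 1 / \<epsilon>) * sqrt t" by simp
    qed
    finally show ?thesis unfolding goal .
  next
    case True
    have pt: "p_sq / n \<le> t" unfolding t_def using N n by (intro divide_right_mono) auto
    have "t\<^sup>2 \<le> t" using t0 True by (simp add: power2_eq_square mult_left_le_one_le)
    then have tt: "t \<le> sqrt t" using t0 by (intro real_le_rsqrt)
    \<comment> \<open>Integrability is required of the dominating function alone; the empirical map,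
      which depends on the sample through a choice of densities, is compared by
      monotonicity.\<close>
    have "?E \<le> (\<integral>\<^sup>+ s. ennreal (error_bound s) \<partial>sample_law n \<mu> \<nu>)"
      using AE_good by (intro nn_integral_mono_AE) (auto elim!: eventually_mono intro: L2_error_le(2))
    also have "\<dots> = ennreal (\<integral>s. error_bound s \<partial>sample_law n \<mu> \<nu>)"
      by (rule nn_integral_eq_integral[OF integral_error_bound(1)]) (simp add: error_bound_nonneg)
    also have "\<dots> \<le> ennreal (48 * R\<^sup>2 * (1 + 1 / \<epsilon>) * sqrt t)"
    proof (rule ennreal_leI)
      have "(\<integral>s. error_bound s \<partial>sample_law n \<mu> \<nu>) \<le> 6 * R\<^sup>2 * (p_sq / n) + 48 * R\<^sup>2 / \<epsilon> * sqrt (p_sq / n)"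
        by (rule integral_error_bound(2))
      also have "\<dots> \<le> 48 * R\<^sup>2 * sqrt t + 48 * R\<^sup>2 / \<epsilon> * sqrt t"
      proof (rule add_mono)
        show "6 * R\<^sup>2 * (p_sq / n) \<le> 48 * R\<^sup>2 * sqrt t"
          using pt tt p_sq_nonneg n by (intro mult_mono) auto
        show "48 * R\<^sup>2 / \<epsilon> * sqrt (p_sq / n) \<le> 48 * R\<^sup>2 / \<epsilon> * sqrt t"
          using pt \<epsilon>_pos by (intro mult_left_mono) auto
      qed
      also have "\<dots> = 48 * R\<^sup>2 * (1 + 1 / \<epsilon>) * sqrt t" by (simp add: algebra_simps)
      finally show "(\<integral>s. error_bound s \<partial>sample_law n \<mu> \<nu>) \<le> 48 * R\<^sup>2 * (1 + 1 / \<epsilon>) * sqrt t" .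
    qed
    finally show ?thesis unfolding goal .
  qed
qed

end

text \<open>The second moment of \<open>p\<close> does not change when the two sides are exchanged,
  so cells may be taken in whichever space needs fewer of them. This is the source of the
  minimum.\<close>

lemma gibbs_p_sq_le_min_covering:
  assumes sys: "schrodinger_system \<mu> \<nu> (gibbs_kernel c \<epsilon>) u v (1 / \<epsilon>)"
    and \<mu>: "borel_prob d \<mu>" and \<nu>: "borel_prob d \<nu>" and L: "0 < L" and \<epsilon>: "0 < \<epsilon>"
    and c: "cost_assumption d \<mu> \<nu> L c"
    and diam: "\<And>y y'. y \<in> supp d \<nu> \<Longrightarrow> y' \<in> supp d \<nu> \<Longrightarrow> edist d y y' \<le> R"
  shows "schrodinger_system.p_sq \<mu> \<nu> (gibbs_kernel c \<epsilon>) u v \<le> exp 4 * min_covering d \<mu> \<nu> (\<epsilon> / L)"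
proof -
  interpret schrodinger_system \<mu> \<nu> "gibbs_kernel c \<epsilon>" u v "1 / \<epsilon>" by fact
  let ?a = "covering_number d \<mu> (\<epsilon> / L)" and ?b = "covering_number d \<nu> (\<epsilon> / L)"
  have scale: "L * t \<le> 2 * \<epsilon>" if "t \<le> 2 * (\<epsilon> / L)" for t
    using mult_left_mono[OF that, of L] L by simp
  have b: "?b \<noteq> \<infinity>"
    by (rule covering_number_finite[OF diam _ \<nu>]) (use L \<epsilon> in auto)
  have le_a: "p_norm_sq \<le> ennreal (exp 4 * N)" if "?a = enat N" for N
  proof (rule p_norm_sq_le_covering[OF sys \<mu> \<nu> L \<epsilon> _ that])
    fix x x' y assume *: "x \<in> supp d \<mu>" "x' \<in> supp d \<mu>" "y \<in> supp d \<nu>" "edist d x x' \<le> 2 * (\<epsilon> / L)"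
    then have "\<bar>c x y - c x' y\<bar> \<le> L * edist d x x'" using c by (auto simp: cost_assumption_def)
    also have "\<dots> \<le> 2 * \<epsilon>" by (rule scale[OF *(4)])
    finally have "\<bar>c x y - c x' y\<bar> \<le> 2 * \<epsilon>" .
    then show "gibbs_kernel c \<epsilon> x y \<le> exp 2 * gibbs_kernel c \<epsilon> x' y" by (intro gibbs_kernel_ratio \<epsilon>)
  qed
  have le_b: "p_norm_sq \<le> ennreal (exp 4 * N)" if "?b = enat N" for N
    unfolding p_norm_sq_swap[symmetric]
  proof (rule p_norm_sq_le_covering[OF swap \<nu> \<mu> L \<epsilon> _ that])
    fix y y' x assume *: "y \<in> supp d \<nu>" "y' \<in> supp d \<nu>" "x \<in> supp d \<mu>" "edist d y y' \<le> 2 * (\<epsilon> / L)"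
    then have "\<bar>c x y - c x y'\<bar> \<le> L * edist d y y'" using c by (auto simp: cost_assumption_def)
    also have "\<dots> \<le> 2 * \<epsilon>" by (rule scale[OF *(4)])
    finally have "\<bar>c x y - c x y'\<bar> \<le> 2 * \<epsilon>" .
    then show "gibbs_kernel c \<epsilon> x y \<le> exp 2 * gibbs_kernel c \<epsilon> x y'" by (intro gibbs_kernel_ratio \<epsilon>)
  qed
  obtain N where N: "min ?a ?b = enat N" using b by (cases "min ?a ?b") (auto simp: min_def split: if_splits)
  then have "?a = enat N \<or> ?b = enat N" by (auto simp: min_def split: if_splits)
  then have "ennreal p_sq \<le> ennreal (exp 4 * N)" unfolding p_norm_sq_eq[symmetric] using le_a le_b by blast
  moreover have "min_covering d \<mu> \<nu> (\<epsilon> / L) = N" by (simp add: min_covering_def N)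
  ultimately show ?thesis by (simp add: ennreal_le_iff)
qed

theorem theorem3:
  shows "\<exists>C::real. C > 0 \<and>
    (\<forall>(d::nat) (\<mu>::point measure) (\<nu>::point measure) (c::point \<Rightarrow> point \<Rightarrow> real)
       (L::real) (\<epsilon>::real) (n::nat) (R::real).
       d \<ge> 1 \<longrightarrow> borel_prob d \<mu> \<longrightarrow> borel_prob d \<nu> \<longrightarrow>
       L > 0 \<longrightarrow> cost_assumption d \<mu> \<nu> L c \<longrightarrow>
       \<epsilon> > 0 \<longrightarrow> n \<ge> 1 \<longrightarrow>
       R > 0 \<longrightarrow> (\<forall>y\<in>supp d \<nu>. \<forall>y'\<in>supp d \<nu>. edist d y y' \<le> R) \<longrightarrow>
       (\<integral>\<^sup>+ s. L2_norm_sq d (empirical d n (fst s))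
                (\<lambda>x k. entropic_map d c \<epsilon> (empirical d n (fst s)) (empirical d n (snd s)) x k
                        - entropic_map d c \<epsilon> \<mu> \<nu> x k)
          \<partial>sample_law n \<mu> \<nu>)
       \<le> ennreal (C * R\<^sup>2 * (1 + 1 / \<epsilon>)
                    * sqrt (min_covering d \<mu> \<nu> (\<epsilon> / L) / real n)))"
proof (rule exI[of _ "48 * exp 2"], intro conjI allI impI)
  fix d n :: nat and \<mu> \<nu> :: "point measure" and c :: "point \<Rightarrow> point \<Rightarrow> real" and L \<epsilon> R :: real
  assume \<mu>: "borel_prob d \<mu>" and \<nu>: "borel_prob d \<nu>" and L: "L > 0" and c: "cost_assumption d \<mu> \<nu> L c"
    and \<epsilon>: "\<epsilon> > 0" and n: "n \<ge> 1" and R: "R > 0" and diam: "\<forall>y\<in>supp d \<nu>. \<forall>y'\<in>supp d \<nu>. edist d y y' \<le> R"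
  have ps: "prob_space \<mu>" "prob_space \<nu>" and sets: "sets \<mu> = sets (Rd d)" "sets \<nu> = sets (Rd d)"
    using \<mu> \<nu> by (auto simp: borel_prob_def)
  have cm: "(\<lambda>(x, y). c x y) \<in> borel_measurable (Rd d \<Otimes>\<^sub>M Rd d)"
    and cb: "AE z in \<mu> \<Otimes>\<^sub>M \<nu>. \<bar>c (fst z) (snd z)\<bar> \<le> 1"
    using c by (auto simp: cost_assumption_def)
  have "(\<lambda>(x, y). c x y) \<in> borel_measurable (\<mu> \<Otimes>\<^sub>M \<nu>)"
    using cm measurable_cong_sets[OF sets_pair_measure_cong[OF sets] refl] by blast
  then obtain u v where sys: "schrodinger_system \<mu> \<nu> (gibbs_kernel c \<epsilon>) u v (1 / \<epsilon>)"
    using gibbs_system_exists[OF ps \<epsilon>] by blast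
  obtain y0 where y0: "y0 \<in> supp d \<nu>" using supp_nonempty[OF \<nu>] by blast
  interpret entropic_sampling \<mu> \<nu> c \<epsilon> u v d n R y0
    by (intro entropic_sampling.intro entropic_sampling_axioms.intro sys \<mu> \<nu> cm cb \<epsilon> n R y0) (use diam in blast)
  have "p_sq \<le> exp 4 * min_covering d \<mu> \<nu> (\<epsilon> / L)"
    by (rule gibbs_p_sq_le_min_covering[OF sys \<mu> \<nu> L \<epsilon> c]) (use diam in blast)
  then show "(\<integral>\<^sup>+ s. L2_norm_sq d (empirical d n (fst s))
                (\<lambda>x k. entropic_map d c \<epsilon> (empirical d n (fst s)) (empirical d n (snd s)) x k
                        - entropic_map d c \<epsilon> \<mu> \<nu> x k)
          \<partial>sample_law n \<mu> \<nu>)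
       \<le> ennreal (48 * exp 2 * R\<^sup>2 * (1 + 1 / \<epsilon>) * sqrt (min_covering d \<mu> \<nu> (\<epsilon> / L) / real n))"
    by (rule expected_error_le) (simp add: min_covering_def)
qed simp

end
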